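(* Let $\mathcal{U}\subseteq\mathbb{F}^n$ be an algebraic set of degree $n$ all of whose components are of dimension $1$. Then $\mathcal{U}$ is a primitive $\alpha$-hypercircle if and only if it has an infinite number of points with coordinates in $\mathbb{K}$ and its projective closure passes through all the points of the set $P=\{P_1,\ldots,P_n\}$ of points at infinity, where $P_j$ is the unique point of the hyperplane at infinity $\{X_n=0\}\subseteq\mathbb{P}(\mathbb{F})^n$ lying on the hyperplanes $X_0+\alpha_kX_1+\cdots+\alpha_k^{n-1}X_{n-1}=0$ for all $k\in\{1,\ldots,n\}$, $k\neq j$, and $\alpha_1,\ldots,\alpha_n$ are the conjugates of $\alpha$ over $\mathbb{K}$.
   Context: $\mathbb{K}$ is a field of characteristic zero, $\mathbb{L}=\mathbb{K}(\alpha)$ is a finite algebraic extension of $\mathbb{K}$ of degree $n$ with primitive element $\alpha$, and $\mathbb{F}$ is the algebraic closure of $\mathbb{K}$. A unit of $\mathbb{L}(t)$ (under composition) is a rational function $u(t)=\frac{at+b}{ct+d}$ with $a,b,c,d\in\mathbb{L}$, $ad-bc\neq 0$. Every unit $u(t)\in\mathbb{L}(t)$ is written uniquely as $u(t)=\sum_{i=0}^{n-1}\phi_i(t)\alpha^i$ with $\phi_i(t)\in\mathbb{K}(t)$, and the $\alpha$-hypercircle generated by $u(t)$ is the rational curve in $\mathbb{F}^n$ parametrized by $(\phi_0(t),\ldots,\phi_{n-1}(t))$ (Zariski closure of the image). An $\alpha$-hypercircle is primitive if its degree as a curve equals $n=[\mathbb{K}(\alpha):\mathbb{K}]$. $\mathbb{F}^n$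 is embedded in $\mathbb{P}(\mathbb{F})^n$ via $(X_0,\ldots,X_{n-1})\mapsto[X_0:\cdots:X_{n-1}:1]$. The set $P$ is the common set of points at infinity of all primitive $\alpha$-hypercircles. *)

theory Defs
  imports
    "HOL-Algebra.Algebraic_Closure_Type"
    "HOL-Algebra.Generated_Fields"
    "HOL-Library.Poly_Mapping"
    "HOL-Library.Extended_Nat"
    "Jordan_Normal_Form.Matrix"
begin

text \<open>
  The field \<open>K\<close> is the type \<open>'k\<close>, its algebraic closure \<open>F\<close> is the type \<open>'k alg_closure\<close>, with
  embedding \<^const>\<open>to_ac\<close>. All the fields \<open>K \<subseteq> K(\<alpha>) \<subseteq> F\<close> are regarded as subsets of \<open>F\<close>, and
  \<open>F\<^sup>n\<close> is \<open>carrier_vec n\<close>.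
\<close>

section \<open>The extension generated by an element, and conjugates\<close>

definition base_field :: "'k::field alg_closure set" where
  "base_field = range to_ac"

definition adjoin :: "'k::field alg_closure \<Rightarrow> 'k alg_closure set" where
  "adjoin \<alpha> = generate_field ring_of_type_algebra (insert \<alpha> base_field)"

definition ext_degree :: "'k::field alg_closure \<Rightarrow> nat" where
  "ext_degree \<alpha> = vector_space.dim (\<lambda>(c::'k) x. to_ac c * x) (adjoin \<alpha>)"

definition min_poly :: "'k::field alg_closure \<Rightarrow> 'k poly" where
  "min_poly \<alpha> = (THE p. lead_coeff p = 1 \<and> Factorial_Ring.irreducible p \<and>
                        poly (map_poly to_ac p) \<alpha> = 0)"

definition conjugates :: "'k::field alg_closure \<Rightarrow> 'k alg_closure set" where
  "conjugates \<alpha> = {\<beta>. poly (map_poly to_ac (min_poly \<alpha>)) \<beta> = 0}"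


section \<open>Rational functions\<close>

text \<open>For a subfield \<open>S\<close> of \<open>F\<close>, the subfield \<open>S(t)\<close> of \<open>F(t)\<close>.\<close>

definition ratfuns :: "'a::field set \<Rightarrow> 'a poly fract set" where
  "ratfuns S = {Fract p q | p q. set (Polynomial.coeffs p) \<subseteq> S \<and> set (Polynomial.coeffs q) \<subseteq> S \<and> q \<noteq> 0}"

text \<open>
  \<open>ratfun_value f t x\<close>: the rational function \<open>f\<close> is defined at \<open>t\<close> and takes the value \<open>x\<close> there.
  The value does not depend on the chosen representation of \<open>f\<close> with nonvanishing denominator.
\<close>

definition ratfun_value :: "'a::field poly fract \<Rightarrow> 'a \<Rightarrow> 'a \<Rightarrow> bool" where
  "ratfun_value f t x \<longleftrightarrow> (\<exists>p q. f = Fract p q \<and> poly q t \<noteq> 0 \<and> x = poly p t / poly q t)"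

definition is_unit_over :: "'a::field set \<Rightarrow> 'a poly fract \<Rightarrow> bool" where
  "is_unit_over S u \<longleftrightarrow>
     (\<exists>a\<in>S. \<exists>b\<in>S. \<exists>c\<in>S. \<exists>d\<in>S. a * d - b * c \<noteq> 0 \<and> u = Fract [:b, a:] [:d, c:])"


section \<open>Polynomials in several variables and affine algebraic sets\<close>

type_synonym 'a mpol = "(nat \<Rightarrow>\<^sub>0 nat) \<Rightarrow>\<^sub>0 'a"

text \<open>The polynomials in the variables \<open>X\<^sub>0, \<dots>, X\<^bsub>n-1\<^esub>\<close>.\<close>

definition mpols :: "nat \<Rightarrow> 'a::comm_ring_1 mpol set" where
  "mpols n = {p. \<forall>m\<in>Poly_Mapping.keys p. Poly_Mapping.keys m \<subseteq> {..<n}}"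

definition mpol_eval :: "'a::comm_ring_1 mpol \<Rightarrow> 'a vec \<Rightarrow> 'a" where
  "mpol_eval p x = (\<Sum>m\<in>Poly_Mapping.keys p.
     Poly_Mapping.lookup p m * (\<Prod>i\<in>Poly_Mapping.keys m. (x $ i) ^ Poly_Mapping.lookup m i))"

definition homogeneous :: "'a::comm_ring_1 mpol \<Rightarrow> bool" where
  "homogeneous p \<longleftrightarrow> (\<exists>d. \<forall>m\<in>Poly_Mapping.keys p.
     (\<Sum>i\<in>Poly_Mapping.keys m. Poly_Mapping.lookup m i) = d)"

definition algebraic_set :: "nat \<Rightarrow> 'a::field vec set \<Rightarrow> bool" where
  "algebraic_set n V \<longleftrightarrow>
     (\<exists>I\<subseteq>mpols n. V = {x \<in> carrier_vec n. \<forall>p\<in>I. mpol_eval p x = 0})"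

definition zariski_closure :: "nat \<Rightarrow> 'a::field vec set \<Rightarrow> 'a vec set" where
  "zariski_closure n S = \<Inter>{V. algebraic_set n V \<and> S \<subseteq> V}"

definition irreducible_set :: "nat \<Rightarrow> 'a::field vec set \<Rightarrow> bool" where
  "irreducible_set n V \<longleftrightarrow> algebraic_set n V \<and> V \<noteq> {} \<and>
     (\<forall>A B. algebraic_set n A \<and> algebraic_set n B \<and> V = A \<union> B \<longrightarrow> A = V \<or> B = V)"

definition components :: "nat \<Rightarrow> 'a::field vec set \<Rightarrow> 'a vec set set" where
  "components n V = {C. irreducible_set n C \<and> C \<subseteq> V \<and>
     (\<forall>D. irreducible_set n D \<and> C \<subseteq> D \<and> D \<subseteq> V \<longrightarrow> D = C)}"

text \<open>
  Krull dimension: the supremum of the lengths of chains of irreducible closed subsets. It is only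
  meaningful for nonempty \<open>V\<close>, as the empty set gets dimension \<open>0\<close>.
\<close>

definition zariski_dim :: "nat \<Rightarrow> 'a::field vec set \<Rightarrow> enat" where
  "zariski_dim n V = Sup {enat d | d. \<exists>Z. (\<forall>i\<le>d. irreducible_set n (Z i) \<and> Z i \<subseteq> V) \<and>
                                          (\<forall>i<d. Z i \<subset> Z (Suc i))}"

text \<open>The embedding of affine into projective coordinates, \<open>x \<mapsto> (x, 1)\<close>.\<close>

definition append_one :: "'a::field vec \<Rightarrow> 'a vec" where
  "append_one x = x @\<^sub>v vec 1 (\<lambda>_. 1)"

text \<open>
  The degree of an algebraic set of pure dimension one: the number of its intersection points with
  a generic hyperplane \<open>a\<^sub>0 X\<^sub>0 + \<dots> + a\<^bsub>n-1\<^esub> X\<^bsub>n-1\<^esub> + a\<^sub>n = 0\<close>, where generic means that \<open>a\<close> lies outside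
  the zero set of some nonzero polynomial \<open>G\<close>.
\<close>

definition has_curve_degree :: "nat \<Rightarrow> 'a::field vec set \<Rightarrow> nat \<Rightarrow> bool" where
  "has_curve_degree n V d \<longleftrightarrow>
     (\<exists>G\<in>mpols (n + 1). G \<noteq> 0 \<and>
        (\<forall>a\<in>carrier_vec (n + 1). mpol_eval G a \<noteq> 0 \<longrightarrow>
           finite {x \<in> V. a \<bullet> append_one x = 0} \<and> card {x \<in> V. a \<bullet> append_one x = 0} = d))"


section \<open>Projective space\<close>

definition proj_point :: "'a::field vec \<Rightarrow> 'a vec set" where
  "proj_point v = {c \<cdot>\<^sub>v v | c. c \<noteq> 0}"

definition proj_space :: "nat \<Rightarrow> 'a::field vec set set" where
  "proj_space n = {proj_point v | v. v \<in> carrier_vec (n + 1) \<and> v \<noteq> 0\<^sub>v (n + 1)}"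

definition proj_hyperplane :: "nat \<Rightarrow> 'a::field vec \<Rightarrow> 'a vec set set" where
  "proj_hyperplane n a = {Q \<in> proj_space n. \<forall>v\<in>Q. a \<bullet> v = 0}"

definition proj_algebraic_set :: "nat \<Rightarrow> 'a::field vec set set \<Rightarrow> bool" where
  "proj_algebraic_set n W \<longleftrightarrow>
     (\<exists>I\<subseteq>{p \<in> mpols (n + 1). homogeneous p}.
        W = {Q \<in> proj_space n. \<forall>p\<in>I. \<forall>v\<in>Q. mpol_eval p v = 0})"

definition proj_closure :: "nat \<Rightarrow> 'a::field vec set \<Rightarrow> 'a vec set set" where
  "proj_closure n U = \<Inter>{W. proj_algebraic_set n W \<and> (\<lambda>x. proj_point (append_one x)) ` U \<subseteq> W}"

text \<open>
  The point \<open>P\<^sub>j\<close>: the unique point at infinity (\<open>X\<^sub>n = 0\<close>) lying on the hyperplanes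
  \<open>X\<^sub>0 + \<alpha>\<^sub>k X\<^sub>1 + \<dots> + \<alpha>\<^sub>k\<^bsup>n-1\<^esup> X\<^bsub>n-1\<^esub> = 0\<close> for all \<open>k \<noteq> j\<close>.
\<close>

definition point_at_infinity :: "nat \<Rightarrow> (nat \<Rightarrow> 'a::field) \<Rightarrow> nat \<Rightarrow> 'a vec set" where
  "point_at_infinity n as j =
     (THE Q. Q \<in> proj_hyperplane n (unit_vec (n + 1) n) \<and>
             (\<forall>k\<in>{1..n} - {j}.
                Q \<in> proj_hyperplane n (vec (n + 1) (\<lambda>i. if i < n then as k ^ i else 0))))"


section \<open>Hypercircles\<close>

definition hypercircle :: "'k::field_char_0 alg_closure \<Rightarrow> 'k alg_closure vec set \<Rightarrow> bool" where
  "hypercircle \<alpha> U \<longleftrightarrow> (\<exists>u \<phi>. let n = ext_degree \<alpha> in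
     is_unit_over (adjoin \<alpha>) u \<and>
     (\<forall>i<n. \<phi> i \<in> ratfuns base_field) \<and>
     u = (\<Sum>i<n. \<phi> i * to_fract [:\<alpha> ^ i:]) \<and>
     U = zariski_closure n {x \<in> carrier_vec n. \<exists>t. \<forall>i<n. ratfun_value (\<phi> i) t (x $ i)})"

definition primitive_hypercircle ::
    "'k::field_char_0 alg_closure \<Rightarrow> 'k alg_closure vec set \<Rightarrow> bool" where
  "primitive_hypercircle \<alpha> U \<longleftrightarrow>
     hypercircle \<alpha> U \<and> has_curve_degree (ext_degree \<alpha>) U (ext_degree \<alpha>)"

end

(*  Let Y_k be the linear forms x |-> sum_i alpha_k^i x_i. In these coordinates P_j is the j-th coordinate
    point at infinity, a point over the base field has coordinates the conjugates of an element of K(alpha),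
    and a hypercircle is parametrized by the conjugates of a unit.

    If a hypercircle has degree n, the poles of the conjugate units are pairwise distinct, since otherwise
    the hyperplane sections have fewer than n points; letting the parameter tend to the j-th pole gives P_j.

    Conversely, sections by the hyperplanes of a pencil h_0 = e h_1 specialize, as e tends to 0, to a section
    h_0 = 0 of the projective closure, and this bounds the number of points of the latter on each irreducible
    component. At infinity the bound shows that every component passes through some P_k. A component with
    infinitely many points over K is defined over K, hence passes through all of them, and no other
    component is left. On the hyperplane Y_k = t, which contains the P_j with j different from k, the bound
    shows that Y_k is injective on U. So Y_j is a rational function of degree one of Y_k, and the unit with
    prescribed values at 0, 1 and infinity, taken from three points over K, parametrizes U.

    That sections of the pencil have sufficiently many points rests on extending specializations, one ring
    generator at a time. *)

theory Submission
  imports Defs "HOL-Library.Function_Algebras"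
begin

section \<open>Extending specializations\<close>

text \<open>About \<open>U\<close> only the number of points on generic affine hyperplane sections
  is known, whereas the sections that matter are special. A special section is therefore never
  counted directly: its points in the projective closure give a lower bound for the degree of a
  function h2 / h1 over the rational functions of h0 / h1, stated as \<open>no_relation\<close>, and
  this bound gives as many points on h0 = e h1. Function fields occur only through membership in the
  ideal of functions vanishing on the component, inside the ring of all functions on vectors. Each
  extension of a specialization costs one nonzero element of the smaller ring that must not be
  killed; pushed down to the polynomials in h0 / h1, it excludes finitely many e. Distinct
  extensions require simple roots, hence characteristic zero. Galois automorphisms are replaced by
  one rule: a polynomial over K that vanishes at one conjugate of \<alpha> vanishes at all of them.
  For this reason elements of K(\<alpha>), coefficients of units and points at infinity are all
  given by polynomials over K that are evaluated at a conjugate.\<close>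

definition is_subring :: "'r::comm_ring_1 set \<Rightarrow> bool" where
  "is_subring R \<longleftrightarrow> 1 \<in> R \<and> (\<forall>a\<in>R. \<forall>b\<in>R. a + b \<in> R \<and> a * b \<in> R \<and> - a \<in> R)"

definition polys_over :: "'r::comm_ring_1 set \<Rightarrow> 'r poly set" where
  "polys_over R = {p. \<forall>i. coeff p i \<in> R}"

definition adj :: "'r::comm_ring_1 set \<Rightarrow> 'r \<Rightarrow> 'r set" where
  "adj R y = {poly p y | p. p \<in> polys_over R}"

text \<open>The derivative is given by its coefficients because the coefficient ring will be a ring
  of functions, which has zero divisors.\<close>

definition formal_deriv :: "'r::comm_ring_1 poly \<Rightarrow> 'r poly" where
  "formal_deriv p = (\<Sum>i<degree p. monom (of_nat (Suc i) * coeff p (Suc i)) i)"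

lemma coeff_formal_deriv: "coeff (formal_deriv p) i = of_nat (Suc i) * coeff p (Suc i)"
  unfolding formal_deriv_def coeff_sum coeff_monom
  by (auto simp: sum.delta coeff_eq_0 not_less less_Suc_eq_le simp del: of_nat_Suc)

lemma is_subringD:
  assumes "is_subring R"
  shows "1 \<in> R" "0 \<in> R" "a \<in> R \<Longrightarrow> b \<in> R \<Longrightarrow> a + b \<in> R" "a \<in> R \<Longrightarrow> b \<in> R \<Longrightarrow> a * b \<in> R"
    "a \<in> R \<Longrightarrow> - a \<in> R" "a \<in> R \<Longrightarrow> b \<in> R \<Longrightarrow> a - b \<in> R"
proof -
  show "1 \<in> R" "a \<in> R \<Longrightarrow> b \<in> R \<Longrightarrow> a + b \<in> R" "a \<in> R \<Longrightarrow> b \<in> R \<Longrightarrow> a * b \<in> R"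
    "a \<in> R \<Longrightarrow> - a \<in> R"
    using assms by (auto simp: is_subring_def)
  have "1 + - 1 \<in> R" using assms unfolding is_subring_def by blast
  then show "0 \<in> R" by simp
  assume "a \<in> R" "b \<in> R"
  then have "a + - b \<in> R" using assms unfolding is_subring_def by blast
  then show "a - b \<in> R" by simp
qed

lemma is_subring_sum: "is_subring R \<Longrightarrow> (\<And>i. i \<in> A \<Longrightarrow> f i \<in> R) \<Longrightarrow> sum f A \<in> R"
  by (induction A rule: infinite_finite_induct) (auto intro: is_subringD)

lemma is_subring_prod: "is_subring R \<Longrightarrow> (\<And>i. i \<in> A \<Longrightarrow> f i \<in> R) \<Longrightarrow> prod f A \<in> R"
  by (induction A rule: infinite_finite_induct) (auto intro: is_subringD)

lemma is_subring_power: "is_subring R \<Longrightarrow> a \<in> R \<Longrightarrow> a ^ k \<in> R"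
  by (induction k) (auto intro: is_subringD)

lemma is_subring_of_nat: "is_subring R \<Longrightarrow> of_nat k \<in> R"
  by (induction k) (auto intro: is_subringD)

lemma polys_overI: "(\<And>i. coeff p i \<in> R) \<Longrightarrow> p \<in> polys_over R"
  by (simp add: polys_over_def)

lemma polys_overD: "p \<in> polys_over R \<Longrightarrow> coeff p i \<in> R"
  by (simp add: polys_over_def)

context
  fixes R :: "'r::comm_ring_1 set"
  assumes R: "is_subring R"
begin

lemma polys_over_ring:
  "0 \<in> polys_over R" "1 \<in> polys_over R" "p \<in> polys_over R \<Longrightarrow> q \<in> polys_over R \<Longrightarrow> p + q \<in> polys_over R"
  "p \<in> polys_over R \<Longrightarrow> q \<in> polys_over R \<Longrightarrow> p * q \<in> polys_over R"
  "p \<in> polys_over R \<Longrightarrow> - p \<in> polys_over R"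
  "p \<in> polys_over R \<Longrightarrow> q \<in> polys_over R \<Longrightarrow> p - q \<in> polys_over R"
  "a \<in> R \<Longrightarrow> p \<in> polys_over R \<Longrightarrow> smult a p \<in> polys_over R"
  "a \<in> R \<Longrightarrow> monom a k \<in> polys_over R"
  "a \<in> R \<Longrightarrow> p \<in> polys_over R \<Longrightarrow> pCons a p \<in> polys_over R"
  "p \<in> polys_over R \<Longrightarrow> formal_deriv p \<in> polys_over R"
  using R by (auto intro!: is_subringD is_subring_sum is_subring_of_nat split: nat.splits
      simp: polys_over_def coeff_mult coeff_pCons coeff_formal_deriv simp del: of_nat_Suc)

lemma is_subring_adj: "is_subring (adj R y)"
proof -
  have "\<exists>r\<in>polys_over R. poly p y + poly q y = poly r y"
    "\<exists>r\<in>polys_over R. poly p y * poly q y = poly r y"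
    "\<exists>r\<in>polys_over R. - poly p y = poly r y"
    if "p \<in> polys_over R" "q \<in> polys_over R" for p q
    using polys_over_ring(3)[OF that] polys_over_ring(4)[OF that] polys_over_ring(5)[OF that(1)]
    by (metis poly_add, metis poly_mult, metis poly_minus)
  moreover have "1 = poly 1 y" by simp
  ultimately show ?thesis
    unfolding is_subring_def adj_def using polys_over_ring(2) by (smt (verit) mem_Collect_eq)
qed

lemma subset_adj: "R \<subseteq> adj R y"
proof
  fix a assume "a \<in> R"
  then have "[:a:] \<in> polys_over R" by (intro polys_over_ring)
  then show "a \<in> adj R y" unfolding adj_def by (force intro: exI[of _ "[:a:]"])
qed

lemma gen_in_adj: "y \<in> adj R y"
proof -
  have "[:0, 1:] \<in> polys_over R" by (intro polys_over_ring is_subringD(1,2)[OF R])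
  then show ?thesis unfolding adj_def by (force intro: exI[of _ "[:0, 1:]"])
qed

lemma poly_in_subring: "p \<in> polys_over R \<Longrightarrow> y \<in> R \<Longrightarrow> poly p y \<in> R"
  using R by (auto simp: poly_altdef polys_over_def intro!: is_subring_sum is_subring_power is_subringD(4))

text \<open>Division by a non-monic \<open>g\<close> stays inside \<open>R\<close> when the dividend
  is first multiplied by a power of the leading coefficient. The bound on the degree of the quotient
  is what later makes the quotient subject to the minimality of a relation.\<close>

lemma pseudo_division:
  assumes "q \<in> polys_over R" "g \<in> polys_over R" "degree g > 0"
  shows "\<exists>e. \<exists>s\<in>polys_over R. \<exists>r\<in>polys_over R.
           smult (lead_coeff g ^ e) q = s * g + r \<and> degree r < degree g \<and> degree s \<le> degree q - degree g"
  using assms(1)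
proof (induction "degree q" arbitrary: q rule: less_induct)
  case less
  show ?case
  proof (cases "degree q < degree g")
    case True
    then show ?thesis using less.prems polys_over_ring(1)
      by (intro exI[of _ 0] bexI[of _ 0] bexI[of _ q]) auto
  next
    case False
    define c where "c = lead_coeff g"
    define m where "m = monom (lead_coeff q) (degree q - degree g)"
    define q' where "q' = smult c q - m * g"
    have cR: "c \<in> R" unfolding c_def using assms(2) by (rule polys_overD)
    have mR: "m \<in> polys_over R" unfolding m_def
      using polys_over_ring(8) polys_overD[OF less.prems] by blast
    have q'R: "q' \<in> polys_over R" unfolding q'_def
      by (intro polys_over_ring(4,6,7) mR assms(2) less.prems cR)
    have degm: "degree m \<le> degree q - degree g" unfolding m_def by (rule degree_monom_le)
    have deg1: "degree q' \<le> degree q"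
      unfolding q'_def
    proof (rule degree_diff_le)
      show "degree (smult c q) \<le> degree q" by (rule degree_smult_le)
      show "degree (m * g) \<le> degree q"
        using degree_mult_le[of m g] degm False by linarith
    qed
    have "coeff (m * g) (degree q) = lead_coeff q * c"
      unfolding m_def c_def using False by (simp add: coeff_monom_mult)
    then have "coeff q' (degree q) = 0" unfolding q'_def by (simp add: mult.commute)
    moreover have "degree q > 0" using False assms(3) by linarith
    ultimately have deg: "degree q' < degree q"
      using deg1 by (metis degree_0 leading_coeff_0_iff order_le_less)
    obtain e s r where esr: "s \<in> polys_over R" "r \<in> polys_over R" "smult (c ^ e) q' = s * g + r"
      "degree r < degree g" "degree s \<le> degree q' - degree g"
      using less.hyps[OF deg q'R] unfolding c_def by blast
    have "smult (c ^ Suc e) q = smult (c ^ e) q' + smult (c ^ e) m * g"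
      unfolding q'_def by (simp add: smult_diff_right mult.commute)
    also have "\<dots> = (s + smult (c ^ e) m) * g + r" using esr(3) by (simp add: algebra_simps)
    finally have eq: "smult (c ^ Suc e) q = (s + smult (c ^ e) m) * g + r" .
    have "s + smult (c ^ e) m \<in> polys_over R"
      by (intro polys_over_ring(3,7) esr(1) mR is_subring_power[OF R] cR)
    moreover have "degree (s + smult (c ^ e) m) \<le> degree q - degree g"
      using esr(5) degm deg by (intro degree_add_le order_trans[OF degree_smult_le]) linarith+
    ultimately show ?thesis using eq esr(2,4) unfolding c_def by blast
  qed
qed

end

lemma adj_subset: "is_subring S \<Longrightarrow> R \<subseteq> S \<Longrightarrow> y \<in> S \<Longrightarrow> adj R y \<subseteq> S"
  unfolding adj_def using poly_in_subring by (fastforce simp: polys_over_def)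

text \<open>These are the homomorphisms to a field from \<open>R\<close> modulo
  \<open>R \<inter> I\<close>, without forming the quotient. The values outside \<open>R\<close> are
  arbitrary, so an extension is simply another function that agrees on \<open>R\<close>.\<close>

definition specialization :: "'r::comm_ring_1 set \<Rightarrow> 'r set \<Rightarrow> ('r \<Rightarrow> 'a::field) \<Rightarrow> bool" where
  "specialization I R \<phi> \<longleftrightarrow> \<phi> 1 = 1 \<and> (\<forall>a\<in>R. \<forall>b\<in>R. \<phi> (a + b) = \<phi> a + \<phi> b \<and> \<phi> (a * b) = \<phi> a * \<phi> b) \<and>
     (\<forall>a\<in>R \<inter> I. \<phi> a = 0)"

lemma specializationD:
  assumes "specialization I R \<phi>"
  shows "\<phi> 1 = 1" "a \<in> R \<Longrightarrow> b \<in> R \<Longrightarrow> \<phi> (a + b) = \<phi> a + \<phi> b"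
    "a \<in> R \<Longrightarrow> b \<in> R \<Longrightarrow> \<phi> (a * b) = \<phi> a * \<phi> b" "a \<in> R \<Longrightarrow> a \<in> I \<Longrightarrow> \<phi> a = 0"
  using assms unfolding specialization_def by auto

lemma specialization_0:
  assumes "is_subring R" "specialization I R \<phi>" shows "\<phi> 0 = 0"
  using specializationD(2)[OF assms(2) is_subringD(2)[OF assms(1)] is_subringD(2)[OF assms(1)]]
  by (metis add.right_neutral add_cancel_left_left)

lemma specialization_sum:
  assumes "is_subring R" "specialization I R \<phi>" "\<And>i. i \<in> A \<Longrightarrow> f i \<in> R"
  shows "\<phi> (sum f A) = (\<Sum>i\<in>A. \<phi> (f i))"
  using assms(3)
  by (induction A rule: infinite_finite_induct)
     (auto simp: specialization_0[OF assms(1,2)] specializationD(2)[OF assms(2)] is_subring_sum[OF assms(1)])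

lemma specialization_prod:
  assumes "is_subring R" "specialization I R \<phi>" "\<And>i. i \<in> A \<Longrightarrow> f i \<in> R"
  shows "\<phi> (prod f A) = (\<Prod>i\<in>A. \<phi> (f i))"
  using assms(3)
  by (induction A rule: infinite_finite_induct)
     (auto simp: specializationD(1,3)[OF assms(2)] is_subring_prod[OF assms(1)])

lemma specialization_power:
  assumes "is_subring R" "specialization I R \<phi>" "a \<in> R"
  shows "\<phi> (a ^ k) = \<phi> a ^ k"
  by (induction k) (auto simp: specializationD(1,3)[OF assms(2)] is_subring_power[OF assms(1)] assms(3))

lemma specialization_of_nat:
  assumes "is_subring R" "specialization I R \<phi>"
  shows "\<phi> (of_nat k) = of_nat k"
  by (induction k) (auto simp: specialization_0[OF assms] specializationD(1,2)[OF assms(2)] 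
      is_subring_of_nat[OF assms(1)] is_subringD(1)[OF assms(1)])

lemma specialization_minus:
  assumes "is_subring R" "specialization I R \<phi>" "a \<in> R"
  shows "\<phi> (- a) = - \<phi> a"
proof -
  have "\<phi> (a + - a) = \<phi> a + \<phi> (- a)"
    using assms by (intro specializationD(2)) (auto intro: is_subringD)
  then show ?thesis using specialization_0[OF assms(1,2)] by (simp add: eq_neg_iff_add_eq_0 add.commute)
qed

context
  fixes R I :: "'r::comm_ring_1 set" and \<phi> :: "'r \<Rightarrow> 'a::field"
  assumes R: "is_subring R" and spec: "specialization I R \<phi>"
begin

private lemma coeff_map: "coeff (map_poly \<phi> p) i = \<phi> (coeff p i)"
  by (rule coeff_map_poly) (rule specialization_0[OF R spec])

lemma spec_poly_add:
  "p \<in> polys_over R \<Longrightarrow> q \<in> polys_over R \<Longrightarrow> map_poly \<phi> (p + q) = map_poly \<phi> p + map_poly \<phi> q"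
  by (rule poly_eqI) (simp add: coeff_map specializationD[OF spec] polys_over_def)

lemma spec_poly_mult:
  "p \<in> polys_over R \<Longrightarrow> q \<in> polys_over R \<Longrightarrow> map_poly \<phi> (p * q) = map_poly \<phi> p * map_poly \<phi> q"
  by (rule poly_eqI)
     (auto simp: coeff_map coeff_mult specialization_sum[OF R spec] specializationD[OF spec] 
        polys_over_def is_subringD[OF R])

lemma spec_poly_smult:
  "a \<in> R \<Longrightarrow> q \<in> polys_over R \<Longrightarrow> map_poly \<phi> (smult a q) = smult (\<phi> a) (map_poly \<phi> q)"
  by (rule poly_eqI) (auto simp: coeff_map specializationD[OF spec] polys_over_def)

lemma spec_poly_minus:
  "q \<in> polys_over R \<Longrightarrow> map_poly \<phi> (- q) = - map_poly \<phi> q"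
  by (rule poly_eqI) (auto simp: coeff_map specialization_minus[OF R spec] polys_over_def)

lemma spec_poly_deriv:
  "q \<in> polys_over R \<Longrightarrow> map_poly \<phi> (formal_deriv q) = pderiv (map_poly \<phi> q)"
  by (rule poly_eqI)
     (auto simp: coeff_map coeff_pderiv coeff_formal_deriv specializationD[OF spec] polys_over_def specialization_of_nat[OF R spec]
        is_subring_of_nat[OF R] simp del: of_nat_Suc)

lemma spec_poly_zero: "(\<And>i. coeff p i \<in> I) \<Longrightarrow> p \<in> polys_over R \<Longrightarrow> map_poly \<phi> p = 0"
  by (rule poly_eqI) (auto simp: coeff_map specializationD[OF spec] polys_over_def)

lemma spec_poly_const: "map_poly \<phi> [:a:] = [:\<phi> a:]"
  by (rule poly_eqI) (auto simp: coeff_map coeff_pCons specialization_0[OF R spec] split: nat.splits)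

text \<open>Two polynomials over \<open>R\<close> with the same value at \<open>y\<close> differ by
  a relation of \<open>y\<close>. So sending \<open>y\<close> to \<open>t\<close> is well defined as
  soon as \<open>t\<close> is a root of every specialized relation.\<close>

lemma specialization_extend:
  assumes "\<And>p. p \<in> polys_over R \<Longrightarrow> poly p y \<in> I \<Longrightarrow> poly (map_poly \<phi> p) t = 0" and "0 \<in> I"
  shows "\<exists>\<psi>. specialization I (adj R y) \<psi> \<and> (\<forall>p\<in>polys_over R. \<psi> (poly p y) = poly (map_poly \<phi> p) t)"
proof -
  define \<psi> where "\<psi> z = poly (map_poly \<phi> (SOME p. p \<in> polys_over R \<and> poly p y = z)) t" for z
  have val: "\<psi> (poly p y) = poly (map_poly \<phi> p) t" if p: "p \<in> polys_over R" for p
  proof -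
    define q where "q = (SOME q. q \<in> polys_over R \<and> poly q y = poly p y)"
    have q: "q \<in> polys_over R \<and> poly q y = poly p y"
      unfolding q_def by (rule someI[of _ p]) (simp add: p)
    have "poly (map_poly \<phi> (q + - p)) t = 0"
      using q p assms(2) by (intro assms(1) polys_over_ring[OF R]) auto
    then have "poly (map_poly \<phi> q) t = poly (map_poly \<phi> p) t"
      unfolding spec_poly_add[OF conjunct1[OF q] polys_over_ring(5)[OF R p]] spec_poly_minus[OF p] by simp
    then show ?thesis unfolding \<psi>_def q_def .
  qed
  have "specialization I (adj R y) \<psi>"
    unfolding specialization_def
  proof (intro conjI ballI)
    have "\<psi> (poly 1 y) = 1"
      using polys_over_ring(2)[OF R] val[of 1] spec_poly_const[of 1] specializationD(1)[OF spec]
      by (simp add: one_pCons)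
    then show "\<psi> 1 = 1" by simp
  next
    fix a b assume "a \<in> adj R y" "b \<in> adj R y"
    then obtain p q where pq: "p \<in> polys_over R" "q \<in> polys_over R" "a = poly p y" "b = poly q y"
      unfolding adj_def by blast
    show "\<psi> (a + b) = \<psi> a + \<psi> b"
      using val[OF polys_over_ring(3)[OF R pq(1,2)]] pq by (simp add: val spec_poly_add)
    show "\<psi> (a * b) = \<psi> a * \<psi> b"
      using val[OF polys_over_ring(4)[OF R pq(1,2)]] pq by (simp add: val spec_poly_mult)
  next
    fix a assume "a \<in> adj R y \<inter> I"
    then show "\<psi> a = 0" unfolding adj_def using assms(1) val by auto
  qed
  then show ?thesis using val by blast
qed

end

text \<open>Splitting off one linear factor keeps the hypothesis, and the root removed is not a root
  of the cofactor. The zero polynomial is excluded by the hypothesis itself.\<close>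

lemma card_simple_roots:
  fixes P :: "'a::alg_closed_field poly"
  assumes "\<And>t. poly P t = 0 \<Longrightarrow> poly (pderiv P) t \<noteq> 0"
  shows "card {t. poly P t = 0} = degree P"
  using assms
proof (induction "degree P" arbitrary: P)
  case 0
  then obtain c where "P = [:c:]" by (metis degree_eq_zeroE)
  then show ?case using 0 by (cases "c = 0") auto
next
  case (Suc d)
  then obtain t where t: "poly P t = 0" using alg_closed_imp_poly_has_root[of P] by auto
  then obtain Q where Q: "P = [:- t, 1:] * Q" by (auto simp: poly_eq_0_iff_dvd)
  have P0: "P \<noteq> 0" using Suc by auto
  then have Q0: "Q \<noteq> 0" using Q by auto
  have dQ: "degree P = Suc (degree Q)" unfolding Q using Q0 by (subst degree_mult_eq) auto
  have dP: "pderiv P = [:- t, 1:] * pderiv Q + Q" unfolding Q pderiv_mult by (simp add: pderiv_pCons)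
  have Qt: "poly Q t \<noteq> 0" using Suc.prems[OF t] dP by auto
  have "card {s. poly Q s = 0} = degree Q"
  proof (rule Suc.hyps)
    fix s assume s: "poly Q s = 0"
    then have "poly P s = 0" using Q by simp
    then show "poly (pderiv Q) s \<noteq> 0" using Suc.prems[of s] dP s by auto
  qed (use Suc dQ in auto)
  moreover have "{s. poly P s = 0} = insert t {s. poly Q s = 0}" unfolding Q by auto
  ultimately show ?case using dQ Qt poly_roots_finite[OF Q0] by simp
qed

text \<open>The quotient S/I is an integral domain of characteristic zero; the last assumption is
  the characteristic. Every statement about S/I is phrased as membership in
  \<open>I\<close>.\<close>

locale prime_quotient =
  fixes S I :: "'r::comm_ring_1 set"
  assumes subring: "is_subring S"
    and ideal_subset: "I \<subseteq> S"
    and ideal_0: "0 \<in> I"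
    and ideal_add: "a \<in> I \<Longrightarrow> b \<in> I \<Longrightarrow> a + b \<in> I"
    and ideal_mult: "r \<in> S \<Longrightarrow> a \<in> I \<Longrightarrow> r * a \<in> I"
    and one_notin_ideal: "1 \<notin> I"
    and prime: "a \<in> S \<Longrightarrow> b \<in> S \<Longrightarrow> a * b \<in> I \<Longrightarrow> a \<in> I \<or> b \<in> I"
    and of_nat_cancel: "a \<in> S \<Longrightarrow> of_nat (Suc m) * a \<in> I \<Longrightarrow> a \<in> I"
begin

lemma ideal_minus: "a \<in> I \<Longrightarrow> - a \<in> I"
  using ideal_mult[of "- 1" a] is_subringD[OF subring] by simp

lemma ideal_diff: "a \<in> I \<Longrightarrow> b \<in> I \<Longrightarrow> a - b \<in> I"
  using ideal_add[of a "- b"] ideal_minus by simp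

lemma ideal_sum: "(\<And>i. i \<in> A \<Longrightarrow> f i \<in> I) \<Longrightarrow> sum f A \<in> I"
  by (induction A rule: infinite_finite_induct) (auto intro: ideal_0 ideal_add)

lemma power_notin_ideal: "a \<in> S \<Longrightarrow> a \<notin> I \<Longrightarrow> a ^ k \<notin> I"
proof (induction k)
  case (Suc k)
  then show ?case using prime[of a "a ^ k"] is_subring_power[OF subring] by auto
qed (simp add: one_notin_ideal)

lemma ideal_cancel: "a \<in> S \<Longrightarrow> b \<in> S \<Longrightarrow> a - b \<in> I \<Longrightarrow> a \<in> I \<longleftrightarrow> b \<in> I"
  using ideal_add[of "a - b" b] ideal_diff[of a "a - b"] by auto

lemma poly_in_ideal: "(\<And>i. coeff p i \<in> I) \<Longrightarrow> y \<in> S \<Longrightarrow> poly p y \<in> I"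
  unfolding poly_altdef
  by (intro ideal_sum) (metis ideal_mult is_subring_power mult.commute subring)

context
  fixes R :: "'r set" and y :: 'r
  assumes R: "is_subring R" "R \<subseteq> S" and y: "y \<in> S"
begin

lemma poly_in_S: "p \<in> polys_over R \<Longrightarrow> poly p y \<in> S"
  using adj_subset[OF subring R(2) y] unfolding adj_def by blast

text \<open>Leading terms with coefficient in \<open>I\<close> are dropped one after the other.
  Afterwards the degree of the polynomial is its true degree modulo \<open>I\<close>.\<close>

lemma trim_poly:
  assumes "q \<in> polys_over R"
  shows "\<exists>q'\<in>polys_over R. degree q' \<le> degree q \<and> (\<forall>i. coeff (q - q') i \<in> I) \<and> (q' = 0 \<or> lead_coeff q' \<notin> I)"
  using assms
proof (induction "degree q" arbitrary: q rule: less_induct)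
  case less
  show ?case
  proof (cases "q = 0 \<or> lead_coeff q \<notin> I")
    case True
    then show ?thesis using less.prems ideal_0 by (intro bexI[of _ q]) auto
  next
    case False
    define q1 where "q1 = q - monom (lead_coeff q) (degree q)"
    have q1: "q1 \<in> polys_over R" unfolding q1_def
      by (intro polys_over_ring[OF R(1)] less.prems polys_overD)
    have diff: "coeff (q - q1) i \<in> I" for i using False ideal_0 by (auto simp: q1_def)
    show ?thesis
    proof (cases "degree q = 0")
      case True
      then have "coeff (q - 0) i \<in> I" for i using False ideal_0 by (cases i) (auto simp: coeff_eq_0)
      then show ?thesis using polys_over_ring(1)[OF R(1)] by (intro bexI[of _ 0]) auto
    next
      case deg: False
      have "degree q1 \<le> degree q" unfolding q1_def by (intro degree_diff_le degree_monom_le) simp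
      moreover have "coeff q1 (degree q) = 0" unfolding q1_def by simp
      ultimately have "degree q1 < degree q" using deg by (metis degree_0 leading_coeff_0_iff order_le_less neq0_conv)
      then obtain q' where q': "q' \<in> polys_over R" "degree q' \<le> degree q1" "\<And>i. coeff (q1 - q') i \<in> I"
        "q' = 0 \<or> lead_coeff q' \<notin> I"
        using less.hyps[OF _ q1] by blast
      have "coeff (q - q') i \<in> I" for i
        using ideal_add[OF diff[of i] q'(3)[of i]] by simp
      then show ?thesis using q' \<open>degree q1 < degree q\<close> by (intro bexI[of _ q']) auto
    qed
  qed
qed

lemma trim_nonzero:
  assumes "q \<in> polys_over R" "\<not> (\<forall>i. coeff q i \<in> I)"
  shows "\<exists>q'\<in>polys_over R. degree q' \<le> degree q \<and> poly q y - poly q' y \<in> I \<and> lead_coeff q' \<notin> I"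
proof -
  obtain q' where q': "q' \<in> polys_over R" "degree q' \<le> degree q" "\<And>i. coeff (q - q') i \<in> I"
    "q' = 0 \<or> lead_coeff q' \<notin> I"
    using trim_poly[OF assms(1)] by blast
  have "poly q y - poly q' y \<in> I"
    using poly_in_ideal[of "q - q'" y] q'(3) y by simp
  moreover have "q' \<noteq> 0" using assms(2) q'(3) by auto
  ultimately show ?thesis using q' by blast
qed

text \<open>Over the fraction field of R/I the polynomial \<open>p\<close> is a minimal polynomial
  of \<open>y\<close>, so the nonzero class of \<open>poly q y\<close> has an inverse that is a
  polynomial in \<open>y\<close>. Clearing denominators turns this into a multiple of
  \<open>poly q y\<close> that is congruent to a nonzero element \<open>a\<close> of
  \<open>R\<close>. The proof is the Euclidean algorithm on \<open>q\<close> and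
  \<open>p\<close>.\<close>

lemma bezout_algebraic:
  assumes p: "p \<in> polys_over R" "poly p y \<in> I" "lead_coeff p \<notin> I"
    and minimal: "\<And>r. r \<in> polys_over R \<Longrightarrow> poly r y \<in> I \<Longrightarrow> degree r < degree p \<Longrightarrow> \<forall>i. coeff r i \<in> I"
    and q: "q \<in> polys_over R" "poly q y \<notin> I"
  shows "\<exists>u\<in>polys_over R. \<exists>a\<in>R. a \<notin> I \<and> a - poly u y * poly q y \<in> I"
  using q
proof (induction "degree q" arbitrary: q rule: less_induct)
  case less
  note inS = poly_in_S
  have degp: "degree p > 0"
  proof (rule ccontr)
    assume "\<not> degree p > 0"
    then obtain c where "p = [:c:]" by (metis degree_eq_zeroE neq0_conv)
    then show False using p by auto
  qed
  have "\<not> (\<forall>i. coeff q i \<in> I)" using less.prems poly_in_ideal y by blast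
  then obtain q' where q': "q' \<in> polys_over R" "degree q' \<le> degree q" "poly q y - poly q' y \<in> I"
    "lead_coeff q' \<notin> I"
    using trim_nonzero[OF less.prems(1)] by blast
  have q'I: "poly q' y \<notin> I"
    using less.prems ideal_cancel[OF inS inS q'(3)] q'(1) by blast
  have reduce: ?case if "u \<in> polys_over R" "a \<in> R" "a \<notin> I" "a - poly u y * poly q' y \<in> I" for u a
  proof -
    have "(a - poly u y * poly q' y) - poly u y * (poly q y - poly q' y) \<in> I"
      by (intro ideal_diff that ideal_mult inS q'(3))
    then have "a - poly u y * poly q y \<in> I" by (simp add: algebra_simps)
    then show ?thesis using that by blast
  qed
  \<comment> \<open>A constant is already the wanted element \<open>a\<close>. If \<open>q'\<close>
    is not shorter than \<open>p\<close>, it is reduced by \<open>p\<close>; otherwise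
    \<open>p\<close> is reduced by \<open>q'\<close>. In both cases the remainder is shorter than
    \<open>q\<close> and the induction applies to it.\<close>
  consider "degree q' = 0" | "degree q' \<ge> degree p" | "0 < degree q'" "degree q' < degree p" by linarith
  then show ?case
  proof cases
    case 1
    then obtain c where c: "q' = [:c:]" by (metis degree_eq_zeroE)
    show ?thesis
      by (rule reduce[of 1 c])
        (use c q' ideal_0 polys_over_ring(2)[OF R(1)] polys_overD[OF q'(1), of 0] in auto)
  next
    case 2
    obtain e s r where r: "s \<in> polys_over R" "r \<in> polys_over R" "smult (lead_coeff p ^ e) q' = s * p + r"
      "degree r < degree p"
      using pseudo_division[OF R(1) q'(1) p(1) degp] by blast
    define c where "c = lead_coeff p ^ e"
    have cR: "c \<in> R" "c \<in> S" "c \<notin> I" unfolding c_def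
      using polys_overD[OF p(1)] R(2) p(3)
      by (auto intro!: is_subring_power[OF R(1)] is_subring_power[OF subring] simp: power_notin_ideal subsetD)
    have eq: "c * poly q' y = poly s y * poly p y + poly r y"
      using arg_cong[OF r(3), of "\<lambda>f. poly f y"] unfolding c_def by simp
    have sp: "poly s y * poly p y \<in> I" by (intro ideal_mult inS r p(2))
    have "c * poly q' y \<notin> I" using prime[OF cR(2) inS[OF q'(1)]] cR(3) q'I by blast
    then have rI: "poly r y \<notin> I" using eq sp ideal_add by metis
    have "degree r < degree q" using r(4) 2 q'(2) by linarith
    then obtain u a where ua: "u \<in> polys_over R" "a \<in> R" "a \<notin> I" "a - poly u y * poly r y \<in> I"
      using less.hyps[OF _ r(2) rI] by blast
    have "(a - poly u y * poly r y) - poly u y * (poly s y * poly p y) \<in> I"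
      by (intro ideal_diff ideal_mult inS sp ua)
    then have "a - poly u y * (c * poly q' y) \<in> I" unfolding eq by (simp add: algebra_simps)
    then have "a - poly (smult c u) y * poly q' y \<in> I" by (simp add: algebra_simps)
    then show ?thesis
      by (intro reduce[of "smult c u" a] polys_over_ring(7)[OF R(1) cR(1)] ua)
  next
    case 3
    obtain e s r where r: "s \<in> polys_over R" "r \<in> polys_over R" "smult (lead_coeff q' ^ e) p = s * q' + r"
      "degree r < degree q'" "degree s \<le> degree p - degree q'"
      using pseudo_division[OF R(1) p(1) q'(1) 3(1)] by blast
    define c where "c = lead_coeff q' ^ e"
    have cR: "c \<in> R" "c \<in> S" "c \<notin> I" unfolding c_def
      using polys_overD[OF q'(1)] R(2) q'(4)
      by (auto intro!: is_subring_power[OF R(1)] is_subring_power[OF subring] simp: power_notin_ideal subsetD)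
    have eq: "c * poly p y = poly s y * poly q' y + poly r y"
      using arg_cong[OF r(3), of "\<lambda>f. poly f y"] unfolding c_def by simp
    have cp: "c * poly p y \<in> I" by (intro ideal_mult cR p(2))
    \<comment> \<open>If the remainder died at \<open>y\<close>, minimality would put its
      coefficients in \<open>I\<close>; primality and minimality would do the same for the quotient
      \<open>s\<close>. Then \<open>c\<close> times the leading coefficient of \<open>p\<close>
      would lie in \<open>I\<close>.\<close>
    have rI: "poly r y \<notin> I"
    proof
      assume rI: "poly r y \<in> I"
      have rc: "\<forall>i. coeff r i \<in> I" by (rule minimal[OF r(2) rI]) (use r(4) 3(2) in linarith)
      have "poly s y * poly q' y \<in> I" using ideal_diff[OF cp rI] eq by simp
      then have sI: "poly s y \<in> I" using prime[OF inS inS] r(1) q'(1) q'I by blast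
      have sc: "\<forall>i. coeff s i \<in> I" by (rule minimal[OF r(1) sI]) (use r(5) 3 in linarith)
      have "coeff (s * q' + r) i \<in> I" for i
        unfolding coeff_add coeff_mult using rc sc polys_overD[OF q'(1)] R(2)
        by (intro ideal_add ideal_sum) (metis ideal_mult mult.commute subsetD, blast)
      then have "c * lead_coeff p \<in> I" using r(3) unfolding c_def by (metis coeff_smult)
      then show False using prime cR p(3) R(2) polys_overD[OF p(1)] by blast
    qed
    have "degree r < degree q" using r(4) q'(2) by linarith
    then obtain u a where ua: "u \<in> polys_over R" "a \<in> R" "a \<notin> I" "a - poly u y * poly r y \<in> I"
      using less.hyps[OF _ r(2) rI] by blast
    have "(a - poly u y * poly r y) + poly u y * (c * poly p y) \<in> I"
      by (intro ideal_add ideal_mult inS cp ua)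
    then have "a - poly (- (u * s)) y * poly q' y \<in> I" unfolding eq by (simp add: algebra_simps)
    then show ?thesis
      by (intro reduce[of "- (u * s)" a] polys_over_ring[OF R(1)] ua r)
  qed
qed

text \<open>A specialization extends to one more generator in as many ways as the specialized
  minimal polynomial has roots. The element \<open>a\<close> collects all that must survive: the
  degree of that polynomial, the simplicity of its roots and the nonvanishing of
  \<open>b\<close>.\<close>

lemma extension_count:
  assumes b: "b \<in> adj R y" "b \<notin> I"
    and no_rel: "\<forall>p\<in>polys_over R. poly p y \<in> I \<longrightarrow> degree p < N \<longrightarrow> (\<forall>i. coeff p i \<in> I)"
  shows "\<exists>a\<in>R. a \<notin> I \<and> (\<forall>\<phi>::'r \<Rightarrow> 'a::{alg_closed_field, field_char_0}.
     specialization I R \<phi> \<and> \<phi> a \<noteq> 0 \<longrightarrow> (\<exists>T. finite T \<and> card T = N \<and>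
       (\<forall>t\<in>T. \<exists>\<psi>. specialization I (adj R y) \<psi> \<and> (\<forall>r\<in>R. \<psi> r = \<phi> r) \<and> \<psi> y = t \<and> \<psi> b \<noteq> 0)))"
proof -
  obtain q where q: "q \<in> polys_over R" "b = poly q y" using b(1) unfolding adj_def by blast
  have ext: "\<exists>\<psi>. specialization I (adj R y) \<psi> \<and> (\<forall>r\<in>R. \<psi> r = \<phi> r) \<and> \<psi> y = t \<and>
       (\<forall>p\<in>polys_over R. \<psi> (poly p y) = poly (map_poly \<phi> p) t)"
    if \<phi>: "specialization I R \<phi>" and t: "\<And>p. p \<in> polys_over R \<Longrightarrow> poly p y \<in> I \<Longrightarrow> poly (map_poly \<phi> p) t = 0"
    for \<phi> :: "'r \<Rightarrow> 'a" and t
  proof -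
    obtain \<psi> where \<psi>: "specialization I (adj R y) \<psi>"
      "\<And>p. p \<in> polys_over R \<Longrightarrow> \<psi> (poly p y) = poly (map_poly \<phi> p) t"
      using specialization_extend[OF R(1) \<phi> t ideal_0] by blast
    have "\<psi> r = \<phi> r" if "r \<in> R" for r
      using \<psi>(2)[of "[:r:]"] that polys_over_ring(1,9)[OF R(1)] spec_poly_const[OF R(1) \<phi>] by simp
    moreover have "\<psi> y = t"
    proof -
      have "[:0, 1:] \<in> polys_over R" by (intro polys_over_ring[OF R(1)] is_subringD(1,2)[OF R(1)])
      moreover have "map_poly \<phi> [:0, 1:] = [:0, 1:]"
        using specialization_0[OF R(1) \<phi>] specializationD(1)[OF \<phi>]
        by (intro poly_eqI) (auto simp: coeff_map_poly coeff_pCons split: nat.splits)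
      ultimately show ?thesis using \<psi>(2)[of "[:0, 1:]"] by simp
    qed
    ultimately show ?thesis using \<psi> by blast
  qed
  show ?thesis
  proof (cases "\<exists>p\<in>polys_over R. poly p y \<in> I \<and> \<not> (\<forall>i. coeff p i \<in> I)")
    \<comment> \<open>Here \<open>y\<close> is transcendental modulo \<open>I\<close>, so any value
      \<open>t\<close> is allowed except the roots of the specialized \<open>q\<close>. One
      coefficient of \<open>q\<close> outside \<open>I\<close> keeps that polynomial
      nonzero.\<close>
    case False
    have "\<not> (\<forall>i. coeff q i \<in> I)" using poly_in_ideal[OF _ y] q b(2) by blast
    then obtain i where i: "coeff q i \<notin> I" by blast
    have "\<exists>T. finite T \<and> card T = N \<and>
       (\<forall>t\<in>T. \<exists>\<psi>. specialization I (adj R y) \<psi> \<and> (\<forall>r\<in>R. \<psi> r = \<phi> r) \<and> \<psi> y = t \<and> \<psi> b \<noteq> 0)"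
      if \<phi>: "specialization I R \<phi>" "\<phi> (coeff q i) \<noteq> 0" for \<phi> :: "'r \<Rightarrow> 'a"
    proof -
      have "coeff (map_poly \<phi> q) i \<noteq> 0"
        using \<phi> specialization_0[OF R(1) \<phi>(1)] by (simp add: coeff_map_poly)
      then have "map_poly \<phi> q \<noteq> 0" by auto
      then have "infinite (- {t. poly (map_poly \<phi> q) t = 0})"
        using poly_roots_finite[of "map_poly \<phi> q"] infinite_UNIV_char_0[where 'a = 'a]
        by (simp add: Compl_eq_Diff_UNIV Diff_infinite_finite)
      then obtain T where T: "finite T" "card T = N" "T \<subseteq> - {t. poly (map_poly \<phi> q) t = 0}"
        using infinite_arbitrarily_large by blast
      have "\<exists>\<psi>. specialization I (adj R y) \<psi> \<and> (\<forall>r\<in>R. \<psi> r = \<phi> r) \<and> \<psi> y = t \<and> \<psi> b \<noteq> 0"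
        if "t \<in> T" for t
      proof -
        have "poly (map_poly \<phi> p) t = 0" if "p \<in> polys_over R" "poly p y \<in> I" for p
          using spec_poly_zero[OF R(1) \<phi>(1), of p] that False by auto
        then obtain \<psi> where \<psi>: "specialization I (adj R y) \<psi>" "\<forall>r\<in>R. \<psi> r = \<phi> r" "\<psi> y = t"
          "\<forall>p\<in>polys_over R. \<psi> (poly p y) = poly (map_poly \<phi> p) t"
          using ext[OF \<phi>(1)] by blast
        moreover have "\<psi> b \<noteq> 0" using \<psi>(4) q T(3) that by auto
        ultimately show ?thesis by blast
      qed
      then show ?thesis using T by blast
    qed
    then show ?thesis using i polys_overD[OF q(1)] by blast
  next
    \<comment> \<open>Here \<open>y\<close> is algebraic modulo \<open>I\<close>. The relation
      \<open>p\<close> of least degree has degree at least \<open>N\<close>, and its specialization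
      supplies the values of \<open>y\<close>.\<close>
    case True
    define rel where "rel d \<longleftrightarrow> (\<exists>p\<in>polys_over R. poly p y \<in> I \<and> lead_coeff p \<notin> I \<and> degree p = d)" for d
    obtain p0 where p0: "p0 \<in> polys_over R" "poly p0 y \<in> I" "\<not> (\<forall>i. coeff p0 i \<in> I)" using True by blast
    have trimmed: "\<exists>d\<le>degree r. rel d"
      if r: "r \<in> polys_over R" "poly r y \<in> I" "\<not> (\<forall>i. coeff r i \<in> I)" for r
    proof -
      obtain r' where r': "r' \<in> polys_over R" "degree r' \<le> degree r" "poly r y - poly r' y \<in> I" "lead_coeff r' \<notin> I"
        using trim_nonzero[OF r(1,3)] by blast
      then show ?thesis using ideal_cancel[OF poly_in_S poly_in_S r'(3)] r unfolding rel_def by blast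
    qed
    define d where "d = (LEAST d. rel d)"
    have "rel d" unfolding d_def using trimmed[OF p0] by (meson LeastI)
    then obtain p where p: "p \<in> polys_over R" "poly p y \<in> I" "lead_coeff p \<notin> I" "degree p = d"
      unfolding rel_def by blast
    have minimal: "\<forall>i. coeff r i \<in> I" if r: "r \<in> polys_over R" "poly r y \<in> I" "degree r < degree p" for r
    proof (rule ccontr)
      assume "\<not> ?thesis"
      then obtain k where "k \<le> degree r" "rel k" using trimmed[OF r(1,2)] by blast
      then show False using r(3) p(4) not_less_Least[of k rel] unfolding d_def by simp
    qed
    have dN: "d \<ge> N" using no_rel p by (meson not_less)
    have d0: "d > 0"
    proof (rule ccontr)
      assume "\<not> d > 0"
      then obtain c where "p = [:c:]" using p(4) by (metis degree_eq_zeroE neq0_conv)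
      then show False using p by auto
    qed
    define p' where "p' = formal_deriv p"
    have p': "p' \<in> polys_over R" unfolding p'_def by (rule polys_over_ring(10)[OF R(1) p(1)])
    \<comment> \<open>The derivative is shorter than \<open>p\<close>, so by minimality its leading
      coefficient would be in \<open>I\<close>. Characteristic zero cancels the integer
      factor.\<close>
    have p'I: "poly p' y \<notin> I"
    proof
      assume *: "poly p' y \<in> I"
      have "degree p' < d" using d0 unfolding p'_def
        by (intro degree_lessI) (auto simp: coeff_formal_deriv p(4) coeff_eq_0 simp del: of_nat_Suc)
      then have "coeff p' (d - 1) \<in> I" using minimal[OF p' *] p(4) by blast
      then have "of_nat (Suc (d - 1)) * lead_coeff p \<in> I" using d0 p(4)
        unfolding p'_def coeff_formal_deriv by simp
      then show False using of_nat_cancel p(3) polys_overD[OF p(1)] R(2) by blast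
    qed
    \<comment> \<open>One application of the Bezout identity to the product controls both factors:
      where \<open>a\<close> survives, neither \<open>b\<close> nor the derivative of the
      specialized \<open>p\<close> vanishes.\<close>
    have "poly (q * p') y \<notin> I" using prime[OF poly_in_S poly_in_S] q p' p'I b(2) by auto
    then obtain u a where ua: "u \<in> polys_over R" "a \<in> R" "a \<notin> I" "a - poly u y * poly (q * p') y \<in> I"
      using bezout_algebraic[OF p(1-3) minimal polys_over_ring(4)[OF R(1) q(1) p']] by blast
    define l where "l = lead_coeff p"
    have l: "l \<in> R" "l \<notin> I" unfolding l_def using polys_overD[OF p(1)] p(3) by auto
    have "\<exists>T. finite T \<and> card T = N \<and>
       (\<forall>t\<in>T. \<exists>\<psi>. specialization I (adj R y) \<psi> \<and> (\<forall>r\<in>R. \<psi> r = \<phi> r) \<and> \<psi> y = t \<and> \<psi> b \<noteq> 0)"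
      if \<phi>: "specialization I R \<phi>" "\<phi> (a * l) \<noteq> 0" for \<phi> :: "'r \<Rightarrow> 'a"
    proof -
      define P where "P = map_poly \<phi> p"
      have al: "\<phi> a \<noteq> 0" "\<phi> l \<noteq> 0" using \<phi> specializationD(3)[OF \<phi>(1) ua(2) l(1)] by auto
      have degP: "degree P = d" unfolding P_def p(4)[symmetric]
        using al(2) unfolding l_def by (intro map_poly_degree_eq) auto
      have key: "\<exists>\<psi>. specialization I (adj R y) \<psi> \<and> (\<forall>r\<in>R. \<psi> r = \<phi> r) \<and> \<psi> y = t \<and> \<psi> b \<noteq> 0 \<and>
          poly (pderiv P) t \<noteq> 0" if t: "poly P t = 0" for t
      proof -
        \<comment> \<open>Up to a power of \<open>l\<close>, every relation is a multiple of
          \<open>p\<close> plus a remainder with coefficients in \<open>I\<close>. Hence a root of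
          the specialized \<open>p\<close> respects all relations.\<close>
        have "poly (map_poly \<phi> r) t = 0" if r: "r \<in> polys_over R" "poly r y \<in> I" for r
        proof -
          obtain e s r' where r': "s \<in> polys_over R" "r' \<in> polys_over R" "smult (l ^ e) r = s * p + r'"
            "degree r' < degree p"
            using pseudo_division[OF R(1) r(1) p(1)] d0 unfolding l_def p(4) by blast
          have lR: "l ^ e \<in> R" using R l by (simp add: is_subring_power)
          have "poly r' y = l ^ e * poly r y - poly s y * poly p y"
            using arg_cong[OF r'(3), of "\<lambda>f. poly f y"] by simp
          then have "poly r' y \<in> I"
            using lR R(2) by (auto intro!: ideal_diff ideal_mult r p(2) poly_in_S r')
          then have "map_poly \<phi> r' = 0" using spec_poly_zero[OF R(1) \<phi>(1)] minimal r' by blast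
          then have "smult (\<phi> (l ^ e)) (map_poly \<phi> r) = map_poly \<phi> s * P"
            using arg_cong[OF r'(3), of "map_poly \<phi>"] unfolding P_def
              spec_poly_smult[OF R(1) \<phi>(1) lR r(1)]
              spec_poly_add[OF R(1) \<phi>(1) polys_over_ring(4)[OF R(1) r'(1) p(1)] r'(2)]
              spec_poly_mult[OF R(1) \<phi>(1) r'(1) p(1)] by simp
          then have "\<phi> (l ^ e) * poly (map_poly \<phi> r) t = 0" using t
            by (metis mult_zero_right poly_mult poly_smult)
          then show ?thesis using al(2) specialization_power[OF R(1) \<phi>(1) l(1)] by simp
        qed
        then obtain \<psi> where \<psi>: "specialization I (adj R y) \<psi>" "\<forall>r\<in>R. \<psi> r = \<phi> r" "\<psi> y = t"
            "\<forall>p\<in>polys_over R. \<psi> (poly p y) = poly (map_poly \<phi> p) t"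
          using ext[OF \<phi>(1)] by blast
        define w where "w = u * (q * p')"
        have w: "w \<in> polys_over R" "[:a:] - w \<in> polys_over R" unfolding w_def
          by (intro polys_over_ring[OF R(1)] ua q p')+
        have "\<psi> (poly ([:a:] + - w) y) = 0"
        proof (rule specializationD(4)[OF \<psi>(1)])
          show "poly ([:a:] + - w) y \<in> adj R y" 
            unfolding adj_def using polys_over_ring(3,5)[OF R(1)] polys_over_ring(9)[OF R(1) ua(2) polys_over_ring(1)[OF R(1)]] w(1)
            by blast
          show "poly ([:a:] + - w) y \<in> I" using ua(4) unfolding w_def by (simp add: mult.assoc)
        qed
        then have "poly (map_poly \<phi> ([:a:] + - w)) t = 0" using \<psi>(4) w by auto
        then have "\<phi> a = poly (map_poly \<phi> w) t"
          unfolding spec_poly_add[OF R(1) \<phi>(1) polys_over_ring(9)[OF R(1) ua(2) polys_over_ring(1)[OF R(1)]] 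
              polys_over_ring(5)[OF R(1) w(1)]]
            spec_poly_minus[OF R(1) \<phi>(1) w(1)] spec_poly_const[OF R(1) \<phi>(1)] by simp
        also have "\<dots> = poly (map_poly \<phi> u) t * (poly (map_poly \<phi> q) t * poly (pderiv P) t)"
          unfolding w_def P_def
          by (simp add: spec_poly_mult[OF R(1) \<phi>(1)] polys_over_ring[OF R(1)] ua q p' p
             spec_poly_deriv[OF R(1) \<phi>(1), symmetric] p'_def)
        finally have "poly (map_poly \<phi> q) t \<noteq> 0" "poly (pderiv P) t \<noteq> 0" using al by auto
        then show ?thesis using \<psi> q by auto
      qed
      have "card {t. poly P t = 0} = d" using card_simple_roots[of P] key degP by blast
      moreover have "P \<noteq> 0" using degP d0 by auto
      ultimately obtain T where "T \<subseteq> {t. poly P t = 0}" "card T = N" "finite T"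
        using dN poly_roots_finite[of P] by (metis finite_subset obtain_subset_with_card_n)
      then show ?thesis using key by blast
    qed
    moreover have "a * l \<in> R" "a * l \<notin> I"
      using ua l R is_subringD(4)[OF R(1)] prime by blast+
    ultimately show ?thesis by blast
  qed
qed

end

section \<open>Towers of several generators, and the fibres of a transcendental function\<close>

fun adjs :: "'r set \<Rightarrow> 'r list \<Rightarrow> 'r set" where
  "adjs R [] = R"
| "adjs R (y # ys) = adjs (adj R y) ys"

lemma adjs_subring:
  assumes "is_subring R" "R \<subseteq> S" "set ys \<subseteq> S"
  shows "is_subring (adjs R ys) \<and> R \<subseteq> adjs R ys \<and> set ys \<subseteq> adjs R ys"
  using assms
proof (induction ys arbitrary: R)
  case (Cons y ys)
  have "is_subring (adj R y)" "adj R y \<subseteq> S" "set ys \<subseteq> S"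
    using Cons.prems is_subring_adj adj_subset[OF subring] by auto
  then show ?case
    using Cons.IH[of "adj R y"] subset_adj[OF Cons.prems(1), of y] gen_in_adj[OF Cons.prems(1), of y]
    by auto
qed auto

text \<open>Obstructions descend and specializations ascend: \<open>b\<close> is traded for an
  element of the ring below it, generator by generator. One extension per generator is enough, so
  each step is the count with 1 in the place of \<open>N\<close>.\<close>

lemma extension_list:
  assumes "is_subring R" "R \<subseteq> S" "set ys \<subseteq> S" "b \<in> adjs R ys" "b \<notin> I"
  shows "\<exists>a\<in>R. a \<notin> I \<and> (\<forall>\<phi>::'r \<Rightarrow> 'a::{alg_closed_field, field_char_0}. specialization I R \<phi> \<and> \<phi> a \<noteq> 0 \<longrightarrow>
           (\<exists>\<psi>. specialization I (adjs R ys) \<psi> \<and> (\<forall>r\<in>R. \<psi> r = \<phi> r) \<and> \<psi> b \<noteq> 0))"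
  using assms
proof (induction ys arbitrary: R)
  case Nil
  then show ?case by auto
next
  case (Cons y ys)
  have *: "is_subring (adj R y)" "adj R y \<subseteq> S" "set ys \<subseteq> S" "b \<in> adjs (adj R y) ys" "y \<in> S"
    using Cons.prems is_subring_adj adj_subset[OF subring] by auto
  obtain a1 where a1: "a1 \<in> adj R y" "a1 \<notin> I"
    "\<And>\<phi>::'r \<Rightarrow> 'a. specialization I (adj R y) \<phi> \<Longrightarrow> \<phi> a1 \<noteq> 0 \<Longrightarrow>
           (\<exists>\<psi>. specialization I (adjs (adj R y) ys) \<psi> \<and> (\<forall>r\<in>adj R y. \<psi> r = \<phi> r) \<and> \<psi> b \<noteq> 0)"
    using Cons.IH[OF *(1-4) Cons.prems(5)] by blast
  \<comment> \<open>A relation of degree less than 1 is a constant that lies in \<open>I\<close>, so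
    the hypothesis of the count holds for any generator.\<close>
  have const: "\<forall>p\<in>polys_over R. poly p y \<in> I \<longrightarrow> degree p < 1 \<longrightarrow> (\<forall>i. coeff p i \<in> I)"
  proof (intro ballI impI)
    fix p assume that: "p \<in> polys_over R" "poly p y \<in> I" "degree p < 1"
    obtain c where "p = [:c:]" using \<open>degree p < 1\<close> by (metis degree_eq_zeroE less_one)
    then show "\<forall>i. coeff p i \<in> I" using that ideal_0 by (auto simp: coeff_pCons split: nat.splits)
  qed
  obtain a where a: "a \<in> R" "a \<notin> I" "\<forall>\<phi>::'r \<Rightarrow> 'a. specialization I R \<phi> \<and> \<phi> a \<noteq> 0 \<longrightarrow>
     (\<exists>T. finite T \<and> card T = 1 \<and> (\<forall>t\<in>T. \<exists>\<psi>. specialization I (adj R y) \<psi> \<and> (\<forall>r\<in>R. \<psi> r = \<phi> r) \<and>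
        \<psi> y = t \<and> \<psi> a1 \<noteq> 0))"
    using extension_count[OF Cons.prems(1,2) *(5) a1(1,2) const] by (elim bexE conjE) 
  have "\<exists>\<psi>. specialization I (adjs R (y # ys)) \<psi> \<and> (\<forall>r\<in>R. \<psi> r = \<phi> r) \<and> \<psi> b \<noteq> 0"
    if \<phi>: "specialization I R \<phi>" "\<phi> a \<noteq> 0" for \<phi> :: "'r \<Rightarrow> 'a"
  proof -
    obtain T where T: "card T = 1" "\<And>t. t \<in> T \<Longrightarrow> \<exists>\<psi>. specialization I (adj R y) \<psi> \<and> (\<forall>r\<in>R. \<psi> r = \<phi> r) \<and>
        \<psi> y = t \<and> \<psi> a1 \<noteq> 0" using a(3) \<phi> by blast
    then obtain \<psi>1 where \<psi>1: "specialization I (adj R y) \<psi>1" "\<forall>r\<in>R. \<psi>1 r = \<phi> r" "\<psi>1 a1 \<noteq> 0"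
      by (metis card_1_singletonE singletonI)
    obtain \<psi> where \<psi>: "specialization I (adjs (adj R y) ys) \<psi>" "\<forall>r\<in>adj R y. \<psi> r = \<psi>1 r" "\<psi> b \<noteq> 0"
      using a1(3)[OF \<psi>1(1,3)] by blast
    have "\<psi> r = \<phi> r" if "r \<in> R" for r
      using that \<psi>(2) \<psi>1(2) subset_adj[OF Cons.prems(1), of y] by (metis subsetD)
    then show ?thesis using \<psi> by auto
  qed
  then show ?case using a(1,2) by blast
qed

text \<open>The tower is: constants, then \<open>f\<close>, then \<open>g\<close>, then
  \<open>ys\<close>. The map \<open>f\<close> to \<open>e\<close> always exists since
  \<open>f\<close> is transcendental, \<open>g\<close> then has \<open>N\<close> possible values,
  and \<open>ys\<close> follow with one extension each. Descending from \<open>b\<close> through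
  this tower ends in a nonzero polynomial in \<open>f\<close>, whose roots are the exceptional
  \<open>e\<close>.\<close>

lemma fibre_specializations:
  fixes \<kappa> :: "'a::{alg_closed_field, field_char_0} \<Rightarrow> 'r"
  assumes \<kappa>: "\<And>c. \<kappa> c \<in> S" "\<And>c d. \<kappa> (c + d) = \<kappa> c + \<kappa> d" "\<And>c d. \<kappa> (c * d) = \<kappa> c * \<kappa> d" "\<kappa> 1 = 1"
    and fg: "f \<in> S" "g \<in> S" "set ys \<subseteq> S"
    and b: "b \<in> adjs (adj (adj (range \<kappa>) f) g) ys" "b \<notin> I"
    and N: "N > 0"
    and no_rel: "\<And>P :: nat \<Rightarrow> 'a poly. (\<Sum>i<N. poly (map_poly \<kappa> (P i)) f * g ^ i) \<in> I \<Longrightarrow> \<forall>i<N. P i = 0"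
  shows "\<exists>B. finite B \<and> (\<forall>e. e \<notin> B \<longrightarrow> (\<exists>T. finite T \<and> card T = N \<and> (\<forall>t\<in>T. \<exists>\<psi>::'r \<Rightarrow> 'a.
           specialization I (adjs (adj (adj (range \<kappa>) f) g) ys) \<psi> \<and> \<psi> b \<noteq> 0 \<and> \<psi> f = e \<and> \<psi> g = t \<and>
           (\<forall>c. \<psi> (\<kappa> c) = c))))"
proof -
  define R0 where "R0 = range \<kappa>"
  define R1 where "R1 = adj R0 f"
  define R2 where "R2 = adj R1 g"
  have \<kappa>0: "\<kappa> 0 = 0" using \<kappa>(2)[of 0 0] by simp
  have \<kappa>m: "\<kappa> (- c) = - \<kappa> c" for c using \<kappa>(2)[of c "- c"] \<kappa>0 by (simp add: eq_neg_iff_add_eq_0 add.commute)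
  have \<kappa>I: "c = 0" if "\<kappa> c \<in> I" for c
  proof (rule ccontr)
    assume "c \<noteq> 0"
    then have "\<kappa> (inverse c) * \<kappa> c = 1" by (simp flip: \<kappa>(3) add: \<kappa>(4))
    then show False using ideal_mult[OF \<kappa>(1)[of "inverse c"] that] one_notin_ideal by simp
  qed
  have inj: "inj \<kappa>"
  proof
    fix c d assume "\<kappa> c = \<kappa> d"
    then have "\<kappa> (c + - d) = 0" unfolding \<kappa>(2) \<kappa>m by simp
    then show "c = d" using \<kappa>I[of "c + - d"] ideal_0 by simp
  qed
  have R0: "is_subring R0" "R0 \<subseteq> S" unfolding R0_def is_subring_def
    using \<kappa> by (auto simp flip: \<kappa>(2,3) \<kappa>m)
  have R1: "is_subring R1" "R1 \<subseteq> S" "R0 \<subseteq> R1" "f \<in> R1" unfolding R1_def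
    using is_subring_adj[OF R0(1)] adj_subset[OF subring R0(2) fg(1)] subset_adj[OF R0(1)] gen_in_adj[OF R0(1)]
    by auto
  have R2: "is_subring R2" "R2 \<subseteq> S" "R1 \<subseteq> R2" unfolding R2_def
    using is_subring_adj[OF R1(1)] adj_subset[OF subring R1(2) fg(2)] subset_adj[OF R1(1)] by auto
  have lift0: "\<exists>Q. p = map_poly \<kappa> Q" if "p \<in> polys_over R0" for p
  proof (intro exI[of _ "map_poly (inv_into UNIV \<kappa>) p"] poly_eqI)
    fix i
    have "inv_into UNIV \<kappa> 0 = 0" using inj \<kappa>0 by (metis inv_f_f)
    moreover have "coeff p i \<in> range \<kappa>" using that polys_overD R0_def by blast
    ultimately show "coeff p i = coeff (map_poly \<kappa> (map_poly (inv_into UNIV \<kappa>) p)) i"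
      by (simp add: coeff_map_poly \<kappa>0 f_inv_into_f)
  qed
  have lift1: "\<exists>Q. r = poly (map_poly \<kappa> Q) f" if "r \<in> R1" for r
    using that lift0 unfolding R1_def adj_def by blast
  \<comment> \<open>A relation with only its term of index 0 shows that \<open>f\<close> is
    transcendental over the constants; this is where \<open>N\<close> must be positive.\<close>
  have rel1: "Q = 0" if "poly (map_poly \<kappa> Q) f \<in> I" for Q
  proof -
    have "(\<Sum>i<N. poly (map_poly \<kappa> (if i = 0 then Q else 0)) f * g ^ i) = poly (map_poly \<kappa> Q) f"
    proof -
      have "(\<Sum>i<N. poly (map_poly \<kappa> (if i = 0 then Q else 0)) f * g ^ i) = 
        (\<Sum>i<N. if i = 0 then poly (map_poly \<kappa> Q) f else 0)"
        by (rule sum.cong) auto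
      then show ?thesis using N by simp
    qed
    then show ?thesis using no_rel[of "\<lambda>i. if i = 0 then Q else 0"] that N by auto
  qed
  obtain a2 where a2: "a2 \<in> R2" "a2 \<notin> I" "\<And>\<phi>::'r \<Rightarrow> 'a. specialization I R2 \<phi> \<Longrightarrow> \<phi> a2 \<noteq> 0 \<Longrightarrow>
           (\<exists>\<psi>. specialization I (adjs R2 ys) \<psi> \<and> (\<forall>r\<in>R2. \<psi> r = \<phi> r) \<and> \<psi> b \<noteq> 0)"
    using extension_list[OF R2(1,2) fg(3) _ b(2)] b(1) unfolding R2_def R1_def R0_def by blast
  have rel2: "\<forall>p\<in>polys_over R1. poly p g \<in> I \<longrightarrow> degree p < N \<longrightarrow> (\<forall>i. coeff p i \<in> I)"
  proof (intro ballI impI)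
    fix p assume p: "p \<in> polys_over R1" "poly p g \<in> I" "degree p < N"
    have "\<forall>i. \<exists>Q. coeff p i = poly (map_poly \<kappa> Q) f" using lift1 polys_overD[OF p(1)] by blast
    then obtain P where P: "\<And>i. coeff p i = poly (map_poly \<kappa> (P i)) f" by metis
    have "poly p g = (\<Sum>i<N. coeff p i * g ^ i)" unfolding poly_altdef
      using p(3) by (intro sum.mono_neutral_left) (auto simp: coeff_eq_0)
    then have "\<forall>i<N. P i = 0" using no_rel[of P] p(2) unfolding P by simp
    then have "coeff p i = 0" if "i < N" for i using P[of i] that by simp
    moreover have "coeff p i = 0" if "i \<ge> N" for i using p(3) that by (simp add: coeff_eq_0)
    ultimately show "\<forall>i. coeff p i \<in> I" using ideal_0 by (metis not_less)
  qed
  have "b \<in> adjs R2 ys" using b(1) unfolding R2_def R1_def R0_def .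
  have "a2 \<in> adj R1 g" using a2(1) unfolding R2_def .
  then obtain a1 where a1: "a1 \<in> R1" "a1 \<notin> I" "\<forall>\<phi>::'r \<Rightarrow> 'a. specialization I R1 \<phi> \<and> \<phi> a1 \<noteq> 0 \<longrightarrow>
     (\<exists>T. finite T \<and> card T = N \<and> (\<forall>t\<in>T. \<exists>\<psi>. specialization I R2 \<psi> \<and> (\<forall>r\<in>R1. \<psi> r = \<phi> r) \<and>
        \<psi> g = t \<and> \<psi> a2 \<noteq> 0))"
    using extension_count[OF R1(1,2) fg(2) _ a2(2) rel2] unfolding R2_def by blast 
  obtain A where A: "a1 = poly (map_poly \<kappa> A) f" using lift1 a1(1) by blast
  have A0: "A \<noteq> 0" using A a1(2) ideal_0 by auto
  define \<phi>0 where "\<phi>0 = inv_into UNIV \<kappa>"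
  have \<phi>0: "\<phi>0 (\<kappa> c) = c" for c unfolding \<phi>0_def using inj by simp
  have spec0: "specialization I R0 \<phi>0"
    unfolding specialization_def R0_def
  proof (intro conjI ballI)
    show "\<phi>0 1 = 1" using \<phi>0[of 1] \<kappa>(4) by simp
    fix x y assume "x \<in> range \<kappa>" "y \<in> range \<kappa>"
    then obtain c d where cd: "x = \<kappa> c" "y = \<kappa> d" by blast
    show "\<phi>0 (x + y) = \<phi>0 x + \<phi>0 y" "\<phi>0 (x * y) = \<phi>0 x * \<phi>0 y"
      unfolding cd \<kappa>(2,3)[symmetric] \<phi>0 by simp_all
  next
    fix x assume "x \<in> range \<kappa> \<inter> I"
    then show "\<phi>0 x = 0" using \<kappa>I \<phi>0 by auto
  qed
  have map_\<phi>0: "map_poly \<phi>0 (map_poly \<kappa> Q) = Q" for Q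
    using \<phi>0 \<phi>0[of 0] \<kappa>0 by (intro poly_eqI) (simp add: coeff_map_poly)
  have main: "\<forall>e. e \<notin> {e. poly A e = 0} \<longrightarrow> (\<exists>T. finite T \<and> card T = N \<and> (\<forall>t\<in>T. \<exists>\<psi>::'r \<Rightarrow> 'a.
           specialization I (adjs R2 ys) \<psi> \<and> \<psi> b \<noteq> 0 \<and> \<psi> f = e \<and> \<psi> g = t \<and> (\<forall>c. \<psi> (\<kappa> c) = c)))"
  proof (intro allI impI)
    fix e assume "e \<notin> {e. poly A e = 0}"
    then have e: "poly A e \<noteq> 0" by simp
    have "poly (map_poly \<phi>0 p) e = 0" if "p \<in> polys_over R0" "poly p f \<in> I" for p
      using lift0[OF that(1)] that(2) rel1 map_\<phi>0 by (metis poly_0)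
    then obtain \<psi>1 where \<psi>1: "specialization I R1 \<psi>1"
       "\<And>p. p \<in> polys_over R0 \<Longrightarrow> \<psi>1 (poly p f) = poly (map_poly \<phi>0 p) e"
      using specialization_extend[OF R0(1) spec0 _ ideal_0, of f e] unfolding R1_def by blast
    have over: "map_poly \<kappa> Q \<in> polys_over R0" for Q
      unfolding polys_over_def R0_def by (simp add: coeff_map_poly \<kappa>0)
    have \<psi>1Q: "\<psi>1 (poly (map_poly \<kappa> Q) f) = poly Q e" for Q using \<psi>1(2)[OF over] map_\<phi>0 by simp
    have \<psi>1f: "\<psi>1 f = e" 
    proof -
      have "map_poly \<kappa> [:0, 1:] = [:0, 1:]"
        by (intro poly_eqI) (simp add: coeff_map_poly \<kappa>0 \<kappa>(4) coeff_pCons split: nat.splits)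
      then show ?thesis using \<psi>1Q[of "[:0, 1:]"] by simp
    qed
    have \<psi>1\<kappa>: "\<psi>1 (\<kappa> c) = c" for c
    proof -
      have "map_poly \<kappa> [:c:] = [:\<kappa> c:]"
        by (intro poly_eqI) (simp add: coeff_map_poly \<kappa>0 coeff_pCons split: nat.splits)
      then show ?thesis using \<psi>1Q[of "[:c:]"] by simp
    qed
    have nz: "\<psi>1 a1 \<noteq> 0" using \<psi>1Q A e by simp
    from a1(3)[rule_format, OF conjI[OF \<psi>1(1) nz]]
    obtain T where T: "finite T" "card T = N" "\<forall>t\<in>T. \<exists>\<psi>. specialization I R2 \<psi> \<and>
        (\<forall>r\<in>R1. \<psi> r = \<psi>1 r) \<and> \<psi> g = t \<and> \<psi> a2 \<noteq> 0"
      by (elim exE conjE)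
    have "\<exists>\<psi>::'r \<Rightarrow> 'a. specialization I (adjs R2 ys) \<psi> \<and> \<psi> b \<noteq> 0 \<and> \<psi> f = e \<and> \<psi> g = t \<and> (\<forall>c. \<psi> (\<kappa> c) = c)"
      if "t \<in> T" for t
    proof -
      obtain \<psi>2 where \<psi>2: "specialization I R2 \<psi>2" "\<forall>r\<in>R1. \<psi>2 r = \<psi>1 r" "\<psi>2 g = t" "\<psi>2 a2 \<noteq> 0"
        using bspec[OF T(3) \<open>t \<in> T\<close>] by blast
      obtain \<psi> where \<psi>: "specialization I (adjs R2 ys) \<psi>" "\<forall>r\<in>R2. \<psi> r = \<psi>2 r" "\<psi> b \<noteq> 0"
        using a2(3)[OF \<psi>2(1,4)] by blast
      have "\<psi> r = \<psi>1 r" if "r \<in> R1" for r using \<psi>(2) \<psi>2(2) R2(3) that by auto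
      moreover have "\<kappa> c \<in> R1" for c using R1(3) R0_def by blast
      moreover have "\<psi> g = t" using \<psi>(2) \<psi>2(3) gen_in_adj[OF R1(1), of g] unfolding R2_def by simp
      ultimately show ?thesis using \<psi> \<psi>1f \<psi>1\<kappa> R1(4) by auto
    qed
    with T(1,2) show "\<exists>T. finite T \<and> card T = N \<and> (\<forall>t\<in>T. \<exists>\<psi>::'r \<Rightarrow> 'a.
           specialization I (adjs R2 ys) \<psi> \<and> \<psi> b \<noteq> 0 \<and> \<psi> f = e \<and> \<psi> g = t \<and> (\<forall>c. \<psi> (\<kappa> c) = c))"
      by (intro exI[of _ T] conjI ballI)
  qed
  show ?thesis
    by (rule exI[of _ "{e. poly A e = 0}"], rule conjI[OF poly_roots_finite[OF A0]])
      (use main in \<open>unfold R2_def R1_def R0_def\<close>)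
qed

end

section \<open>Polynomial functions and Zariski closed sets\<close>

definition mono_val :: "(nat \<Rightarrow>\<^sub>0 nat) \<Rightarrow> 'a::comm_ring_1 vec \<Rightarrow> 'a" where
  "mono_val m x = (\<Prod>i\<in>Poly_Mapping.keys m. x $ i ^ Poly_Mapping.lookup m i)"

definition mono_deg :: "(nat \<Rightarrow>\<^sub>0 nat) \<Rightarrow> nat" where
  "mono_deg m = (\<Sum>i\<in>Poly_Mapping.keys m. Poly_Mapping.lookup m i)"

text \<open>\<open>pf n UNIV\<close> are all polynomial functions in \<open>n\<close> variables, \<open>pf n {d}\<close> the forms of degree \<open>d\<close>.\<close>

definition pf :: "nat \<Rightarrow> nat set \<Rightarrow> ('a::comm_ring_1 vec \<Rightarrow> 'a) set" where
  "pf n A = {mpol_eval p | p. p \<in> mpols n \<and> (\<forall>m\<in>Poly_Mapping.keys p. mono_deg m \<in> A)}"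

lemma mono_val_superset:
  assumes "finite J" "Poly_Mapping.keys m \<subseteq> J"
  shows "mono_val m x = (\<Prod>i\<in>J. x $ i ^ Poly_Mapping.lookup m i)"
  unfolding mono_val_def using assms by (intro prod.mono_neutral_left) (auto simp: in_keys_iff)

lemma mono_deg_superset:
  assumes "finite J" "Poly_Mapping.keys m \<subseteq> J"
  shows "mono_deg m = (\<Sum>i\<in>J. Poly_Mapping.lookup m i)"
  unfolding mono_deg_def using assms by (intro sum.mono_neutral_left) (auto simp: in_keys_iff)

lemma mono_val_add: "mono_val (m + m') x = mono_val m x * mono_val m' x"
proof -
  let ?J = "Poly_Mapping.keys m \<union> Poly_Mapping.keys m'"
  have "Poly_Mapping.keys (m + m') \<subseteq> ?J" by (rule Poly_Mapping.keys_add)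
  then show ?thesis
    by (simp add: mono_val_superset[of ?J] lookup_add power_add prod.distrib)
qed

lemma mono_deg_add: "mono_deg (m + m') = mono_deg m + mono_deg m'"
proof -
  let ?J = "Poly_Mapping.keys m \<union> Poly_Mapping.keys m'"
  have "Poly_Mapping.keys (m + m') \<subseteq> ?J" by (rule Poly_Mapping.keys_add)
  then show ?thesis
    by (simp add: mono_deg_superset[of ?J] lookup_add sum.distrib)
qed

lemma mpol_eval_superset:
  assumes "finite M" "Poly_Mapping.keys p \<subseteq> M"
  shows "mpol_eval p x = (\<Sum>m\<in>M. Poly_Mapping.lookup p m * mono_val m x)"
  unfolding mpol_eval_def mono_val_def using assms by (intro sum.mono_neutral_left) (auto simp: in_keys_iff)

lemma pf_sumD:
  assumes "f \<in> pf n A"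
  shows "\<exists>M c. finite M \<and> (\<forall>m\<in>M. Poly_Mapping.keys m \<subseteq> {..<n} \<and> mono_deg m \<in> A) \<and>
           f = (\<lambda>x. \<Sum>m\<in>M. c m * mono_val m x)"
proof -
  obtain p where p: "f = mpol_eval p" "p \<in> mpols n" "\<forall>m\<in>Poly_Mapping.keys p. mono_deg m \<in> A"
    using assms unfolding pf_def by blast
  show ?thesis
    using p mpol_eval_superset[of "Poly_Mapping.keys p" p] unfolding mpols_def
    by (intro exI[of _ "Poly_Mapping.keys p"] exI[of _ "Poly_Mapping.lookup p"]) auto
qed

lemma pf_add:
  assumes "f \<in> pf n A" "g \<in> pf n A"
  shows "(\<lambda>x. f x + g x) \<in> pf n A"
proof -
  obtain p q where p: "f = mpol_eval p" "p \<in> mpols n" "\<forall>m\<in>Poly_Mapping.keys p. mono_deg m \<in> A"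
    and q: "g = mpol_eval q" "q \<in> mpols n" "\<forall>m\<in>Poly_Mapping.keys q. mono_deg m \<in> A"
    using assms unfolding pf_def by blast
  let ?M = "Poly_Mapping.keys p \<union> Poly_Mapping.keys q"
  have sub: "Poly_Mapping.keys (p + q) \<subseteq> ?M" by (rule Poly_Mapping.keys_add)
  have "(\<lambda>x. f x + g x) = mpol_eval (p + q)"
    unfolding p q using sub
    by (intro ext) (simp add: mpol_eval_superset[of ?M] lookup_add algebra_simps sum.distrib)
  moreover have "p + q \<in> mpols n" using p q sub unfolding mpols_def by blast
  ultimately show ?thesis unfolding pf_def using p q sub by blast
qed

lemma pf_mono_val:
  assumes "Poly_Mapping.keys m \<subseteq> {..<n}" "mono_deg m \<in> A"
  shows "(\<lambda>x. c * mono_val m x) \<in> pf n A"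
proof -
  have "(\<lambda>x. c * mono_val m x) = mpol_eval (Poly_Mapping.single m c)"
    by (intro ext) (simp add: mpol_eval_superset[of "{m}"])
  moreover have "Poly_Mapping.keys (Poly_Mapping.single m c) \<subseteq> {m}" by simp
  ultimately show ?thesis unfolding pf_def mpols_def using assms by fast
qed

lemma pf_zero: "(\<lambda>x. 0) \<in> pf n A"
proof -
  have "(\<lambda>x. 0) = mpol_eval 0" by (intro ext) (simp add: mpol_eval_def)
  then show ?thesis unfolding pf_def mpols_def by (auto intro!: exI[of _ 0])
qed

lemma pf_sum: "(\<And>i. i \<in> J \<Longrightarrow> f i \<in> pf n A) \<Longrightarrow> (\<lambda>x. \<Sum>i\<in>J. f i x) \<in> pf n A"
  by (induction J rule: infinite_finite_induct) (auto intro: pf_zero pf_add)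

lemma pf_mult:
  assumes "f \<in> pf n A" "g \<in> pf n B" "\<And>a b. a \<in> A \<Longrightarrow> b \<in> B \<Longrightarrow> a + b \<in> C"
  shows "(\<lambda>x. f x * g x) \<in> pf n C"
proof -
  obtain M c where f: "finite M" "\<forall>m\<in>M. Poly_Mapping.keys m \<subseteq> {..<n} \<and> mono_deg m \<in> A"
           "f = (\<lambda>x. \<Sum>m\<in>M. c m * mono_val m x)" using pf_sumD[OF assms(1)] by blast
  obtain M' c' where g: "finite M'" "\<forall>m\<in>M'. Poly_Mapping.keys m \<subseteq> {..<n} \<and> mono_deg m \<in> B"
           "g = (\<lambda>x. \<Sum>m\<in>M'. c' m * mono_val m x)" using pf_sumD[OF assms(2)] by blast
  have "(\<lambda>x. f x * g x) = (\<lambda>x. \<Sum>m\<in>M. \<Sum>m'\<in>M'. (c m * c' m') * mono_val (m + m') x)"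
    unfolding f g sum_product by (intro ext sum.cong refl) (simp add: mono_val_add mult_ac)
  moreover have "(\<lambda>x. (c m * c' m') * mono_val (m + m') x) \<in> pf n C" if "m \<in> M" "m' \<in> M'" for m m'
  proof (rule pf_mono_val)
    show "Poly_Mapping.keys (m + m') \<subseteq> {..<n}" using f(2) g(2) that Poly_Mapping.keys_add[of m m'] by blast
    show "mono_deg (m + m') \<in> C" using f(2) g(2) that assms(3) by (simp add: mono_deg_add)
  qed
  ultimately show ?thesis by (auto intro!: pf_sum)
qed

lemma pf_const: "0 \<in> A \<Longrightarrow> (\<lambda>x. c) \<in> pf n A"
  using pf_mono_val[of 0 n A c] by (simp add: mono_val_def mono_deg_def)

lemma pf_coord: "1 \<in> A \<Longrightarrow> i < n \<Longrightarrow> (\<lambda>x. x $ i) \<in> pf n A"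
  using pf_mono_val[of "Poly_Mapping.single i 1" n A 1] by (simp add: mono_val_def mono_deg_def)

lemma pf_subset: "A \<subseteq> B \<Longrightarrow> f \<in> pf n A \<Longrightarrow> f \<in> pf n B"
  unfolding pf_def by blast

lemma pf_smult: "f \<in> pf n A \<Longrightarrow> (\<lambda>x. c * f x) \<in> pf n A"
  using pf_mult[OF pf_const[of "{0}" c n], of f A A] by simp

lemma pf_uminus: "f \<in> pf n A \<Longrightarrow> (\<lambda>x. - f x) \<in> pf n A"
  using pf_smult[of f n A "- 1"] by simp

lemma pf_diff: "f \<in> pf n A \<Longrightarrow> g \<in> pf n A \<Longrightarrow> (\<lambda>x. f x - g x) \<in> pf n A"
  using pf_add[OF _ pf_uminus] by fastforce

lemma pf_times: "f \<in> pf n UNIV \<Longrightarrow> g \<in> pf n UNIV \<Longrightarrow> (\<lambda>x. f x * g x) \<in> pf n UNIV"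
  by (rule pf_mult) auto

lemma pf_power: "f \<in> pf n {d} \<Longrightarrow> (\<lambda>x. f x ^ k) \<in> pf n {k * d}"
  by (induction k) (auto intro: pf_const pf_mult)

lemma pf_power_UNIV: "f \<in> pf n UNIV \<Longrightarrow> (\<lambda>x. f x ^ k) \<in> pf n UNIV"
  by (induction k) (auto intro: pf_const pf_times)

lemma pf_prod: "(\<And>i. i \<in> J \<Longrightarrow> f i \<in> pf n UNIV) \<Longrightarrow> (\<lambda>x. \<Prod>i\<in>J. f i x) \<in> pf n UNIV"
  by (induction J rule: infinite_finite_induct) (auto intro: pf_const pf_times)

lemma pf_poly: "f \<in> pf n UNIV \<Longrightarrow> (\<lambda>x. poly p (f x)) \<in> pf n UNIV"
  unfolding poly_altdef by (intro pf_sum pf_smult pf_power_UNIV)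

lemmas pf_intros = pf_const pf_coord pf_add pf_diff pf_uminus pf_times pf_power_UNIV pf_sum pf_prod pf_poly

lemma pf_subst:
  assumes "f \<in> pf N UNIV" "\<And>i. i < N \<Longrightarrow> cs i \<in> pf n UNIV"
  shows "(\<lambda>x. f (vec N (\<lambda>i. cs i x))) \<in> pf n UNIV"
proof -
  obtain M c where f: "finite M" "\<forall>m\<in>M. Poly_Mapping.keys m \<subseteq> {..<N} \<and> mono_deg m \<in> UNIV"
           "f = (\<lambda>x. \<Sum>m\<in>M. c m * mono_val m x)" using pf_sumD[OF assms(1)] by blast
  have "(\<lambda>x. mono_val m (vec N (\<lambda>i. cs i x))) \<in> pf n UNIV" if "m \<in> M" for m
  proof -
    have "(\<lambda>x. mono_val m (vec N (\<lambda>i. cs i x))) = 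
      (\<lambda>x. \<Prod>i\<in>Poly_Mapping.keys m. cs i x ^ Poly_Mapping.lookup m i)"
      unfolding mono_val_def using f(2) that
      by (intro ext prod.cong) (auto simp: subset_eq)
    moreover have "\<dots> \<in> pf n UNIV" using f(2) that by (intro pf_prod pf_power_UNIV assms(2)) auto
    ultimately show ?thesis by simp
  qed
  then show ?thesis unfolding f by (intro pf_sum pf_smult)
qed

lemma pf_curve:
  assumes "f \<in> pf N UNIV"
  shows "\<exists>r. \<forall>s. f (vec N (\<lambda>i. poly (W i) s)) = poly r s"
proof -
  obtain M c where f: "finite M" "\<forall>m\<in>M. Poly_Mapping.keys m \<subseteq> {..<N} \<and> mono_deg m \<in> UNIV"
           "f = (\<lambda>x. \<Sum>m\<in>M. c m * mono_val m x)" using pf_sumD[OF assms(1)] by blast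
  have "f (vec N (\<lambda>i. poly (W i) s)) =
    poly (\<Sum>m\<in>M. smult (c m) (\<Prod>i\<in>Poly_Mapping.keys m. W i ^ Poly_Mapping.lookup m i)) s" for s
    unfolding f mono_val_def poly_sum poly_smult poly_prod poly_power using f(2)
    by (intro sum.cong prod.cong arg_cong2[where f = "(*)"]) (auto simp: subset_eq)
  then show ?thesis by blast
qed

lemma pf_homogeneous_smult:
  assumes "f \<in> pf N {d}" "v \<in> carrier_vec N"
  shows "f (c \<cdot>\<^sub>v v) = c ^ d * f v"
proof -
  obtain M a where f: "finite M" "\<forall>m\<in>M. Poly_Mapping.keys m \<subseteq> {..<N} \<and> mono_deg m \<in> {d}"
           "f = (\<lambda>x. \<Sum>m\<in>M. a m * mono_val m x)" using pf_sumD[OF assms(1)] by blast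
  have "mono_val m (c \<cdot>\<^sub>v v) = c ^ d * mono_val m v" if "m \<in> M" for m
  proof -
    have "mono_val m (c \<cdot>\<^sub>v v) = (\<Prod>i\<in>Poly_Mapping.keys m. c ^ Poly_Mapping.lookup m i * v $ i ^ Poly_Mapping.lookup m i)"
      unfolding mono_val_def using f(2) that assms(2)
      by (intro prod.cong refl) (auto simp: power_mult_distrib subset_eq)
    also have "\<dots> = c ^ mono_deg m * mono_val m v"
      unfolding prod.distrib mono_deg_def mono_val_def power_sum ..
    finally show ?thesis using f(2) that by simp
  qed
  then show ?thesis unfolding f by (simp add: sum_distrib_left mult_ac)
qed

lemma mpol_eval_in_pf: "p \<in> mpols n \<Longrightarrow> mpol_eval p \<in> pf n UNIV"
  unfolding pf_def by blast

lemma homogeneous_pfD: "p \<in> mpols n \<Longrightarrow> homogeneous p \<Longrightarrow> \<exists>d. mpol_eval p \<in> pf n {d}"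
  unfolding pf_def homogeneous_def mono_deg_def by blast

lemma homogeneous_pfI: "f \<in> pf n {d} \<Longrightarrow> \<exists>p\<in>mpols n. homogeneous p \<and> f = mpol_eval p"
  unfolding pf_def homogeneous_def mono_deg_def by blast

text \<open>Kronecker substitution: \<open>x\<^sub>i = t ^ (B ^ i)\<close> maps distinct monomials to distinct powers of \<open>t\<close>.\<close>

lemma digit_sum_inject:
  fixes a b :: "nat \<Rightarrow> nat"
  assumes "\<And>i. i < N \<Longrightarrow> a i < B" "\<And>i. i < N \<Longrightarrow> b i < B" "(\<Sum>i<N. a i * B ^ i) = (\<Sum>i<N. b i * B ^ i)" "i < N"
  shows "a i = b i"
  using assms
proof (induction N arbitrary: a b i)
  case (Suc N)
  have split: "(\<Sum>i<Suc N. c i * B ^ i) = c 0 + B * (\<Sum>i<N. c (Suc i) * B ^ i)" for c :: "nat \<Rightarrow> nat"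
    unfolding sum.lessThan_Suc_shift by (simp add: sum_distrib_left mult_ac)
  have eq: "a 0 + B * (\<Sum>i<N. a (Suc i) * B ^ i) = b 0 + B * (\<Sum>i<N. b (Suc i) * B ^ i)"
    using Suc.prems(3) unfolding split .
  have lt: "a 0 < B" "b 0 < B" using Suc.prems(1,2)[of 0] by auto
  have "(a 0 + B * (\<Sum>i<N. a (Suc i) * B ^ i)) mod B = (b 0 + B * (\<Sum>i<N. b (Suc i) * B ^ i)) mod B"
    using eq by simp
  then have 0: "a 0 = b 0" using lt by simp
  then have "(\<Sum>i<N. a (Suc i) * B ^ i) = (\<Sum>i<N. b (Suc i) * B ^ i)" using eq lt by simp
  then have "a (Suc j) = b (Suc j)" if "j < N" for j
    using Suc.IH[of "\<lambda>i. a (Suc i)" "\<lambda>i. b (Suc i)" j] Suc.prems(1,2) that by auto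
  then show ?case using 0 Suc.prems(4) by (cases i) auto
qed simp

lemma mpol_nonzero_value:
  fixes p :: "'a::field_char_0 mpol"
  assumes "p \<in> mpols N" "p \<noteq> 0"
  shows "\<exists>x\<in>carrier_vec N. mpol_eval p x \<noteq> 0"
proof -
  let ?K = "Poly_Mapping.keys p"
  have keys: "Poly_Mapping.keys m \<subseteq> {..<N}" if "m \<in> ?K" for m using assms(1) that unfolding mpols_def by blast
  \<comment> \<open>\<open>B\<close> exceeds every exponent in \<open>p\<close>, so
    \<open>e m\<close> has the exponents of \<open>m\<close> as its digits in base
    \<open>B\<close>.\<close>
  define B where "B = Suc (Max ((\<lambda>(m, i). Poly_Mapping.lookup m i) ` (?K \<times> {..<N})))"
  have lt: "Poly_Mapping.lookup m i < B" if "m \<in> ?K" "i < N" for m i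
    unfolding B_def less_Suc_eq_le using that by (intro Max_ge) force+
  define e where "e m = (\<Sum>i<N. Poly_Mapping.lookup m i * B ^ i)" for m :: "nat \<Rightarrow>\<^sub>0 nat"
  have inj: "inj_on e ?K"
  proof
    fix m m' assume m: "m \<in> ?K" "m' \<in> ?K" "e m = e m'"
    have "Poly_Mapping.lookup m i = Poly_Mapping.lookup m' i" for i
    proof (cases "i < N")
      case True
      then show ?thesis using digit_sum_inject[of N "Poly_Mapping.lookup m" B "Poly_Mapping.lookup m'" i]
          m lt unfolding e_def by blast
    next
      case False
      then have "i \<notin> Poly_Mapping.keys m" "i \<notin> Poly_Mapping.keys m'" using keys m by auto
      then show ?thesis by (simp add: in_keys_iff)
    qed
    then show "m = m'" by (simp add: poly_mapping_eqI)
  qed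
  define r where "r = (\<Sum>m\<in>?K. monom (Poly_Mapping.lookup p m) (e m))"
  obtain m0 where m0: "m0 \<in> ?K" using assms(2) by fastforce
  have "coeff r (e m0) = (\<Sum>m\<in>?K. if m = m0 then Poly_Mapping.lookup p m else 0)"
    unfolding r_def coeff_sum coeff_monom using inj m0 by (intro sum.cong) (auto dest: inj_onD)
  also have "\<dots> = Poly_Mapping.lookup p m0" using m0 by simp
  finally have "r \<noteq> 0" using m0 by (auto simp: in_keys_iff)
  then obtain t where t: "poly r t \<noteq> 0" using poly_all_0_iff_0 by blast
  have "mpol_eval p (vec N (\<lambda>i. t ^ (B ^ i))) = poly r t"
  proof -
    have "mono_val m (vec N (\<lambda>i. t ^ (B ^ i))) = t ^ e m" if "m \<in> ?K" for m
      unfolding mono_val_superset[OF finite_lessThan keys[OF that]] e_def power_sum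
      by (intro prod.cong) (auto simp: power_mult mult.commute simp flip: power_mult)
    then show ?thesis
      unfolding mpol_eval_superset[OF finite_keys order_refl] r_def poly_sum poly_monom by simp
  qed
  then show ?thesis using t by (intro bexI[of _ "vec N (\<lambda>i. t ^ (B ^ i))"]) auto
qed

lemma pf_line:
  assumes "f \<in> pf N UNIV" "a \<in> carrier_vec N" "b \<in> carrier_vec N"
  shows "\<exists>r. \<forall>s. f (a + s \<cdot>\<^sub>v b) = poly r s"
proof -
  have "a + s \<cdot>\<^sub>v b = vec N (\<lambda>i. poly [:a $ i, b $ i:] s)" for s using assms(2,3) by (intro eq_vecI) auto
  then show ?thesis using pf_curve[OF assms(1), of "\<lambda>i. [:a $ i, b $ i:]"] by simp
qed

lemma pf_line_finite:
  assumes "f \<in> pf N UNIV" "a \<in> carrier_vec N" "b \<in> carrier_vec N" "f a \<noteq> (0 :: 'a::field)"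
  shows "finite {s. f (a + s \<cdot>\<^sub>v b) = 0}"
proof -
  obtain r where r: "\<forall>s. f (a + s \<cdot>\<^sub>v b) = poly r s" using pf_line[OF assms(1-3)] by blast
  have "a + 0 \<cdot>\<^sub>v b = a" using assms(2,3) by (intro eq_vecI) auto
  then have "r \<noteq> 0" using r[rule_format, of 0] assms(4) by auto
  then show ?thesis using poly_roots_finite[of r] r by simp
qed

text \<open>A point good for the old functions and a point good for the new one are joined by a
  line. Each function is nonzero somewhere on it, hence vanishes there only finitely often.\<close>

lemma generic_choice:
  fixes \<Phi> :: "('a::field_char_0 vec \<Rightarrow> 'a) set"
  assumes "finite \<Phi>" "\<Phi> \<subseteq> pf N UNIV" "\<And>f. f \<in> \<Phi> \<Longrightarrow> \<exists>x\<in>carrier_vec N. f x \<noteq> 0"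
  shows "\<exists>x\<in>carrier_vec N. \<forall>f\<in>\<Phi>. f x \<noteq> 0"
  using assms
proof (induction \<Phi> rule: finite_induct)
  case empty
  then show ?case by (auto intro: exI[of _ "0\<^sub>v N"])
next
  case (insert g \<Phi>)
  obtain a where a: "a \<in> carrier_vec N" "\<forall>f\<in>\<Phi>. f a \<noteq> 0" using insert by blast
  obtain b where b: "b \<in> carrier_vec N" "g b \<noteq> 0" using insert.prems by blast
  define F where "F = (\<Union>f\<in>\<Phi>. {s. f (a + s \<cdot>\<^sub>v (b - a)) = 0})"
  have 1: "finite F" unfolding F_def using insert a b
    by (intro finite_UN_I pf_line_finite[where N = N]) auto
  have 2: "finite {s. g (b + s \<cdot>\<^sub>v (a - b)) = 0}"
    using insert a b by (intro pf_line_finite[where N = N]) auto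
  \<comment> \<open>The line is traversed from \<open>a\<close> for the old functions and from
    \<open>b\<close> for \<open>g\<close>; the reflection \<open>1 - s\<close> matches the two
    parametrizations.\<close>
  have "finite (F \<union> (\<lambda>s. 1 - s) ` {s. g (b + s \<cdot>\<^sub>v (a - b)) = 0})" using 1 2 by simp
  then obtain s where s: "s \<notin> F \<union> (\<lambda>s. 1 - s) ` {s. g (b + s \<cdot>\<^sub>v (a - b)) = 0}"
    using ex_new_if_finite[OF infinite_UNIV_char_0] by blast
  have "a + s \<cdot>\<^sub>v (b - a) = b + (1 - s) \<cdot>\<^sub>v (a - b)"
    using a b by (intro eq_vecI) (auto simp: algebra_simps)
  moreover have "g (b + (1 - s) \<cdot>\<^sub>v (a - b)) \<noteq> 0" using s by force
  ultimately have "g (a + s \<cdot>\<^sub>v (b - a)) \<noteq> 0" by simp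
  moreover have "a + s \<cdot>\<^sub>v (b - a) \<in> carrier_vec N" using a b by simp
  ultimately show ?case using s unfolding F_def by (intro bexI[of _ "a + s \<cdot>\<^sub>v (b - a)"]) auto
qed

section \<open>Zariski closed and irreducible sets in terms of polynomial functions\<close>

lemma algebraic_set_pf:
  "algebraic_set n V \<longleftrightarrow> (\<exists>F\<subseteq>pf n UNIV. V = {x \<in> carrier_vec n. \<forall>f\<in>F. f x = 0})"
proof
  assume "algebraic_set n V"
  then obtain I where I: "I \<subseteq> mpols n" "V = {x \<in> carrier_vec n. \<forall>p\<in>I. mpol_eval p x = 0}"
    unfolding algebraic_set_def by blast
  then show "\<exists>F\<subseteq>pf n UNIV. V = {x \<in> carrier_vec n. \<forall>f\<in>F. f x = 0}"
    by (intro exI[of _ "mpol_eval ` I"]) (auto intro: mpol_eval_in_pf)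
next
  assume "\<exists>F\<subseteq>pf n UNIV. V = {x \<in> carrier_vec n. \<forall>f\<in>F. f x = 0}"
  then obtain F where F: "F \<subseteq> pf n UNIV" "V = {x \<in> carrier_vec n. \<forall>f\<in>F. f x = 0}" by blast
  define I where "I = {p \<in> mpols n. mpol_eval p \<in> F}"
  have "\<exists>p\<in>I. mpol_eval p = f" if "f \<in> F" for f using F(1) that unfolding pf_def I_def by blast
  then have "V = {x \<in> carrier_vec n. \<forall>p\<in>I. mpol_eval p x = 0}" unfolding F(2) I_def by fast
  then show "algebraic_set n V" unfolding algebraic_set_def I_def by blast
qed

lemma algebraic_set_carrier: "algebraic_set n V \<Longrightarrow> V \<subseteq> carrier_vec n"
  unfolding algebraic_set_def by blast

lemma algebraic_set_Int_zeros:
  assumes "algebraic_set n V" "F \<subseteq> pf n UNIV"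
  shows "algebraic_set n {x \<in> V. \<forall>f\<in>F. f x = 0}"
proof -
  obtain F' where "F' \<subseteq> pf n UNIV" "V = {x \<in> carrier_vec n. \<forall>f\<in>F'. f x = 0}"
    using assms(1) unfolding algebraic_set_pf by blast
  then show ?thesis unfolding algebraic_set_pf using assms(2) by (intro exI[of _ "F' \<union> F"]) auto
qed

text \<open>Mostly used contrapositively: a point outside a closed set is separated from it by a
  polynomial function.\<close>

lemma algebraic_set_mem:
  assumes "algebraic_set n V" "x \<in> carrier_vec n" "\<And>f. f \<in> pf n UNIV \<Longrightarrow> \<forall>y\<in>V. f y = 0 \<Longrightarrow> f x = 0"
  shows "x \<in> V"
proof -
  obtain F' where "F' \<subseteq> pf n UNIV" "V = {x \<in> carrier_vec n. \<forall>f\<in>F'. f x = 0}"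
    using assms(1) unfolding algebraic_set_pf by blast
  then show ?thesis using assms(2,3) by blast
qed

lemma algebraic_set_closure_form:
  "algebraic_set n {x \<in> carrier_vec n. \<forall>f\<in>pf n UNIV. (\<forall>y\<in>S. f y = 0) \<longrightarrow> f x = 0}"
  unfolding algebraic_set_pf
  by (intro exI[of _ "{f \<in> pf n UNIV. \<forall>y\<in>S. f y = 0}"]) auto

lemma zariski_closure_pf:
  assumes "S \<subseteq> carrier_vec n"
  shows "zariski_closure n S = {x \<in> carrier_vec n. \<forall>f\<in>pf n UNIV. (\<forall>y\<in>S. f y = 0) \<longrightarrow> f x = 0}" (is "_ = ?C")
proof
  show "zariski_closure n S \<subseteq> ?C"
    unfolding zariski_closure_def using algebraic_set_closure_form[of n S] assms
    by (intro Inter_lower) auto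
  show "?C \<subseteq> zariski_closure n S"
    unfolding zariski_closure_def
  proof (intro Inter_greatest subsetI)
    fix V x assume V: "V \<in> {V. algebraic_set n V \<and> S \<subseteq> V}" and x: "x \<in> ?C"
    show "x \<in> V" by (rule algebraic_set_mem[of n]) (use V x in \<open>blast+\<close>)
  qed
qed

lemma irreducible_setD: "irreducible_set n D \<Longrightarrow> algebraic_set n D" "irreducible_set n D \<Longrightarrow> D \<noteq> {}"
  unfolding irreducible_set_def by auto

text \<open>The zero sets of \<open>f\<close> and \<open>g\<close> in \<open>D\<close> are closed
  and cover it. Primality of the vanishing ideal is the form in which irreducibility is used
  below.\<close>

lemma irreducible_set_prime:
  assumes "irreducible_set n D" "f \<in> pf n UNIV" "g \<in> pf n UNIV" "\<forall>x\<in>D. f x * g x = (0 :: 'a::field)"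
  shows "(\<forall>x\<in>D. f x = 0) \<or> (\<forall>x\<in>D. g x = 0)"
proof -
  define A where "A h = {x \<in> D. \<forall>k\<in>{h}. k x = 0}" for h :: "'a vec \<Rightarrow> 'a"
  have "algebraic_set n (A f)" "algebraic_set n (A g)"
    unfolding A_def using assms(2,3) by (auto intro!: algebraic_set_Int_zeros simp only: irreducible_setD(1)[OF assms(1)])
  moreover have "D = A f \<union> A g" unfolding A_def using assms(4) by auto
  ultimately have "A f = D \<or> A g = D" using assms(1) unfolding irreducible_set_def by blast
  then show ?thesis unfolding A_def by blast
qed

lemma irreducible_set_prime_prod:
  assumes "irreducible_set n D" "finite J" "\<And>i. i \<in> J \<Longrightarrow> f i \<in> pf n UNIV"
    "\<forall>x\<in>D. (\<Prod>i\<in>J. f i x) = (0 :: 'a::field)"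
  shows "\<exists>i\<in>J. \<forall>x\<in>D. f i x = 0"
  using assms(2-4)
proof (induction J rule: finite_induct)
  case empty
  then show ?case using irreducible_setD(2)[OF assms(1)] by auto
next
  case (insert i J)
  have "(\<forall>x\<in>D. f i x = 0) \<or> (\<forall>x\<in>D. (\<Prod>i\<in>J. f i x) = 0)"
    using insert by (intro irreducible_set_prime[OF assms(1)] pf_prod) auto
  then show ?case using insert by auto
qed

lemma irreducible_closure:
  assumes "S \<subseteq> carrier_vec n" "S \<noteq> {}"
    and prime: "\<And>f g. f \<in> pf n UNIV \<Longrightarrow> g \<in> pf n UNIV \<Longrightarrow> \<forall>x\<in>S. f x * g x = (0 :: 'a::field) \<Longrightarrow>
       (\<forall>x\<in>S. f x = 0) \<or> (\<forall>x\<in>S. g x = 0)"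
  shows "irreducible_set n (zariski_closure n S)"
proof -
  have alg: "algebraic_set n (zariski_closure n S)"
    unfolding zariski_closure_pf[OF assms(1)] by (rule algebraic_set_closure_form)
  have sub: "S \<subseteq> zariski_closure n S" unfolding zariski_closure_def by blast
  have "A = zariski_closure n S \<or> B = zariski_closure n S"
    if AB: "algebraic_set n A" "algebraic_set n B" "zariski_closure n S = A \<union> B" for A B
  proof (rule ccontr)
    assume "\<not> ?thesis"
    then have "\<not> S \<subseteq> A" "\<not> S \<subseteq> B" using AB unfolding zariski_closure_def by blast+
    then obtain x y where xy: "x \<in> S" "x \<notin> A" "y \<in> S" "y \<notin> B" by blast
    obtain f where f: "f \<in> pf n UNIV" "\<forall>z\<in>A. f z = 0" "f x \<noteq> 0"
      using algebraic_set_mem[OF AB(1)] xy assms(1) by blast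
    obtain g where g: "g \<in> pf n UNIV" "\<forall>z\<in>B. g z = 0" "g y \<noteq> 0"
      using algebraic_set_mem[OF AB(2)] xy assms(1) by blast
    have "\<forall>z\<in>S. f z * g z = 0" using f g AB(3) sub by auto
    then show False using prime[OF f(1) g(1)] f(3) g(3) xy by blast
  qed
  then show ?thesis unfolding irreducible_set_def using alg sub assms(2) by blast
qed

lemma irreducible_singleton:
  assumes "x \<in> carrier_vec n"
  shows "irreducible_set n {x :: 'a::field vec}"
proof -
  have "algebraic_set n {x}"
    unfolding algebraic_set_pf
  proof (intro exI conjI)
    show "(\<lambda>i y. y $ i - x $ i) ` {..<n} \<subseteq> pf n UNIV" by (auto intro!: pf_intros)
    show "{x} = {y \<in> carrier_vec n. \<forall>f\<in>(\<lambda>i y. y $ i - x $ i) ` {..<n}. f y = 0}"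
      using assms by (auto intro!: eq_vecI)
  qed
  then show ?thesis unfolding irreducible_set_def by blast
qed

section \<open>Homogeneous coordinates, the projective closure and linear forms\<close>

lemma append_one_eq: "x \<in> carrier_vec n \<Longrightarrow> append_one x = vec (n + 1) (\<lambda>i. if i < n then x $ i else 1)"
  unfolding append_one_def by (intro eq_vecI) auto

lemma append_one_carrier: "x \<in> carrier_vec n \<Longrightarrow> append_one x \<in> carrier_vec (n + 1)"
  by (simp add: append_one_eq)

lemma append_one_index: "x \<in> carrier_vec n \<Longrightarrow> i \<le> n \<Longrightarrow> append_one x $ i = (if i < n then x $ i else 1)"
  by (simp add: append_one_eq)

lemma append_one_nonzero: "x \<in> carrier_vec n \<Longrightarrow> append_one x \<noteq> 0\<^sub>v (n + 1)"
  by (metis append_one_index index_zero_vec(1) less_add_one order_refl less_irrefl zero_neq_one)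

lemma pf_append_one:
  assumes "f \<in> pf (n + 1) UNIV"
  shows "\<exists>g\<in>pf n UNIV. \<forall>x\<in>carrier_vec n. g x = f (append_one x)"
proof -
  have *: "(\<lambda>x. f (vec (n + 1) (\<lambda>i. (if i < n then (\<lambda>x. x $ i) else (\<lambda>x. 1)) x))) \<in> pf n UNIV"
    by (intro pf_subst[OF assms]) (auto intro: pf_intros)
  have "vec (n + 1) (\<lambda>i. (if i < n then (\<lambda>x. x $ i) else (\<lambda>x. 1)) x) = append_one x"
    if "x \<in> carrier_vec n" for x :: "'a vec"
    using that by (auto simp: append_one_eq intro!: eq_vecI)
  then show ?thesis by (intro bexI[OF _ *]) simp
qed

text \<open>\<open>in_closure n D v\<close>: the projective point with coordinates \<open>v\<close> lies on the projective closure of \<open>D\<close>.\<close>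

definition in_closure :: "nat \<Rightarrow> 'a::field vec set \<Rightarrow> 'a vec \<Rightarrow> bool" where
  "in_closure n D v \<longleftrightarrow> (\<forall>d. \<forall>f\<in>pf (n + 1) {d}. (\<forall>x\<in>D. f (append_one x) = 0) \<longrightarrow> f v = 0)"

lemma in_closureD: "in_closure n D v \<Longrightarrow> f \<in> pf (n + 1) {d} \<Longrightarrow> (\<And>x. x \<in> D \<Longrightarrow> f (append_one x) = 0) \<Longrightarrow> f v = 0"
  unfolding in_closure_def by blast

lemma in_closure_point: "x \<in> D \<Longrightarrow> in_closure n D (append_one x)"
  unfolding in_closure_def by blast

text \<open>A form vanishes at all representatives of a projective point or at none. So one
  representative \<open>v\<close> decides membership, and projective points need not be handled as
  sets any more.\<close>

lemma proj_closure_iff: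
  assumes D: "D \<subseteq> carrier_vec n" and v: "v \<in> carrier_vec (n + 1)" "v \<noteq> 0\<^sub>v (n + 1)"
  shows "proj_point v \<in> proj_closure n D \<longleftrightarrow> in_closure n D v"
proof -
  have self: "w \<in> proj_point w" if "w \<in> carrier_vec (n + 1)" for w :: "'a vec"
    unfolding proj_point_def using that by (auto intro!: exI[of _ 1])
  have point: "(\<forall>w\<in>proj_point u. f w = 0) \<longleftrightarrow> f u = 0" if "f \<in> pf (n + 1) {d}" "u \<in> carrier_vec (n + 1)" for f d and u :: "'a vec"
    
  proof
    assume "f u = 0"
    then show "\<forall>w\<in>proj_point u. f w = 0"
      unfolding proj_point_def using pf_homogeneous_smult[OF that] by auto
  qed (use self[OF that(2)] in blast)
  show ?thesis
  proof
    assume L: "proj_point v \<in> proj_closure n D"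
    show "in_closure n D v"
      unfolding in_closure_def
    proof (intro allI ballI impI)
      fix d f assume f: "f \<in> pf (n + 1) {d}" "\<forall>x\<in>D. f (append_one x) = 0"
      obtain p where p: "p \<in> mpols (n + 1)" "homogeneous p" "f = mpol_eval p" using homogeneous_pfI[OF f(1)] by blast
      define W where "W = {Q \<in> proj_space n. \<forall>q\<in>{p}. \<forall>w\<in>Q. mpol_eval q w = 0}"
      have "proj_algebraic_set n W" unfolding proj_algebraic_set_def W_def using p(1,2)
        by (intro exI[of _ "{p}"]) simp
      moreover have "(\<lambda>x. proj_point (append_one x)) ` D \<subseteq> W"
      proof
        fix Q assume "Q \<in> (\<lambda>x. proj_point (append_one x)) ` D"
        then obtain x where x: "x \<in> D" "Q = proj_point (append_one x)" by blast
        then have c: "x \<in> carrier_vec n" using D by blast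
        show "Q \<in> W" unfolding W_def x(2)
          using point[OF f(1) append_one_carrier[OF c]] f(2) x(1) append_one_carrier[OF c] append_one_nonzero[OF c]
          unfolding p(3) proj_space_def by blast
      qed
      ultimately have "proj_point v \<in> W" using L unfolding proj_closure_def by blast
      then show "f v = 0" unfolding W_def p(3) using self[OF v(1)] by blast
    qed
  next
    assume R: "in_closure n D v"
    show "proj_point v \<in> proj_closure n D"
      unfolding proj_closure_def
    proof (intro InterI, elim CollectE conjE)
      fix W assume "proj_algebraic_set n W" and sub: "(\<lambda>x. proj_point (append_one x)) ` D \<subseteq> W"
      then obtain I where I: "I \<subseteq> {p \<in> mpols (n + 1). homogeneous p}"
        "W = {Q \<in> proj_space n. \<forall>p\<in>I. \<forall>v\<in>Q. mpol_eval p v = 0}" unfolding proj_algebraic_set_def by blast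
      have "\<forall>w\<in>proj_point v. mpol_eval p w = 0" if p: "p \<in> I" for p
      proof -
        obtain d where d: "mpol_eval p \<in> pf (n + 1) {d}" using homogeneous_pfD I(1) p by blast
        have "mpol_eval p (append_one x) = 0" if "x \<in> D" for x
          using sub that I(2) p self[OF append_one_carrier] D by blast
        then have "mpol_eval p v = 0" using in_closureD[OF R d] by blast
        then show ?thesis using point[OF d v(1)] by blast
      qed
      then show "proj_point v \<in> W" unfolding I(2) proj_space_def using v by blast
    qed
  qed
qed

definition linf :: "nat \<Rightarrow> 'a::field vec \<Rightarrow> 'a vec \<Rightarrow> 'a" where
  "linf N a v = (\<Sum>i<N. a $ i * v $ i)"

lemma linf_scalar_prod: "v \<in> carrier_vec N \<Longrightarrow> a \<bullet> v = linf N a v"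
  unfolding linf_def scalar_prod_def by (auto simp: lessThan_atLeast0)

lemma linf_pf: "linf N a \<in> pf N {1}"
  unfolding linf_def by (intro pf_sum pf_smult pf_coord) auto

lemma linf_pf_coeff: "(\<lambda>a. linf N a v) \<in> pf N {1}"
  unfolding linf_def by (subst mult.commute) (intro pf_sum pf_smult pf_coord, auto)

lemma linf_add: "a \<in> carrier_vec N \<Longrightarrow> b \<in> carrier_vec N \<Longrightarrow> linf N (a + c \<cdot>\<^sub>v b) v = linf N a v + c * linf N b v"
  unfolding linf_def by (auto simp: algebra_simps sum.distrib sum_distrib_left intro!: sum.cong)

lemma linf_nonzero:
  assumes "v \<in> carrier_vec N" "v \<noteq> 0\<^sub>v N" shows "\<exists>a\<in>carrier_vec N. linf N a v \<noteq> 0"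
proof -
  obtain i where i: "i < N" "v $ i \<noteq> 0" using assms by (metis carrier_vecD eq_vecI index_zero_vec)
  have "linf N (unit_vec N i) v = v $ i"
  proof -
    have "linf N (unit_vec N i) v = (\<Sum>j<N. if j = i then v $ j else 0)" unfolding linf_def unit_vec_def
      by (intro sum.cong) auto
    then show ?thesis using i by simp
  qed
  then show ?thesis using i by (intro bexI[of _ "unit_vec N i"]) auto
qed

section \<open>Points on hyperplane sections of irreducible sets\<close>

lemma power_fun_eval: "(f ^ k) x = (f x ^ k :: 'a::comm_ring_1)"
  by (induction k) auto

lemma sum_fun_eval: "(\<Sum>i\<in>A. f i) x = (\<Sum>i\<in>A. f i x :: 'a::comm_ring_1)"
  by (induction A rule: infinite_finite_induct) auto

lemma prod_fun_eval: "(\<Prod>i\<in>A. f i) x = (\<Prod>i\<in>A. f i x :: 'a::comm_ring_1)"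
  by (induction A rule: infinite_finite_induct) auto

lemma poly_const_fun_eval: "poly (map_poly (\<lambda>c _. c) P) f x = poly P (f x :: 'a::comm_ring_1)"
  by (induction P) (auto simp: map_poly_pCons zero_fun_def)

lemma of_nat_fun_eval: "(of_nat k :: 'b \<Rightarrow> 'a::comm_ring_1) x = of_nat k"
  by (induction k) auto

text \<open>A specialization that fixes the constants is determined on polynomial functions by its
  values on the coordinates: it is evaluation at the vector of these values. This is how
  specializations become points.\<close>

lemma pf_in_subring:
  fixes f :: "'a::field vec \<Rightarrow> 'a"
  assumes "is_subring R" "\<And>c. (\<lambda>_. c) \<in> R" "\<And>i. i < n \<Longrightarrow> (\<lambda>x :: 'a vec. x $ i) \<in> R" "f \<in> pf n UNIV"
  shows "f \<in> R"
    and "specialization I R \<psi> \<Longrightarrow> (\<And>c. \<psi> (\<lambda>_. c) = c) \<Longrightarrow> \<psi> f = f (vec n (\<lambda>i. \<psi> (\<lambda>x :: 'a vec. x $ i)))"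
proof -
  obtain M c where f: "finite M" "\<forall>m\<in>M. Poly_Mapping.keys m \<subseteq> {..<n} \<and> mono_deg m \<in> UNIV"
           "f = (\<lambda>x. \<Sum>m\<in>M. c m * mono_val m x)" using pf_sumD[OF assms(4)] by blast
  have lt: "i < n" if "m \<in> M" "i \<in> Poly_Mapping.keys m" for m i using f(2) that by auto
  have eq: "f = (\<Sum>m\<in>M. (\<lambda>_. c m) * (\<Prod>i\<in>Poly_Mapping.keys m. (\<lambda>x :: 'a vec. x $ i) ^ Poly_Mapping.lookup m i))"
    unfolding f mono_val_def by (intro ext) (simp add: sum_fun_eval prod_fun_eval power_fun_eval)
  have mem: "(\<Prod>i\<in>Poly_Mapping.keys m. (\<lambda>x :: 'a vec. x $ i) ^ Poly_Mapping.lookup m i) \<in> R" if "m \<in> M" for m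
    using lt[OF that] by (intro is_subring_prod is_subring_power assms)
  show "f \<in> R" unfolding eq
    by (intro is_subring_sum[OF assms(1)] is_subringD(4)[OF assms(1)] assms(2) mem)
  assume \<psi>: "specialization I R \<psi>" "\<And>c. \<psi> (\<lambda>_. c) = c"
  have "\<psi> f = (\<Sum>m\<in>M. \<psi> ((\<lambda>_. c m) * (\<Prod>i\<in>Poly_Mapping.keys m. (\<lambda>x :: 'a vec. x $ i) ^ Poly_Mapping.lookup m i)))"
    unfolding eq using mem
    by (intro specialization_sum[OF assms(1) \<psi>(1)] is_subringD(4)[OF assms(1)] assms(2))
  also have "\<dots> = (\<Sum>m\<in>M. c m * mono_val m (vec n (\<lambda>i. \<psi> (\<lambda>x :: 'a vec. x $ i))))"
  proof (rule sum.cong[OF refl])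
    fix m assume m: "m \<in> M"
    have "\<psi> (\<Prod>i\<in>Poly_Mapping.keys m. (\<lambda>x :: 'a vec. x $ i) ^ Poly_Mapping.lookup m i) =
        (\<Prod>i\<in>Poly_Mapping.keys m. \<psi> ((\<lambda>x :: 'a vec. x $ i) ^ Poly_Mapping.lookup m i))"
      using lt[OF m] by (intro specialization_prod[OF assms(1) \<psi>(1)] is_subring_power assms)
    also have "\<dots> = mono_val m (vec n (\<lambda>i. \<psi> (\<lambda>x :: 'a vec. x $ i)))"
      unfolding mono_val_def using lt[OF m]
      by (intro prod.cong) (auto simp: specialization_power[OF assms(1) \<psi>(1)] assms)
    finally show "\<psi> ((\<lambda>_. c m) * (\<Prod>i\<in>Poly_Mapping.keys m. (\<lambda>x :: 'a vec. x $ i) ^ Poly_Mapping.lookup m i)) =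
       c m * mono_val m (vec n (\<lambda>i. \<psi> (\<lambda>x :: 'a vec. x $ i)))"
      using specializationD(3)[OF \<psi>(1) assms(2) mem[OF m]] \<psi>(2) by simp
  qed
  finally show "\<psi> f = f (vec n (\<lambda>i. \<psi> (\<lambda>x :: 'a vec. x $ i)))" unfolding f .
qed

text \<open>For \<open>N > 0\<close> this includes that \<open>F / h\<close> is transcendental over the constants.\<close>

definition no_relation :: "'a::field vec set \<Rightarrow> ('a vec \<Rightarrow> 'a) \<Rightarrow> ('a vec \<Rightarrow> 'a) \<Rightarrow> ('a vec \<Rightarrow> 'a) \<Rightarrow> nat \<Rightarrow> bool" where
  "no_relation D F G h N \<longleftrightarrow> (\<forall>P :: nat \<Rightarrow> 'a poly.
     (\<forall>x\<in>D. h x \<noteq> 0 \<longrightarrow> (\<Sum>i<N. poly (P i) (F x / h x) * (G x / h x) ^ i) = 0) \<longrightarrow> (\<forall>i<N. P i = 0))"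

text \<open>Specializations of the coordinate ring of \<open>D\<close> with \<open>h\<close>
  inverted are the points of \<open>D\<close> with \<open>h\<close> nonzero. The count of
  specializations with \<open>F / h\<close> sent to \<open>e\<close> thus becomes a count of points,
  kept apart by their values of \<open>G / h\<close>.\<close>

lemma fibre_points:
  fixes D :: "'a::{alg_closed_field, field_char_0} vec set"
  assumes D: "irreducible_set n D"
    and pfs: "F \<in> pf n UNIV" "G \<in> pf n UNIV" "h \<in> pf n UNIV" "b \<in> pf n UNIV"
    and nz: "\<exists>x\<in>D. h x \<noteq> 0" "\<exists>x\<in>D. b x \<noteq> 0"
    and no_rel: "no_relation D F G h N" "N > 0"
  shows "\<exists>B. finite B \<and> (\<forall>e. e \<notin> B \<longrightarrow> (\<exists>A. finite A \<and> card A = N \<and> A \<subseteq> D \<and>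
           (\<forall>x\<in>A. h x \<noteq> 0 \<and> b x \<noteq> 0 \<and> F x = e * h x)))"
proof -
  define Z where "Z = {x \<in> D. h x \<noteq> 0}"
  \<comment> \<open>\<open>S\<close> is the ring of functions that agree on \<open>Z\<close> with a
    polynomial function divided by a power of \<open>h\<close>, and \<open>I\<close> its ideal of
    functions vanishing on \<open>Z\<close>. Values outside \<open>Z\<close> are irrelevant, which
    is why equality is always taken modulo \<open>I\<close>.\<close>
  define S where "S = {z. \<exists>p\<in>pf n UNIV. \<exists>k. \<forall>x\<in>Z. z x * h x ^ k = p x}"
  define I where "I = {z :: 'a vec \<Rightarrow> 'a. \<forall>x\<in>Z. z x = 0}"
  have Zne: "Z \<noteq> {}" "Z \<subseteq> D" using nz(1) unfolding Z_def by auto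
  have pf_I: "\<forall>x\<in>D. f x = 0" if "f \<in> pf n UNIV" "f \<in> I" for f
  proof -
    have "\<forall>x\<in>D. f x * h x = 0" using that(2) unfolding I_def Z_def by auto
    then show ?thesis using irreducible_set_prime[OF D that(1) pfs(3)] nz(1) by blast
  qed
  have S_pf: "f \<in> S" if "f \<in> pf n UNIV" for f
    unfolding S_def using that by (auto intro!: bexI[of _ f] exI[of _ 0])
  have S_div: "(\<lambda>x. f x / h x) \<in> S" if "f \<in> pf n UNIV" for f
    unfolding S_def using that by (auto intro!: bexI[of _ f] exI[of _ 1] simp: Z_def)
  have subS: "is_subring S" unfolding is_subring_def
  proof (intro conjI ballI)
    have "(\<lambda>x. 1) \<in> S" by (intro S_pf pf_intros) auto
    then show "1 \<in> S" by (simp add: one_fun_def)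
    fix z w assume "z \<in> S" "w \<in> S"
    then obtain p k q l where zw: "p \<in> pf n UNIV" "\<And>x. x \<in> Z \<Longrightarrow> z x * h x ^ k = p x"
      "q \<in> pf n UNIV" "\<And>x. x \<in> Z \<Longrightarrow> w x * h x ^ l = q x" unfolding S_def by blast
    have "(z x + w x) * h x ^ (k + l) = p x * h x ^ l + q x * h x ^ k" "(z x * w x) * h x ^ (k + l) = p x * q x"
      if "x \<in> Z" for x
      unfolding zw(2)[OF that, symmetric] zw(4)[OF that, symmetric] by (simp_all add: power_add algebra_simps)
    then have eq: "\<forall>x\<in>Z. (z + w) x * h x ^ (k + l) = p x * h x ^ l + q x * h x ^ k"
      "\<forall>x\<in>Z. (z * w) x * h x ^ (k + l) = p x * q x" "\<forall>x\<in>Z. (- z) x * h x ^ k = - p x"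
      using zw(2) by auto
    have mem: "(\<lambda>x. p x * h x ^ l + q x * h x ^ k) \<in> pf n UNIV" "(\<lambda>x. p x * q x) \<in> pf n UNIV" "(\<lambda>x. - p x) \<in> pf n UNIV"
      by (intro pf_intros zw pfs)+
    show "z + w \<in> S" unfolding S_def
      by (intro CollectI bexI[OF _ mem(1)] exI[of _ "k + l"]) (rule eq(1))
    show "z * w \<in> S" unfolding S_def
      by (intro CollectI bexI[OF _ mem(2)] exI[of _ "k + l"]) (rule eq(2))
    show "- z \<in> S" unfolding S_def
      by (intro CollectI bexI[OF _ mem(3)] exI[of _ "k"]) (rule eq(3))
  qed
  interpret prime_quotient S I
  proof
    show "is_subring S" by (rule subS)
    show "I \<subseteq> S" unfolding I_def S_def by (auto intro!: bexI[of _ "\<lambda>x. 0"] exI[of _ 0] pf_zero)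
    show "0 \<in> I" unfolding I_def by simp
    show "1 \<notin> I" using Zne unfolding I_def by auto
    fix z w assume "z \<in> S" "w \<in> S" and zw0: "z * w \<in> I"
    then obtain p k q l where zw: "p \<in> pf n UNIV" "\<And>x. x \<in> Z \<Longrightarrow> z x * h x ^ k = p x"
      "q \<in> pf n UNIV" "\<And>x. x \<in> Z \<Longrightarrow> w x * h x ^ l = q x" unfolding S_def by blast
    have "(\<lambda>x. p x * q x) \<in> I" unfolding I_def
    proof (intro CollectI ballI)
      fix x assume x: "x \<in> Z"
      then have "z x * w x = 0" using zw0 unfolding I_def by auto
      then show "p x * q x = 0" unfolding zw(2)[OF x, symmetric] zw(4)[OF x, symmetric] by auto
    qed
    then have "\<forall>x\<in>D. p x * q x = 0" by (intro pf_I pf_intros zw)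
    then consider "\<forall>x\<in>D. p x = 0" | "\<forall>x\<in>D. q x = 0" using irreducible_set_prime[OF D zw(1,3)] by blast
    then show "z \<in> I \<or> w \<in> I"
    proof cases
      case 1
      then have "z x = 0" if "x \<in> Z" for x using zw(2)[OF that] that unfolding Z_def by auto
      then show ?thesis unfolding I_def by blast
    next
      case 2
      then have "w x = 0" if "x \<in> Z" for x using zw(4)[OF that] that unfolding Z_def by auto
      then show ?thesis unfolding I_def by blast
    qed
  next
    fix z :: "'a vec \<Rightarrow> 'a" and m assume "of_nat (Suc m) * z \<in> I"
    then show "z \<in> I" unfolding I_def by (auto simp: of_nat_fun_eval simp del: of_nat_Suc)
  qed (auto simp: I_def)
  define \<kappa> where "\<kappa> = (\<lambda>(c :: 'a) (_ :: 'a vec). c)"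
  define f where "f = (\<lambda>x. F x / h x)"
  define g where "g = (\<lambda>x. G x / h x)"
  define hi where "hi = (\<lambda>x. 1 / h x)"
  \<comment> \<open>The coordinates among the generators make a specialization a point; the
    generator \<open>1 / h\<close> forces \<open>h\<close> to be nonzero at that point.\<close>
  define ys where "ys = hi # map (\<lambda>i x :: 'a vec. x $ i) [0..<n]"
  define R where "R = adjs (adj (adj (range \<kappa>) f) g) ys"
  have \<kappa>S: "\<kappa> c \<in> S" for c unfolding \<kappa>_def by (intro S_pf pf_intros) auto
  have sub0: "is_subring (range \<kappa>)" unfolding is_subring_def
  proof (intro conjI ballI)
    have "1 = \<kappa> 1" unfolding \<kappa>_def one_fun_def ..
    then show "1 \<in> range \<kappa>" by blast
    fix x y assume "x \<in> range \<kappa>" "y \<in> range \<kappa>"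
    then obtain c d where cd: "x = \<kappa> c" "y = \<kappa> d" by blast
    have "x + y = \<kappa> (c + d)" "x * y = \<kappa> (c * d)" "- x = \<kappa> (- c)" unfolding cd \<kappa>_def by auto
    then show "x + y \<in> range \<kappa>" "x * y \<in> range \<kappa>" "- x \<in> range \<kappa>" by blast+
  qed
  have fS: "f \<in> S" "g \<in> S" unfolding f_def g_def by (intro S_div pfs)+
  have ysS: "set ys \<subseteq> S" unfolding ys_def hi_def
    using S_div[OF pf_const[of UNIV 1]] by (auto intro!: S_pf pf_coord)
  note sub1 = is_subring_adj[OF sub0, of f] and sub2 = is_subring_adj[OF is_subring_adj[OF sub0, of f], of g]
  have inS: "adj (range \<kappa>) f \<subseteq> S" "adj (adj (range \<kappa>) f) g \<subseteq> S"
    using adj_subset[OF subS _ fS(1), of "range \<kappa>"] adj_subset[OF subS _ fS(2), of "adj (range \<kappa>) f"] \<kappa>S by blast+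
  have R: "is_subring R" "adj (adj (range \<kappa>) f) g \<subseteq> R" "set ys \<subseteq> R"
    unfolding R_def using adjs_subring[OF sub2 inS(2) ysS] by auto
  have \<kappa>R: "\<kappa> c \<in> R" for c
    using R(2) subset_adj[OF sub1, of g] subset_adj[OF sub0, of f] by blast
  have fgR: "f \<in> R" "g \<in> R"
    using R(2) subset_adj[OF sub1, of g] gen_in_adj[OF sub0, of f] gen_in_adj[OF sub1, of g] by blast+
  have coordR: "(\<lambda>x :: 'a vec. x $ i) \<in> R" if "i < n" for i using R(3) that unfolding ys_def by auto
  have hiR: "hi \<in> R" using R(3) unfolding ys_def by auto
  have pfR: "p \<in> R" if "p \<in> pf n UNIV" for p
    by (rule pf_in_subring(1)[OF R(1) _ _ that]) (use \<kappa>R coordR in \<open>auto simp: \<kappa>_def\<close>)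
  have bI: "b \<notin> I" using pf_I[OF pfs(4)] nz(2) by blast
  have "\<exists>B. finite B \<and> (\<forall>e. e \<notin> B \<longrightarrow> (\<exists>T. finite T \<and> card T = N \<and> (\<forall>t\<in>T. \<exists>\<psi>::('a vec \<Rightarrow> 'a) \<Rightarrow> 'a.
           specialization I R \<psi> \<and> \<psi> b \<noteq> 0 \<and> \<psi> f = e \<and> \<psi> g = t \<and> (\<forall>c. \<psi> (\<kappa> c) = c))))"
    unfolding R_def
  proof (rule fibre_specializations[OF \<kappa>S _ _ _ fS ysS _ bI no_rel(2)])
    show "b \<in> adjs (adj (adj (range \<kappa>) f) g) ys" using pfR[OF pfs(4)] unfolding R_def .
    fix P :: "nat \<Rightarrow> 'a poly" assume "(\<Sum>i<N. poly (map_poly \<kappa> (P i)) f * g ^ i) \<in> I"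
    then have "\<forall>x\<in>Z. (\<Sum>i<N. poly (P i) (f x) * g x ^ i) = 0"
      unfolding I_def \<kappa>_def by (simp add: sum_fun_eval power_fun_eval poly_const_fun_eval)
    then show "\<forall>i<N. P i = 0" using no_rel(1) unfolding no_relation_def Z_def f_def g_def by blast
  qed (auto simp: \<kappa>_def)
  then obtain B where B: "finite B" "\<And>e. e \<notin> B \<Longrightarrow> \<exists>T. finite T \<and> card T = N \<and> (\<forall>t\<in>T. \<exists>\<psi>::('a vec \<Rightarrow> 'a) \<Rightarrow> 'a.
           specialization I R \<psi> \<and> \<psi> b \<noteq> 0 \<and> \<psi> f = e \<and> \<psi> g = t \<and> (\<forall>c. \<psi> (\<kappa> c) = c))" by blast
  have "\<exists>A. finite A \<and> card A = N \<and> A \<subseteq> D \<and> (\<forall>x\<in>A. h x \<noteq> 0 \<and> b x \<noteq> 0 \<and> F x = e * h x)" if e: "e \<notin> B" for e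
  proof -
    obtain T where T: "finite T" "card T = N" "\<And>t. t \<in> T \<Longrightarrow> \<exists>\<psi>::('a vec \<Rightarrow> 'a) \<Rightarrow> 'a.
           specialization I R \<psi> \<and> \<psi> b \<noteq> 0 \<and> \<psi> f = e \<and> \<psi> g = t \<and> (\<forall>c. \<psi> (\<kappa> c) = c)"
      using B(2)[OF e] by blast
    have "\<forall>t\<in>T. \<exists>y. y \<in> D \<and> h y \<noteq> 0 \<and> b y \<noteq> 0 \<and> F y = e * h y \<and> G y = t * h y"
    proof
      fix t assume t: "t \<in> T"
      obtain \<psi> :: "('a vec \<Rightarrow> 'a) \<Rightarrow> 'a" where \<psi>: "specialization I R \<psi>" "\<psi> b \<noteq> 0" "\<psi> f = e" "\<psi> g = t" "\<And>c. \<psi> (\<kappa> c) = c"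
        using T(3)[OF t] by blast
      define y where "y = vec n (\<lambda>i. \<psi> (\<lambda>x :: 'a vec. x $ i))"
      have val: "\<psi> p = p y" if "p \<in> pf n UNIV" for p
        unfolding y_def by (rule pf_in_subring(2)[OF R(1) _ _ that \<psi>(1)]) (use \<kappa>R coordR \<psi>(5) in \<open>auto simp: \<kappa>_def\<close>)
      have yD: "y \<in> D"
      proof (rule algebraic_set_mem[OF irreducible_setD(1)[OF D]])
        show "y \<in> carrier_vec n" unfolding y_def by simp
        fix p assume p: "p \<in> pf n UNIV" "\<forall>x\<in>D. p x = 0"
        then have "p \<in> I" unfolding I_def Z_def by blast
        then show "p y = 0" using specializationD(4)[OF \<psi>(1) pfR[OF p(1)]] val[OF p(1)] by simp
      qed
      \<comment> \<open>Identities such as \<open>f * h = F\<close> hold only on \<open>Z\<close>,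
        but their defect lies in \<open>I\<close> and is killed.\<close>
      have eqI: "\<psi> z = \<psi> w" if "z \<in> R" "w \<in> R" "\<And>x. x \<in> Z \<Longrightarrow> z x = w x" for z w
      proof -
        have "z + - w \<in> I" using that(3) unfolding I_def by simp
        then have "\<psi> (z + - w) = 0"
          using that R(1) by (intro specializationD(4)[OF \<psi>(1)]) (auto intro: is_subringD)
        then show ?thesis
          using specializationD(2)[OF \<psi>(1) that(1) is_subringD(5)[OF R(1) that(2)]]
            specialization_minus[OF R(1) \<psi>(1) that(2)] by simp
      qed
      have mult: "\<psi> (z * p) = \<psi> z * p y" if "z \<in> R" "p \<in> pf n UNIV" for z p
        using specializationD(3)[OF \<psi>(1) that(1) pfR[OF that(2)]] val[OF that(2)] by simp
      have "\<psi> (hi * h) = \<psi> 1"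
        by (rule eqI) (auto simp: hi_def Z_def intro: is_subringD[OF R(1)] hiR[unfolded hi_def] pfR pfs)
      then have 1: "h y \<noteq> 0" using mult[OF hiR pfs(3)] specializationD(1)[OF \<psi>(1)] by auto
      have "\<psi> (f * h) = \<psi> F"
        by (rule eqI) (auto simp: f_def Z_def intro: is_subringD[OF R(1)] fgR[unfolded f_def] pfR pfs)
      then have 2: "F y = e * h y" using mult[OF fgR(1) pfs(3)] val[OF pfs(1)] \<psi>(3) by simp
      have "\<psi> (g * h) = \<psi> G"
        by (rule eqI) (auto simp: g_def Z_def intro: is_subringD[OF R(1)] fgR[unfolded g_def] pfR pfs)
      then have 3: "G y = t * h y" using mult[OF fgR(2) pfs(3)] val[OF pfs(2)] \<psi>(4) by simp
      show "\<exists>y. y \<in> D \<and> h y \<noteq> 0 \<and> b y \<noteq> 0 \<and> F y = e * h y \<and> G y = t * h y"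
        using yD 1 2 3 \<psi>(2) val[OF pfs(4)] by auto
    qed
    from bchoice[OF this] obtain Y where
      Y: "\<forall>t\<in>T. Y t \<in> D \<and> h (Y t) \<noteq> 0 \<and> b (Y t) \<noteq> 0 \<and> F (Y t) = e * h (Y t) \<and> G (Y t) = t * h (Y t)" by blast
    have "inj_on Y T"
    proof
      fix s t assume st: "s \<in> T" "t \<in> T" "Y s = Y t"
      then have "s * h (Y s) = t * h (Y s)" using Y st by metis
      then show "s = t" using Y st(1) by simp
    qed
    then show ?thesis using T(1,2) Y by (intro exI[of _ "Y ` T"]) (auto simp: card_image)
  qed
  then show ?thesis using B(1) by blast
qed

section \<open>Affine forms, and lower bounds for the degree of one quotient of forms over
  another\<close>

definition lina :: "nat \<Rightarrow> 'a::field vec \<Rightarrow> 'a vec \<Rightarrow> 'a" where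
  "lina n a x = (\<Sum>i<n. a $ i * x $ i) + a $ n"

lemma lina_append_one: "x \<in> carrier_vec n \<Longrightarrow> linf (n + 1) a (append_one x) = lina n a x"
  unfolding linf_def lina_def by (auto simp: append_one_index intro!: sum.cong)

lemma lina_pf: "lina n a \<in> pf n UNIV"
  unfolding lina_def by (intro pf_intros pf_smult) auto

lemma lina_add:
  "a \<in> carrier_vec (n + 1) \<Longrightarrow> b \<in> carrier_vec (n + 1) \<Longrightarrow> lina n (a + c \<cdot>\<^sub>v b) x = lina n a x + c * lina n b x"
  unfolding lina_def by (auto simp: algebra_simps sum.distrib sum_distrib_left intro!: sum.cong)

lemma lina_unit_last: "lina n (unit_vec (n + 1) n) x = 1"
  unfolding lina_def by (auto simp: unit_vec_def)

lemma lina_unit: "i < n \<Longrightarrow> lina n (unit_vec (n + 1) i) x = x $ i"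
proof -
  assume i: "i < n"
  have "(\<Sum>j<n. unit_vec (n + 1) i $ j * x $ j) = (\<Sum>j<n. if j = i then x $ j else 0)"
    unfolding unit_vec_def by (intro sum.cong) auto
  then show ?thesis using i unfolding lina_def by (simp add: unit_vec_def)
qed

lemma linf_unit_last: "linf (n + 1) (unit_vec (n + 1) n) v = v $ n"
  unfolding linf_def by (auto simp: unit_vec_def intro!: sum.neutral)

lemmas unit_form_simps = lina_unit_last lina_unit linf_unit_last
  lina_unit_last[simplified] lina_unit[simplified] linf_unit_last[simplified]

text \<open>An algebraic relation over the constants leaves \<open>F / h\<close> finitely many
  values; by irreducibility it would then be constant, contrary to its values at \<open>x\<close>
  and \<open>y\<close>.\<close>

lemma no_relation_nonconstant:
  fixes D :: "'a::field vec set"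
  assumes D: "irreducible_set n D" and pfs: "F \<in> pf n UNIV" "h \<in> pf n UNIV"
    and xy: "x \<in> D" "y \<in> D" "h x \<noteq> 0" "h y \<noteq> 0" "F x / h x \<noteq> F y / h y"
  shows "no_relation D F G h 1"
  unfolding no_relation_def
proof (intro allI impI)
  fix P :: "nat \<Rightarrow> 'a poly" and i :: nat
  assume rel: "\<forall>x\<in>D. h x \<noteq> 0 \<longrightarrow> (\<Sum>i<1. poly (P i) (F x / h x) * (G x / h x) ^ i) = 0" and i: "i < 1"
  show "P i = 0"
  proof (rule ccontr)
    assume "P i \<noteq> 0"
    then have p: "P 0 \<noteq> 0" using i by simp
    define J where "J = {r. poly (P 0) r = 0}"
    have fin: "finite J" unfolding J_def using p by (rule poly_roots_finite)
    have "\<forall>z\<in>D. (\<Prod>r\<in>J. F z - r * h z) * h z = 0"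
    proof
      fix z assume z: "z \<in> D"
      show "(\<Prod>r\<in>J. F z - r * h z) * h z = 0"
      proof (cases "h z = 0")
        case False
        then have "F z / h z \<in> J" using rel z unfolding J_def by auto
        then have "(\<Prod>r\<in>J. F z - r * h z) = 0" using False fin by (intro prod_zero) (auto intro!: bexI[of _ "F z / h z"])
        then show ?thesis by simp
      qed simp
    qed
    moreover have pf1: "(\<lambda>z. F z - r * h z) \<in> pf n UNIV" for r by (intro pf_diff pf_smult pfs)
    ultimately have "\<forall>z\<in>D. (\<Prod>r\<in>J. F z - r * h z) = 0"
      using irreducible_set_prime[OF D pf_prod[where J = J and f = "\<lambda>r z. F z - r * h z", OF pf1] pfs(2)] xy(1,3) by blast
    then obtain r where r: "\<forall>z\<in>D. F z - r * h z = 0"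
      using irreducible_set_prime_prod[OF D fin, where f = "\<lambda>r z. F z - r * h z", OF pf1] by blast
    then have "F x = r * h x" "F y = r * h y" using xy by auto
    then show False using xy by simp
  qed
qed

text \<open>Let f = h0 / h1 and g = h2 / h1. At every point of \<open>Q\<close> the function f
  vanishes, and g takes different values there. A relation for g over the polynomials in f, not
  divisible by f, becomes at f = 0 a nonzero polynomial with all these values as roots, so it cannot
  have fewer than \<open>card Q\<close> terms.\<close>

lemma no_relation_at_points:
  fixes D :: "'a::field vec set"
  assumes D: "irreducible_set n D" and h0: "\<exists>x\<in>D. lina n h0 x \<noteq> 0"
    and Q: "finite Q" "\<And>q. q \<in> Q \<Longrightarrow> in_closure n D q \<and> linf (n + 1) h0 q = 0 \<and> linf (n + 1) h1 q \<noteq> 0"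
      "inj_on (\<lambda>q. linf (n + 1) h2 q / linf (n + 1) h1 q) Q"
  shows "no_relation D (lina n h0) (lina n h2) (lina n h1) (card Q)"
  unfolding no_relation_def
proof (intro allI impI)
  fix P :: "nat \<Rightarrow> 'a poly" and i0 :: nat
  define N where "N = card Q"
  assume rel: "\<forall>x\<in>D. lina n h1 x \<noteq> 0 \<longrightarrow>
      (\<Sum>i<card Q. poly (P i) (lina n h0 x / lina n h1 x) * (lina n h2 x / lina n h1 x) ^ i) = 0" and i0: "i0 < card Q"
  have Dc: "x \<in> carrier_vec n" if "x \<in> D" for x
    using that algebraic_set_carrier[OF irreducible_setD(1)[OF D]] by blast
  show "P i0 = 0"
  proof (rule ccontr)
    assume Pi0: "P i0 \<noteq> 0"
    define J where "J = {i. i < N \<and> P i \<noteq> 0}"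
    \<comment> \<open>\<open>k\<close> is the largest power of f = h0 / h1 dividing all
      coefficients. It can be cancelled since h0 does not vanish identically on \<open>D\<close>,
      and then some constant coefficient is nonzero.\<close>
    define k where "k = Min ((\<lambda>i. order 0 (P i)) ` J)"
    have J: "finite J" "i0 \<in> J" unfolding J_def N_def using i0 Pi0 by auto
    have "k \<in> (\<lambda>i. order 0 (P i)) ` J" unfolding k_def using J by (intro Min_in) auto
    then obtain i1 where i1: "i1 \<in> J" "order 0 (P i1) = k" by auto
    have "\<exists>p'. P i = [:0, 1:] ^ k * p'" if "i < N" for i
    proof (cases "P i = 0")
      case False
      then have "k \<le> order 0 (P i)" unfolding k_def using J that by (intro Min_le) (auto simp: J_def)
      then have "[:- 0, 1:] ^ k dvd P i" by (meson dvd_trans le_imp_power_dvd order_1)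
      then show ?thesis by (auto elim: dvdE)
    qed (auto intro: exI[of _ 0])
    then obtain P' where P': "\<And>i. i < N \<Longrightarrow> P i = [:0, 1:] ^ k * P' i" by metis
    have P'i1: "coeff (P' i1) 0 \<noteq> 0"
    proof
      assume "coeff (P' i1) 0 = 0"
      then have "poly (P' i1) 0 = 0" by (simp add: poly_0_coeff_0)
      then have "[:- 0, 1:] dvd P' i1" by (simp only: poly_eq_0_iff_dvd)
      then obtain r where r: "P' i1 = [:- 0, 1:] * r" by (elim dvdE)
      have "P i1 = [:- 0, 1:] ^ Suc k * r"
        using P'[of i1] i1(1) unfolding J_def r by (simp only: power_Suc mult_ac minus_zero mem_Collect_eq)
      then have "[:- 0, 1:] ^ Suc k dvd P i1" by (rule dvdI)
      moreover have "P i1 \<noteq> 0" using i1(1) J_def by simp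
      ultimately have "Suc k \<le> order 0 (P i1)" by (subst (asm) order_divides) auto
      then show False using i1(2) by simp
    qed
    define M where "M = Max ((\<lambda>i. degree (P' i)) ` {..<N})"
    have M: "degree (P' i) \<le> M" if "i < N" for i unfolding M_def using that by (intro Max_ge) auto
    \<comment> \<open>Points at infinity can only be reached by forms, so the relation is
      homogenized with powers of h1. The degree \<open>M + N\<close> leaves a nonnegative exponent
      for all \<open>i < N\<close> and \<open>j \<le> M\<close>.\<close>
    define H where "H v = (\<Sum>i<N. \<Sum>j\<le>M. coeff (P' i) j * (linf (n + 1) h0 v ^ j * linf (n + 1) h2 v ^ i * linf (n + 1) h1 v ^ (M + N - i - j)))" for v
    have H: "H \<in> pf (n + 1) {M + N}"
    proof -
      have "(\<lambda>v. linf (n + 1) h0 v ^ j * linf (n + 1) h2 v ^ i * linf (n + 1) h1 v ^ (M + N - i - j)) \<in> pf (n + 1) {M + N}"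
        if "i < N" "j \<le> M" for i j
        by (rule pf_mult[of _ _ "{j + i}" _ "{M + N - i - j}"], rule pf_mult[of _ _ "{j}" _ "{i}"])
           (use that pf_power[OF linf_pf] in \<open>auto\<close>)
      then show ?thesis unfolding H_def by (intro pf_sum pf_smult) auto
    qed
    have H_val: "H v = linf (n + 1) h1 v ^ (M + N) * (\<Sum>i<N. poly (P' i) (linf (n + 1) h0 v / linf (n + 1) h1 v) * (linf (n + 1) h2 v / linf (n + 1) h1 v) ^ i)"
      if "linf (n + 1) h1 v \<noteq> 0" for v
    proof -
      have "poly (P' i) z = (\<Sum>j\<le>M. coeff (P' i) j * z ^ j)" if "i < N" for i z
        unfolding poly_altdef using M[OF that] by (intro sum.mono_neutral_left) (auto simp: coeff_eq_0)
      note poly_M = this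
      have "linf (n + 1) h0 v ^ j * linf (n + 1) h2 v ^ i * linf (n + 1) h1 v ^ (M + N - i - j) =
          linf (n + 1) h1 v ^ (M + N) * ((linf (n + 1) h0 v / linf (n + 1) h1 v) ^ j * (linf (n + 1) h2 v / linf (n + 1) h1 v) ^ i)"
        if "i < N" "j \<le> M" for i j
      proof -
        have "linf (n + 1) h1 v ^ (M + N) = linf (n + 1) h1 v ^ (M + N - i - j) * linf (n + 1) h1 v ^ j * linf (n + 1) h1 v ^ i"
          using that by (simp flip: power_add)
        then show ?thesis using \<open>linf (n + 1) h1 v \<noteq> 0\<close> by (simp add: power_divide)
      qed
      then have "H v = (\<Sum>i<N. \<Sum>j\<le>M. coeff (P' i) j * (linf (n + 1) h1 v ^ (M + N) *
          ((linf (n + 1) h0 v / linf (n + 1) h1 v) ^ j * (linf (n + 1) h2 v / linf (n + 1) h1 v) ^ i)))"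
        unfolding H_def by (intro sum.cong) auto
      also have "\<dots> = (\<Sum>i<N. linf (n + 1) h1 v ^ (M + N) *
          (poly (P' i) (linf (n + 1) h0 v / linf (n + 1) h1 v) * (linf (n + 1) h2 v / linf (n + 1) h1 v) ^ i))"
        by (intro sum.cong refl) (simp add: poly_M sum_distrib_left sum_distrib_right mult_ac)
      finally show ?thesis unfolding sum_distrib_left .
    qed
    obtain H' where H': "H' \<in> pf n UNIV" "\<And>x. x \<in> carrier_vec n \<Longrightarrow> H' x = H (append_one x)"
      using pf_append_one[of H n] pf_subset[OF _ H] by blast
    have h1: "\<exists>x\<in>D. lina n h1 x \<noteq> 0"
    proof (rule ccontr)
      assume "\<not> ?thesis"
      then have "linf (n + 1) h1 (append_one x) = 0" if "x \<in> D" for x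
        using lina_append_one[OF Dc[OF that]] that by auto
      moreover obtain q where "q \<in> Q" using i0 by fastforce
      ultimately show False using in_closureD[OF _ linf_pf] Q(2) by blast
    qed
    have "\<forall>x\<in>D. (lina n h0 x ^ k * lina n h1 x) * H' x = 0"
    proof
      fix x assume x: "x \<in> D"
      let ?h = "lina n h1 x"
      let ?f = "lina n h0 x / ?h"
      let ?g = "lina n h2 x / ?h"
      show "(lina n h0 x ^ k * ?h) * H' x = 0"
      proof (cases "?h = 0")
        case False
        have "(\<Sum>i<N. poly (P i) ?f * ?g ^ i) = ?f ^ k * (\<Sum>i<N. poly (P' i) ?f * ?g ^ i)"
          unfolding sum_distrib_left by (intro sum.cong) (auto simp: P')
        then have "?f ^ k * (\<Sum>i<N. poly (P' i) ?f * ?g ^ i) = 0" using rel x False unfolding N_def by simp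
        then have "?f ^ k = 0 \<or> H' x = 0"
          using H'(2)[OF Dc[OF x]] H_val[of "append_one x"] lina_append_one[OF Dc[OF x]] False by auto
        then show ?thesis using False by (auto simp: power_divide)
      qed simp
    qed
    then have "(\<forall>x\<in>D. lina n h0 x ^ k * lina n h1 x = 0) \<or> (\<forall>x\<in>D. H' x = 0)"
      by (intro irreducible_set_prime[OF D] H' pf_intros lina_pf)
    moreover have "\<not> (\<forall>x\<in>D. lina n h0 x ^ k * lina n h1 x = 0)"
    proof
      assume *: "\<forall>x\<in>D. lina n h0 x ^ k * lina n h1 x = 0"
      then have "\<forall>x\<in>D. (\<Prod>i\<in>{..<k}. lina n h0 x) * lina n h1 x = 0" by simp
      then have "\<forall>x\<in>D. (\<Prod>i\<in>{..<k}. lina n h0 x) = 0"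
        using irreducible_set_prime[OF D pf_prod[where J = "{..<k}" and f = "\<lambda>_. lina n h0", OF lina_pf] lina_pf] h1 by blast
      then have "\<exists>i\<in>{..<k}. \<forall>x\<in>D. lina n h0 x = 0" by (intro irreducible_set_prime_prod[OF D]) (auto intro: lina_pf)
      then show False using h0 by blast
    qed
    ultimately have "\<forall>x\<in>D. H' x = 0" by blast
    then have Hq: "H q = 0" if "q \<in> Q" for q
      using in_closureD[OF _ H, of D q] Q(2)[OF that] H'(2) Dc by force
    \<comment> \<open>The relation at a point of \<open>Q\<close>, where h0 vanishes, with h2 / h1
      as its unknown.\<close>
    define p where "p = (\<Sum>i<N. monom (coeff (P' i) 0) i)"
    have p_coeff: "coeff p i = (if i < N then coeff (P' i) 0 else 0)" for i
      unfolding p_def coeff_sum coeff_monom by (simp add: sum.delta)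
    have "coeff p i1 \<noteq> 0" using P'i1 i1(1) p_coeff unfolding J_def by simp
    then have p0: "p \<noteq> 0" by auto
    have "degree p < N" using i0 p_coeff unfolding N_def by (intro degree_lessI) (use p0 in auto)
    have "poly p (linf (n + 1) h2 q / linf (n + 1) h1 q) = 0" if "q \<in> Q" for q
    proof -
      have "(\<Sum>i<N. poly (P' i) 0 * (linf (n + 1) h2 q / linf (n + 1) h1 q) ^ i) = 0"
        using H_val[of q] Hq[OF that] Q(2)[OF that] by auto
      then show ?thesis unfolding p_def by (simp add: poly_sum poly_monom poly_0_coeff_0)
    qed
    then have "(\<lambda>q. linf (n + 1) h2 q / linf (n + 1) h1 q) ` Q \<subseteq> {x. poly p x = 0}" by blast
    then have "N \<le> card {x. poly p x = 0}"
      unfolding N_def using card_mono[OF poly_roots_finite[OF p0]] card_image[OF Q(3)] by metis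
    also have "\<dots> \<le> degree p" using p0 by (rule card_poly_roots_bound)
    finally show False using \<open>degree p < N\<close> by simp
  qed
qed

text \<open>If \<open>D\<close> were finite, the product over its points of functions vanishing at
  one point each, but not on all of \<open>D\<close>, would vanish on \<open>D\<close>; primality
  forbids this.\<close>

lemma irreducible_infinite:
  fixes D :: "'a::field vec set"
  assumes D: "irreducible_set n D" and xy: "x \<in> D" "y \<in> D" "x \<noteq> y"
  shows "infinite D"
proof
  assume fin: "finite D"
  have Dc: "z \<in> carrier_vec n" if "z \<in> D" for z
    using that algebraic_set_carrier[OF irreducible_setD(1)[OF D]] by blast
  have "\<forall>z\<in>D. \<exists>f. f \<in> pf n UNIV \<and> f z = 0 \<and> (\<exists>w\<in>D. f w \<noteq> 0)"
  proof
    fix z assume z: "z \<in> D"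
    obtain w where w: "w \<in> D" "w \<notin> {z}" using xy by blast
    show "\<exists>f. f \<in> pf n UNIV \<and> f z = 0 \<and> (\<exists>w\<in>D. f w \<noteq> 0)"
    proof (rule ccontr)
      assume no: "\<not> ?thesis"
      have "w \<in> {z}"
        by (rule algebraic_set_mem[OF irreducible_setD(1)[OF irreducible_singleton[OF Dc[OF z]]] Dc[OF w(1)]])
          (use no w in auto)
      then show False using w by blast
    qed
  qed
  from bchoice[OF this] obtain f where f: "\<forall>z\<in>D. f z \<in> pf n UNIV \<and> f z z = 0 \<and> (\<exists>w\<in>D. f z w \<noteq> 0)"
    by blast
  have "\<forall>w\<in>D. (\<Prod>z\<in>D. f z w) = 0"
  proof
    fix w assume "w \<in> D"
    then show "(\<Prod>z\<in>D. f z w) = 0" using f by (intro prod_zero[OF fin] bexI[of _ w]) auto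
  qed
  moreover have "f z \<in> pf n UNIV" if "z \<in> D" for z using f that by blast
  ultimately have "\<exists>z\<in>D. \<forall>w\<in>D. f z w = 0" by (intro irreducible_set_prime_prod[OF D fin])
  then show False using f by blast
qed

section \<open>Closed sets whose generic hyperplane sections have \<open>d\<close> points\<close>

locale curve_sections =
  fixes n d :: nat and U :: "'a::{alg_closed_field, field_char_0} vec set" and G :: "'a vec \<Rightarrow> 'a"
  assumes U: "algebraic_set n U"
    and G_pf: "G \<in> pf (n + 1) UNIV"
    and G_nonzero: "\<exists>a\<in>carrier_vec (n + 1). G a \<noteq> 0"
    and section_card: "\<And>a. a \<in> carrier_vec (n + 1) \<Longrightarrow> G a \<noteq> 0 \<Longrightarrow>
       finite {x \<in> U. lina n a x = 0} \<and> card {x \<in> U. lina n a x = 0} = d"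
begin

text \<open>Maximality is not part of the definition: \<open>branch_eqI\<close> shows that no branch
  is properly contained in another. They play the part of the one-dimensional components.\<close>

definition branches :: "'a vec set set" where
  "branches = {D. irreducible_set n D \<and> D \<subseteq> U \<and> infinite D}"

lemma dom_carrier: "irreducible_set n D \<Longrightarrow> x \<in> D \<Longrightarrow> x \<in> carrier_vec n"
  using algebraic_set_carrier irreducible_setD(1) by blast

lemma finite_shift:
  assumes "a \<in> carrier_vec (n + 1)" "b \<in> carrier_vec (n + 1)" "G a \<noteq> 0"
  shows "finite {s. G (a + s \<cdot>\<^sub>v b) = 0}"
  using pf_line_finite[OF G_pf assms(1,2,3)] .

text \<open>This is the statement that \<open>D\<close> has dimension at most one, extracted from
  the finiteness of generic sections. A generic form and \<open>b\<close> must be algebraically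
  related on \<open>D\<close>, since otherwise some section would have \<open>d + 1\<close> points.
  Such a relation, freed of factors \<open>b\<close>, leaves the form finitely many values where
  \<open>b\<close> vanishes.\<close>

lemma proper_closed_finite:
  assumes D: "irreducible_set n D" "D \<subseteq> U" and b: "b \<in> pf n UNIV" "\<exists>x\<in>D. b x \<noteq> 0"
  shows "finite {x \<in> D. b x = 0}"
proof -
  have lin_image: "finite (lina n a ` {x \<in> D. b x = 0})" if a: "a \<in> carrier_vec (n + 1)" "G a \<noteq> 0" for a
  proof -
    have "\<not> no_relation D (lina n a) b (\<lambda>x. 1) (d + 1)"
    proof
      assume "no_relation D (lina n a) b (\<lambda>x. 1) (d + 1)"
      then have "\<exists>B. finite B \<and> (\<forall>e. e \<notin> B \<longrightarrow> (\<exists>A. finite A \<and> card A = d + 1 \<and> A \<subseteq> D \<and>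
           (\<forall>x\<in>A. (1 :: 'a) \<noteq> 0 \<and> b x \<noteq> 0 \<and> lina n a x = e * 1)))"
        using irreducible_setD(2)[OF D(1)] by (intro fibre_points[OF D(1) lina_pf b(1) _ b(1)] b(2) pf_const) auto
      then obtain B where B: "finite B" "\<And>e. e \<notin> B \<Longrightarrow> \<exists>A. finite A \<and> card A = d + 1 \<and> A \<subseteq> D \<and>
           (\<forall>x\<in>A. b x \<noteq> 0 \<and> lina n a x = e)" by auto
      have "finite (B \<union> uminus ` {s. G (a + s \<cdot>\<^sub>v unit_vec (n + 1) n) = 0})"
        using B(1) finite_shift[OF a(1) _ a(2)] by simp
      then obtain e where e: "e \<notin> B \<union> uminus ` {s. G (a + s \<cdot>\<^sub>v unit_vec (n + 1) n) = 0}"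
        using ex_new_if_finite[OF infinite_UNIV_char_0] by blast
      then have "e \<notin> B" by blast
      from B(2)[OF this] obtain A where A: "finite A" "card A = d + 1" "A \<subseteq> D" "\<forall>x\<in>A. lina n a x = e" by blast
      \<comment> \<open>A level set of the form \<open>a\<close> is the zero set of a shifted form,
        which is generic for all but finitely many levels \<open>e\<close>.\<close>
      define a' where "a' = a + (- e) \<cdot>\<^sub>v unit_vec (n + 1) n"
      have a': "a' \<in> carrier_vec (n + 1)" "G a' \<noteq> 0"
        unfolding a'_def using a e by (auto simp: image_iff)
      have "A \<subseteq> {x \<in> U. lina n a' x = 0}"
        using A(3,4) D(2) unfolding a'_def lina_add[OF a(1) unit_vec_carrier] lina_unit_last by auto
      then have "card A \<le> card {x \<in> U. lina n a' x = 0}" by (rule card_mono[OF conjunct1[OF section_card[OF a']]])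
      then show False using section_card[OF a'] A(2) by simp
    qed
    then obtain P i where P: "\<forall>x\<in>D. (\<Sum>i<d + 1. poly (P i) (lina n a x) * b x ^ i) = 0" "i < d + 1" "P i \<noteq> 0"
      unfolding no_relation_def by auto
    \<comment> \<open>The lowest nonzero coefficient of the relation: after division by
      \<open>b ^ i0\<close> it is all that remains where \<open>b\<close> vanishes.\<close>
    define i0 where "i0 = (LEAST i. P i \<noteq> 0)"
    have i0: "P i0 \<noteq> 0" "\<And>j. j < i0 \<Longrightarrow> P j = 0" "i0 < d + 1"
    proof -
      show "P i0 \<noteq> 0" unfolding i0_def by (rule LeastI[of "\<lambda>i. P i \<noteq> 0", OF P(3)])
      show "P j = 0" if "j < i0" for j using not_less_Least that unfolding i0_def by blast
      have "i0 \<le> i" unfolding i0_def by (rule Least_le[of "\<lambda>i. P i \<noteq> 0", OF P(3)])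
      then show "i0 < d + 1" using P(2) by simp
    qed
    define R where "R x = (\<Sum>i<d + 1 - i0. poly (P (i0 + i)) (lina n a x) * b x ^ i)" for x
    have "b x ^ i0 * R x = 0" if "x \<in> D" for x
    proof -
      have "(\<Sum>i<d + 1. poly (P i) (lina n a x) * b x ^ i) =
        (\<Sum>i<i0. poly (P i) (lina n a x) * b x ^ i) + (\<Sum>i=i0..<d + 1. poly (P i) (lina n a x) * b x ^ i)"
        unfolding lessThan_atLeast0 using i0(3) by (intro sum.atLeastLessThan_concat[symmetric]) auto
      also have "(\<Sum>i<i0. poly (P i) (lina n a x) * b x ^ i) = 0" using i0(2) by (intro sum.neutral) auto
      also have "(\<Sum>i=i0..<d + 1. poly (P i) (lina n a x) * b x ^ i) =
        (\<Sum>i<d + 1 - i0. poly (P (i0 + i)) (lina n a x) * b x ^ (i0 + i))"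
        using sum.shift_bounds_nat_ivl[of "\<lambda>i. poly (P i) (lina n a x) * b x ^ i" 0 i0 "d + 1 - i0"] i0(3)
        by (simp add: lessThan_atLeast0 add.commute)
      also have "\<dots> = b x ^ i0 * R x" unfolding R_def sum_distrib_left by (intro sum.cong) (auto simp: power_add)
      finally show ?thesis using P(1) that by simp
    qed
    moreover have R: "R \<in> pf n UNIV" unfolding R_def by (intro pf_intros lina_pf b(1))
    ultimately have "(\<forall>x\<in>D. b x ^ i0 = 0) \<or> (\<forall>x\<in>D. R x = 0)"
      by (intro irreducible_set_prime[OF D(1)] pf_intros b(1)) auto
    then have R0: "\<forall>x\<in>D. R x = 0" using b(2) by auto
    have "poly (P i0) (lina n a x) = 0" if "x \<in> D" "b x = 0" for x
    proof -
      have "R x = (\<Sum>i<d + 1 - i0. if i = 0 then poly (P i0) (lina n a x) else 0)"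
        unfolding R_def using that(2) by (intro sum.cong) auto
      then show ?thesis using R0 that(1) i0(3) by simp
    qed
    then have "lina n a ` {x \<in> D. b x = 0} \<subseteq> {t. poly (P i0) t = 0}" by auto
    then show ?thesis using poly_roots_finite[OF i0(1)] finite_subset by blast
  qed
  obtain a where a: "a \<in> carrier_vec (n + 1)" "G a \<noteq> 0" using G_nonzero by blast
  \<comment> \<open>A coordinate is a multiple of the difference of two generic forms, so it also
    takes finitely many values.\<close>
  have coord: "finite ((\<lambda>x. x $ i) ` {x \<in> D. b x = 0})" if i: "i < n" for i
  proof -
    have u: "unit_vec (n + 1) i \<in> carrier_vec (n + 1)" by simp
    have "finite ({s. G (a + s \<cdot>\<^sub>v unit_vec (n + 1) i) = 0} \<union> {0})" using finite_shift[OF a(1) u a(2)] by simp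
    then obtain s where s: "s \<notin> {s. G (a + s \<cdot>\<^sub>v unit_vec (n + 1) i) = 0} \<union> {0}"
      using ex_new_if_finite[OF infinite_UNIV_char_0] by blast
    let ?a = "a + s \<cdot>\<^sub>v unit_vec (n + 1) i"
    have "finite (lina n ?a ` {x \<in> D. b x = 0})" using s a by (intro lin_image) auto
    then have "finite ((\<lambda>(p, q). (p - q) / s) ` (lina n ?a ` {x \<in> D. b x = 0} \<times> lina n a ` {x \<in> D. b x = 0}))"
      using lin_image[OF a] by blast
    moreover have "x $ i = (lina n ?a x - lina n a x) / s" for x
      unfolding lina_add[OF a(1) u] lina_unit[OF i] using s by simp
    then have "(\<lambda>x. x $ i) ` {x \<in> D. b x = 0} \<subseteq>
        (\<lambda>(p, q). (p - q) / s) ` (lina n ?a ` {x \<in> D. b x = 0} \<times> lina n a ` {x \<in> D. b x = 0})"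
      by (force simp: image_iff)
    ultimately show ?thesis using finite_subset by blast
  qed
  define C where "C = PiE {..<n} (\<lambda>i. (\<lambda>x. x $ i) ` {x \<in> D. b x = 0})"
  have "finite C" unfolding C_def using coord by (intro finite_PiE) auto
  moreover have "{x \<in> D. b x = 0} \<subseteq> (\<lambda>f. vec n f) ` C"
  proof
    fix x assume x: "x \<in> {x \<in> D. b x = 0}"
    have "x = vec n (restrict (\<lambda>i. x $ i) {..<n})" using dom_carrier[OF D(1)] x by (intro eq_vecI) auto
    moreover have "restrict (\<lambda>i. x $ i) {..<n} \<in> C" unfolding C_def using x by auto
    ultimately show "x \<in> (\<lambda>f. vec n f) ` C" by blast
  qed
  ultimately show ?thesis using finite_subset by blast
qed

lemma branch_eqI:
  assumes "D \<in> branches" "D' \<in> branches" "D \<subseteq> D'" shows "D = D'"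
proof (rule ccontr)
  assume "D \<noteq> D'"
  then obtain x where x: "x \<in> D'" "x \<notin> D" using assms(3) by blast
  have irr: "irreducible_set n D" "irreducible_set n D'" "D' \<subseteq> U" "infinite D"
    using assms unfolding branches_def by auto
  obtain f where f: "f \<in> pf n UNIV" "\<forall>y\<in>D. f y = 0" "f x \<noteq> 0"
    using algebraic_set_mem[OF irreducible_setD(1)[OF irr(1)] dom_carrier[OF irr(2) x(1)]] x(2) by blast
  have "finite {y \<in> D'. f y = 0}" using f x by (intro proper_closed_finite irr) auto
  moreover have "D \<subseteq> {y \<in> D'. f y = 0}" using f assms(3) by blast
  ultimately show False using irr(4) finite_subset by blast
qed

lemma branch_dense:
  assumes "D \<in> branches" "S \<subseteq> D" "infinite S" "f \<in> pf n UNIV" "\<forall>x\<in>S. f x = 0"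
  shows "\<forall>x\<in>D. f x = 0"
proof (rule ccontr)
  assume "\<not> ?thesis"
  then have "finite {x \<in> D. f x = 0}"
    using assms unfolding branches_def by (intro proper_closed_finite) auto
  moreover have "S \<subseteq> {x \<in> D. f x = 0}" using assms by blast
  ultimately show False using assms(3) finite_subset by blast
qed

lemma zariski_dim_singleton: "zariski_dim n {x} \<noteq> 1"
proof
  assume "zariski_dim n {x} = 1"
  moreover have "zariski_dim n {x} \<le> 0"
    unfolding zariski_dim_def
  proof (rule Sup_least, elim CollectE exE conjE)
    fix y m Z assume m: "y = enat m" "\<forall>i\<le>m. irreducible_set n (Z i) \<and> Z i \<subseteq> {x}" "\<forall>i<m. Z i \<subset> Z (Suc i)"
    have "m = 0"
    proof (rule ccontr)
      assume "m \<noteq> 0"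
      then have "Z 0 \<subset> Z 1" "Z 1 \<subseteq> {x}" "Z 0 \<noteq> {}" using m irreducible_setD(2)[of n "Z 0"] by auto
      then show False by blast
    qed
    then show "y \<le> 0" using m(1) by (simp add: zero_enat_def)
  qed
  ultimately show False by simp
qed

text \<open>A point that lies on no infinite irreducible subset would itself be a component, of
  dimension 0.\<close>

lemma branches_cover:
  assumes "\<forall>C\<in>components n U. zariski_dim n C = 1" "x \<in> U"
  shows "\<exists>D\<in>branches. x \<in> D"
proof (rule ccontr)
  assume no: "\<not> ?thesis"
  have xc: "x \<in> carrier_vec n" using assms(2) algebraic_set_carrier[OF U] by blast
  have "{x} \<in> components n U" unfolding components_def
  proof (intro CollectI conjI allI impI)
    show "irreducible_set n {x}" by (rule irreducible_singleton[OF xc])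
    show "{x} \<subseteq> U" using assms(2) by simp
    fix D assume D: "irreducible_set n D \<and> {x} \<subseteq> D \<and> D \<subseteq> U"
    show "D = {x}"
    proof (rule ccontr)
      assume "D \<noteq> {x}"
      then obtain y where "y \<in> D" "y \<noteq> x" using D by blast
      then have "infinite D" using D irreducible_infinite[of n D x y] by blast
      then show False using no D unfolding branches_def by blast
    qed
  qed
  then show False using assms(1) zariski_dim_singleton by blast
qed

text \<open>Multiplying one separating function for each other branch gives \<open>b\<close>. Points
  found with \<open>b\<close> nonzero lie on no other branch, so counts on different branches can be
  added.\<close>

lemma separating_function:
  assumes "finite \<D>" "\<D> \<subseteq> branches" "D \<in> \<D>"
  shows "\<exists>b\<in>pf n UNIV. (\<exists>x\<in>D. b x \<noteq> 0) \<and> (\<forall>D'\<in>\<D> - {D}. \<forall>x\<in>D'. b x = 0)"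
proof -
  have irr: "irreducible_set n D" using assms unfolding branches_def by auto
  have "\<forall>D'\<in>\<D> - {D}. \<exists>f. f \<in> pf n UNIV \<and> (\<forall>x\<in>D'. f x = 0) \<and> (\<exists>x\<in>D. f x \<noteq> 0)"
  proof
    fix D' assume D': "D' \<in> \<D> - {D}"
    then have irr': "irreducible_set n D'" using assms unfolding branches_def by auto
    have "\<not> D \<subseteq> D'" using branch_eqI[of D D'] D' assms by blast
    then obtain x where x: "x \<in> D" "x \<notin> D'" by blast
    then show "\<exists>f. f \<in> pf n UNIV \<and> (\<forall>x\<in>D'. f x = 0) \<and> (\<exists>x\<in>D. f x \<noteq> 0)"
      using algebraic_set_mem[OF irreducible_setD(1)[OF irr'] dom_carrier[OF irr x(1)]] by blast
  qed
  from bchoice[OF this] obtain f where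
    f: "\<forall>D'\<in>\<D> - {D}. f D' \<in> pf n UNIV \<and> (\<forall>x\<in>D'. f D' x = 0) \<and> (\<exists>x\<in>D. f D' x \<noteq> 0)" by blast
  have fin: "finite (\<D> - {D})" using assms(1) by simp
  have "\<exists>x\<in>D. (\<Prod>D'\<in>\<D> - {D}. f D' x) \<noteq> 0"
  proof (rule ccontr)
    assume "\<not> ?thesis"
    then have "\<exists>D'\<in>\<D> - {D}. \<forall>x\<in>D. f D' x = 0"
      using f by (intro irreducible_set_prime_prod[OF irr fin]) auto
    then show False using f by blast
  qed
  moreover have "(\<Prod>D'\<in>\<D> - {D}. f D' x) = 0" if "E \<in> \<D> - {D}" "x \<in> E" for E x
    using f that by (intro prod_zero[OF fin] bexI[of _ E]) auto
  moreover have "(\<lambda>x. \<Prod>D'\<in>\<D> - {D}. f D' x) \<in> pf n UNIV" using f by (intro pf_prod) auto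
  ultimately show ?thesis by (intro bexI[of _ "\<lambda>x. \<Prod>D'\<in>\<D> - {D}. f D' x"]) auto
qed

text \<open>The hyperplanes of the pencil spanned by \<open>h\<^sub>0\<close> and \<open>h\<^sub>1\<close> are generic up to finitely many exceptions.\<close>

lemma pencil_count:
  assumes \<D>: "finite \<D>" "\<D> \<subseteq> branches"
    and h: "h0 \<in> carrier_vec (n + 1)" "h1 \<in> carrier_vec (n + 1)" "G h1 \<noteq> 0"
    and nz: "\<And>D. D \<in> \<D> \<Longrightarrow> \<exists>x\<in>D. lina n h1 x \<noteq> 0"
    and N: "\<And>D. D \<in> \<D> \<Longrightarrow> N D > 0 \<and> no_relation D (lina n h0) (lina n h2) (lina n h1) (N D)"
  shows "(\<Sum>D\<in>\<D>. N D) \<le> d"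
proof -
  have irr: "irreducible_set n D" "D \<subseteq> U" if "D \<in> \<D>" for D using that \<D> unfolding branches_def by auto
  have "\<forall>D\<in>\<D>. \<exists>b. b \<in> pf n UNIV \<and> (\<exists>x\<in>D. b x \<noteq> 0) \<and> (\<forall>D'\<in>\<D> - {D}. \<forall>x\<in>D'. b x = 0)"
    using separating_function[OF \<D>] by blast
  from bchoice[OF this] obtain b where
    b: "\<forall>D\<in>\<D>. b D \<in> pf n UNIV \<and> (\<exists>x\<in>D. b D x \<noteq> 0) \<and> (\<forall>D'\<in>\<D> - {D}. \<forall>x\<in>D'. b D x = 0)" by blast
  have "\<forall>D\<in>\<D>. \<exists>B. finite B \<and> (\<forall>e. e \<notin> B \<longrightarrow> (\<exists>A. finite A \<and> card A = N D \<and> A \<subseteq> D \<and>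
           (\<forall>x\<in>A. lina n h1 x \<noteq> 0 \<and> b D x \<noteq> 0 \<and> lina n h0 x = e * lina n h1 x)))"
  proof
    fix D assume "D \<in> \<D>"
    then show "\<exists>B. finite B \<and> (\<forall>e. e \<notin> B \<longrightarrow> (\<exists>A. finite A \<and> card A = N D \<and> A \<subseteq> D \<and>
           (\<forall>x\<in>A. lina n h1 x \<noteq> 0 \<and> b D x \<noteq> 0 \<and> lina n h0 x = e * lina n h1 x)))"
      using b N by (intro fibre_points[where G = "lina n h2", OF irr(1) lina_pf lina_pf lina_pf _ nz]) auto
  qed
  from bchoice[OF this] obtain B where B: "\<forall>D\<in>\<D>. finite (B D) \<and> (\<forall>e. e \<notin> B D \<longrightarrow> (\<exists>A. finite A \<and> card A = N D \<and> A \<subseteq> D \<and>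
           (\<forall>x\<in>A. lina n h1 x \<noteq> 0 \<and> b D x \<noteq> 0 \<and> lina n h0 x = e * lina n h1 x)))" by blast
  \<comment> \<open>Excluded are the exceptional values of the branches, the value 0, by which the
    equation is to be divided, and the members of the pencil that are not generic.\<close>
  have "finite ((\<Union>D\<in>\<D>. B D) \<union> {0} \<union> (\<lambda>s. - 1 / s) ` {s. G (h1 + s \<cdot>\<^sub>v h0) = 0})"
    using B \<D>(1) finite_shift[OF h(2,1,3)] by auto
  then obtain e where e: "e \<notin> (\<Union>D\<in>\<D>. B D) \<union> {0} \<union> (\<lambda>s. - 1 / s) ` {s. G (h1 + s \<cdot>\<^sub>v h0) = 0}"
    using ex_new_if_finite[OF infinite_UNIV_char_0] by metis
  then have "\<forall>D\<in>\<D>. \<exists>A. finite A \<and> card A = N D \<and> A \<subseteq> D \<and>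
           (\<forall>x\<in>A. lina n h1 x \<noteq> 0 \<and> b D x \<noteq> 0 \<and> lina n h0 x = e * lina n h1 x)"
  proof (intro ballI)
    fix D assume D: "D \<in> \<D>"
    then have "e \<notin> B D" using e by blast
    then show "\<exists>A. finite A \<and> card A = N D \<and> A \<subseteq> D \<and>
           (\<forall>x\<in>A. lina n h1 x \<noteq> 0 \<and> b D x \<noteq> 0 \<and> lina n h0 x = e * lina n h1 x)"
      using bspec[OF B D] by blast
  qed
  from bchoice[OF this] obtain A where A: "\<forall>D\<in>\<D>. finite (A D) \<and> card (A D) = N D \<and> A D \<subseteq> D \<and>
           (\<forall>x\<in>A D. lina n h1 x \<noteq> 0 \<and> b D x \<noteq> 0 \<and> lina n h0 x = e * lina n h1 x)" by blast
  \<comment> \<open>The zero set of \<open>a\<close> is the hyperplane h0 = e h1, with h1 normalized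
    to coefficient 1.\<close>
  define a where "a = h1 + (- 1 / e) \<cdot>\<^sub>v h0"
  have a: "a \<in> carrier_vec (n + 1)" "G a \<noteq> 0"
  proof -
    show "a \<in> carrier_vec (n + 1)" unfolding a_def using h by simp
    have "e = - 1 / (- 1 / e)" using e by simp
    then show "G a \<noteq> 0" unfolding a_def using e by blast
  qed
  have "(\<Union>D\<in>\<D>. A D) \<subseteq> {x \<in> U. lina n a x = 0}"
    using A irr e unfolding a_def lina_add[OF h(2,1)] by fastforce
  moreover have "card (\<Union>D\<in>\<D>. A D) = (\<Sum>D\<in>\<D>. card (A D))"
  proof (rule card_UN_disjoint[OF \<D>(1)])
    show "\<forall>D\<in>\<D>. finite (A D)" using A by blast
    show "\<forall>D\<in>\<D>. \<forall>D'\<in>\<D>. D \<noteq> D' \<longrightarrow> A D \<inter> A D' = {}"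
    proof (intro ballI impI)
      fix D D' assume D: "D \<in> \<D>" "D' \<in> \<D>" "D \<noteq> D'"
      have "x \<notin> A D" if "x \<in> A D'" for x
      proof
        assume "x \<in> A D"
        then have "b D x \<noteq> 0" "x \<in> D'" using A D that by auto
        then show False using b D by blast
      qed
      then show "A D \<inter> A D' = {}" by blast
    qed
  qed
  moreover have "(\<Sum>D\<in>\<D>. card (A D)) = (\<Sum>D\<in>\<D>. N D)" using A by (intro sum.cong) auto
  ultimately show ?thesis
    using section_card[OF a] card_mono[of "{x \<in> U. lina n a x = 0}" "\<Union>D\<in>\<D>. A D"] by linarith
qed

text \<open>Here h1 is generic and nonzero at finitely many prescribed places, and h2 is chosen
  after it so that h2 / h1 separates the points of \<open>Q\<close>.\<close>

lemma generic_forms: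
  assumes Q: "finite Q" "Q \<subseteq> carrier_vec (n + 1)" "\<And>q. q \<in> Q \<Longrightarrow> q \<noteq> 0\<^sub>v (n + 1)"
    and np: "\<And>q q' c. q \<in> Q \<Longrightarrow> q' \<in> Q \<Longrightarrow> q \<noteq> q' \<Longrightarrow> q \<noteq> c \<cdot>\<^sub>v q'"
    and \<Phi>: "finite \<Phi>" "\<Phi> \<subseteq> pf (n + 1) UNIV" "\<And>f. f \<in> \<Phi> \<Longrightarrow> \<exists>x\<in>carrier_vec (n + 1). f x \<noteq> 0"
  shows "\<exists>h1\<in>carrier_vec (n + 1). \<exists>h2. G h1 \<noteq> 0 \<and> (\<forall>f\<in>\<Phi>. f h1 \<noteq> 0) \<and> (\<forall>q\<in>Q. linf (n + 1) h1 q \<noteq> 0) \<and>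
     inj_on (\<lambda>q. linf (n + 1) h2 q / linf (n + 1) h1 q) Q"
proof -
  have pfl: "(\<lambda>a. linf (n + 1) a q) \<in> pf (n + 1) UNIV" for q by (rule pf_subset[OF _ linf_pf_coeff]) simp
  have "\<exists>h1\<in>carrier_vec (n + 1). \<forall>f\<in>{G} \<union> \<Phi> \<union> (\<lambda>q a. linf (n + 1) a q) ` Q. f h1 \<noteq> 0"
  proof (rule generic_choice)
    fix f assume "f \<in> {G} \<union> \<Phi> \<union> (\<lambda>q a. linf (n + 1) a q) ` Q"
    then show "\<exists>x\<in>carrier_vec (n + 1). f x \<noteq> 0" using G_nonzero \<Phi>(3) linf_nonzero Q by blast
  qed (use Q(1) \<Phi> G_pf pfl in auto)
  then obtain h1 where h1c: "h1 \<in> carrier_vec (n + 1)"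
    and all: "\<forall>f\<in>{G} \<union> \<Phi> \<union> (\<lambda>q a. linf (n + 1) a q) ` Q. f h1 \<noteq> 0" by blast
  have h1: "h1 \<in> carrier_vec (n + 1)" "G h1 \<noteq> 0" "\<forall>f\<in>\<Phi>. f h1 \<noteq> 0" "\<forall>q\<in>Q. linf (n + 1) h1 q \<noteq> 0"
  proof -
    show "h1 \<in> carrier_vec (n + 1)" by (rule h1c)
    show "G h1 \<noteq> 0" "\<forall>f\<in>\<Phi>. f h1 \<noteq> 0" using all by simp_all
    show "\<forall>q\<in>Q. linf (n + 1) h1 q \<noteq> 0" using all by (simp add: ball_Un)
  qed
  \<comment> \<open>h2 vanishes at \<open>w q q'\<close> exactly when h2 / h1 takes the same value
    at \<open>q\<close> and \<open>q'\<close>. This vector is nonzero since \<open>q\<close> and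
    \<open>q'\<close> are not proportional.\<close>
  define w where "w q q' = linf (n + 1) h1 q' \<cdot>\<^sub>v q - linf (n + 1) h1 q \<cdot>\<^sub>v q'" for q q'
  have w: "w q q' \<in> carrier_vec (n + 1)" "w q q' \<noteq> 0\<^sub>v (n + 1)" if q: "q \<in> Q" "q' \<in> Q" "q \<noteq> q'" for q q'
  proof -
    have c: "q \<in> carrier_vec (n + 1)" "q' \<in> carrier_vec (n + 1)" using q Q(2) by auto
    show "w q q' \<in> carrier_vec (n + 1)" unfolding w_def using c by simp
    show "w q q' \<noteq> 0\<^sub>v (n + 1)"
    proof
      assume w0: "w q q' = 0\<^sub>v (n + 1)"
      have "q = (linf (n + 1) h1 q / linf (n + 1) h1 q') \<cdot>\<^sub>v q'"
      proof (rule eq_vecI)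
        fix i assume i: "i < dim_vec ((linf (n + 1) h1 q / linf (n + 1) h1 q') \<cdot>\<^sub>v q')"
        then have "w q q' $ i = 0" using w0 c by simp
        then have "linf (n + 1) h1 q' * q $ i = linf (n + 1) h1 q * q' $ i" unfolding w_def using i c by simp
        then show "q $ i = ((linf (n + 1) h1 q / linf (n + 1) h1 q') \<cdot>\<^sub>v q') $ i"
          using i c h1(4) q by (simp add: field_simps)
      qed (use c in auto)
      then show False using np q by blast
    qed
  qed
  have wlin: "linf (n + 1) h (w q q') = linf (n + 1) h1 q' * linf (n + 1) h q - linf (n + 1) h1 q * linf (n + 1) h q'"
    if "q \<in> Q" "q' \<in> Q" for h q q'
  proof -
    have c: "q \<in> carrier_vec (n + 1)" "q' \<in> carrier_vec (n + 1)" using that Q(2) by auto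
    show ?thesis unfolding w_def linf_def sum_distrib_left sum_subtractf[symmetric]
      using c by (intro sum.cong) (auto simp: algebra_simps)
  qed
  let ?W = "(\<lambda>(q, q') a. linf (n + 1) a (w q q')) ` {(q, q'). q \<in> Q \<and> q' \<in> Q \<and> q \<noteq> q'}"
  have "\<exists>h2\<in>carrier_vec (n + 1). \<forall>f\<in>?W. f h2 \<noteq> 0"
  proof (rule generic_choice)
    have "finite (Q \<times> Q)" using Q(1) by simp
    then show "finite ?W" by (intro finite_imageI) (rule finite_subset[of _ "Q \<times> Q"], auto)
    show "?W \<subseteq> pf (n + 1) UNIV" using pfl by auto
    fix f assume "f \<in> ?W"
    then obtain q q' where "f = (\<lambda>a. linf (n + 1) a (w q q'))" "q \<in> Q" "q' \<in> Q" "q \<noteq> q'" by auto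
    then show "\<exists>x\<in>carrier_vec (n + 1). f x \<noteq> 0" using linf_nonzero[OF w] by blast
  qed
  then obtain h2 where h2W: "\<forall>f\<in>?W. f h2 \<noteq> 0" by blast
  have h2: "linf (n + 1) h2 (w q q') \<noteq> 0" if "q \<in> Q" "q' \<in> Q" "q \<noteq> q'" for q q'
    using bspec[OF h2W, of "\<lambda>a. linf (n + 1) a (w q q')"] that by force
  have "inj_on (\<lambda>q. linf (n + 1) h2 q / linf (n + 1) h1 q) Q"
  proof
    fix q q' assume q: "q \<in> Q" "q' \<in> Q" "linf (n + 1) h2 q / linf (n + 1) h1 q = linf (n + 1) h2 q' / linf (n + 1) h1 q'"
    have "linf (n + 1) h2 (w q q') = 0" 
      unfolding wlin[OF q(1,2)] using q h1(4) by (simp add: frac_eq_eq mult.commute)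
    then show "q = q'" using h2 q by blast
  qed
  then show ?thesis using h1 by blast
qed

text \<open>The special hyperplane is the one at infinity, whose affine form is the constant 1. A
  branch counts as many points as it has among the \<open>v k\<close>, but at least 1, because 1 /
  h1 is not constant on it.\<close>

lemma count_at_infinity:
  assumes \<D>: "finite \<D>" "\<D> \<subseteq> branches"
    and K: "finite K" "\<And>k. k \<in> K \<Longrightarrow> v k \<in> carrier_vec (n + 1) \<and> v k \<noteq> 0\<^sub>v (n + 1) \<and> v k $ n = 0"
      "\<And>k k' c. k \<in> K \<Longrightarrow> k' \<in> K \<Longrightarrow> k \<noteq> k' \<Longrightarrow> v k \<noteq> c \<cdot>\<^sub>v v k'"
  shows "(\<Sum>D\<in>\<D>. max 1 (card {k \<in> K. in_closure n D (v k)})) \<le> d"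
proof -
  have irr: "irreducible_set n D" "D \<subseteq> U" "infinite D" if "D \<in> \<D>" for D using that \<D> unfolding branches_def by auto
  have "\<forall>D\<in>\<D>. \<exists>p. fst p \<in> D \<and> snd p \<in> D \<and> fst p \<noteq> snd p"
  proof
    fix D assume D: "D \<in> \<D>"
    obtain x where x: "x \<in> D" using irreducible_setD(2)[OF irr(1)[OF D]] by blast
    have "infinite (D - {x})" using irr(3)[OF D] by simp
    then obtain y where "y \<in> D - {x}" using infinite_imp_nonempty by blast
    then show "\<exists>p. fst p \<in> D \<and> snd p \<in> D \<and> fst p \<noteq> snd p" using x by (intro exI[of _ "(x, y)"]) auto
  qed
  from bchoice[OF this] obtain p where p: "\<forall>D\<in>\<D>. fst (p D) \<in> D \<and> snd (p D) \<in> D \<and> fst (p D) \<noteq> snd (p D)" by blast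
  define x y where "x D = fst (p D)" and "y D = snd (p D)" for D
  have xy: "x D \<in> D" "y D \<in> D" "x D \<noteq> y D" "x D \<in> carrier_vec n" "y D \<in> carrier_vec n" if "D \<in> \<D>" for D
    using p that dom_carrier[OF irr(1)[OF that]] unfolding x_def y_def by auto
  have linapf: "(\<lambda>a. lina n a z) \<in> pf (n + 1) UNIV" for z
    unfolding lina_def by (subst mult.commute) (intro pf_intros pf_smult, auto)
  \<comment> \<open>These conditions make h1 nonzero at two points of every branch and give it
    different values there.\<close>
  define \<Phi> where "\<Phi> = (\<lambda>D a. lina n a (x D)) ` \<D> \<union> (\<lambda>D a. lina n a (y D)) ` \<D> \<union> (\<lambda>D a. lina n a (x D) - lina n a (y D)) ` \<D>"
  have "\<exists>h1\<in>carrier_vec (n + 1). \<exists>h2. G h1 \<noteq> 0 \<and> (\<forall>f\<in>\<Phi>. f h1 \<noteq> 0) \<and> (\<forall>q\<in>v ` K. linf (n + 1) h1 q \<noteq> 0) \<and>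
     inj_on (\<lambda>q. linf (n + 1) h2 q / linf (n + 1) h1 q) (v ` K)"
  proof (rule generic_forms)
    show "finite \<Phi>" "\<Phi> \<subseteq> pf (n + 1) UNIV" unfolding \<Phi>_def using \<D>(1) linapf by (auto intro!: pf_diff)
    fix f assume "f \<in> \<Phi>"
    then consider D where "D \<in> \<D>" "f = (\<lambda>a. lina n a (x D))" | D where "D \<in> \<D>" "f = (\<lambda>a. lina n a (y D))"
      | D where "D \<in> \<D>" "f = (\<lambda>a. lina n a (x D) - lina n a (y D))" unfolding \<Phi>_def by blast
    then show "\<exists>x\<in>carrier_vec (n + 1). f x \<noteq> 0"
    proof cases
      case 1
      then show ?thesis by (intro bexI[of _ "unit_vec (n + 1) n"]) (auto simp: unit_form_simps)
    next
      case 2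
      then show ?thesis by (intro bexI[of _ "unit_vec (n + 1) n"]) (auto simp: unit_form_simps)
    next
      case 3
      have "\<exists>i<n. x D $ i \<noteq> y D $ i" using xy[OF 3(1)] by (metis carrier_vecD eq_vecI)
      then obtain i where "i < n" "x D $ i \<noteq> y D $ i" by blast
      then show ?thesis using 3 by (intro bexI[of _ "unit_vec (n + 1) i"]) (auto simp: unit_form_simps)
    qed
  qed (use K in auto)
  then obtain h1 h2 where h: "h1 \<in> carrier_vec (n + 1)" "G h1 \<noteq> 0" "\<And>f. f \<in> \<Phi> \<Longrightarrow> f h1 \<noteq> 0"
    "\<And>k. k \<in> K \<Longrightarrow> linf (n + 1) h1 (v k) \<noteq> 0"
    "inj_on (\<lambda>q. linf (n + 1) h2 q / linf (n + 1) h1 q) (v ` K)" by auto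
  have vinj: "inj_on v K"
  proof
    fix k k' assume k: "k \<in> K" "k' \<in> K" "v k = v k'"
    then have "v k = 1 \<cdot>\<^sub>v v k'" by simp
    then show "k = k'" using K(3) k by blast
  qed
  have hx: "lina n h1 (x D) \<noteq> 0" "lina n h1 (y D) \<noteq> 0" "lina n h1 (x D) \<noteq> lina n h1 (y D)" if "D \<in> \<D>" for D
    using h(3)[of "\<lambda>a. lina n a (x D)"] h(3)[of "\<lambda>a. lina n a (y D)"] h(3)[of "\<lambda>a. lina n a (x D) - lina n a (y D)"] that
    unfolding \<Phi>_def by auto
  show ?thesis
  proof (rule pencil_count[OF \<D> _ h(1,2), of "unit_vec (n + 1) n" _ h2])
    fix D assume D: "D \<in> \<D>"
    show "\<exists>x\<in>D. lina n h1 x \<noteq> 0" using hx(1)[OF D] xy(1)[OF D] by blast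
    let ?Q = "v ` {k \<in> K. in_closure n D (v k)}"
    have cQ: "card ?Q = card {k \<in> K. in_closure n D (v k)}" by (intro card_image inj_on_subset[OF vinj]) auto
    have "no_relation D (lina n (unit_vec (n + 1) n)) (lina n h2) (lina n h1) (max 1 (card {k \<in> K. in_closure n D (v k)}))"
    proof (cases "card {k \<in> K. in_closure n D (v k)} = 0")
      case True
      have "no_relation D (lina n (unit_vec (n + 1) n)) (lina n h2) (lina n h1) 1"
        using hx[OF D] xy[OF D]
        by (intro no_relation_nonconstant[OF irr(1)[OF D] lina_pf lina_pf, of "x D" "y D"]) (auto simp: unit_form_simps)
      then show ?thesis using True by simp
    next
      case False
      have "no_relation D (lina n (unit_vec (n + 1) n)) (lina n h2) (lina n h1) (card ?Q)"
      proof (rule no_relation_at_points[OF irr(1)[OF D]])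
        show "\<exists>x\<in>D. lina n (unit_vec (n + 1) n) x \<noteq> 0" using xy[OF D] by (auto simp: unit_form_simps)
        show "finite ?Q" using K(1) by simp
        show "inj_on (\<lambda>q. linf (n + 1) h2 q / linf (n + 1) h1 q) ?Q" by (rule inj_on_subset[OF h(5)]) auto
        fix q assume "q \<in> ?Q"
        then show "in_closure n D q \<and> linf (n + 1) (unit_vec (n + 1) n) q = 0 \<and> linf (n + 1) h1 q \<noteq> 0"
          using K(2) h(4) by (auto simp: unit_form_simps)
      qed
      then show ?thesis unfolding cQ using False by (simp add: max_def)
    qed
    then show "0 < max 1 (card {k \<in> K. in_closure n D (v k)}) \<and>
      no_relation D (lina n (unit_vec (n + 1) n)) (lina n h2) (lina n h1) (max 1 (card {k \<in> K. in_closure n D (v k)}))"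
      by simp
  qed simp
qed

text \<open>Without any points at infinity, each branch still contributes 1 to a sum bounded by
  \<open>d\<close>.\<close>

lemma finite_branches: "finite branches"
proof (rule ccontr)
  assume "infinite branches"
  then obtain \<D> where \<D>: "finite \<D>" "card \<D> = d + 1" "\<D> \<subseteq> branches"
    using infinite_arbitrarily_large by blast
  have "(\<Sum>D\<in>\<D>. max 1 (card {k \<in> ({} :: nat set). in_closure n D (0\<^sub>v n)})) \<le> d"
    using count_at_infinity[OF \<D>(1,3), of "{} :: nat set" "\<lambda>_. 0\<^sub>v n"] by simp
  then show False using \<D>(2) by simp
qed

text \<open>The pencil argument for a single branch and any hyperplane that does not contain it. The
  points of \<open>Q\<close> may lie at infinity as well as in the affine part.\<close>

lemma hyperplane_count:
  assumes C: "C \<in> branches" and h0: "h0 \<in> carrier_vec (n + 1)" "\<exists>x\<in>C. lina n h0 x \<noteq> 0"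
    and Q: "finite Q" "Q \<subseteq> carrier_vec (n + 1)" "\<And>q. q \<in> Q \<Longrightarrow> q \<noteq> 0\<^sub>v (n + 1) \<and> in_closure n C q \<and> linf (n + 1) h0 q = 0"
      "\<And>q q' c. q \<in> Q \<Longrightarrow> q' \<in> Q \<Longrightarrow> q \<noteq> q' \<Longrightarrow> q \<noteq> c \<cdot>\<^sub>v q'"
  shows "card Q \<le> d"
proof (cases "card Q = 0")
  case False
  have irr: "irreducible_set n C" using C unfolding branches_def by auto
  obtain x where x: "x \<in> C" using irreducible_setD(2)[OF irr] by blast
  have linapf: "(\<lambda>a. lina n a z) \<in> pf (n + 1) UNIV" for z
    unfolding lina_def by (subst mult.commute) (intro pf_intros pf_smult, auto)
  have "\<exists>h1\<in>carrier_vec (n + 1). \<exists>h2. G h1 \<noteq> 0 \<and> (\<forall>f\<in>{\<lambda>a. lina n a x}. f h1 \<noteq> 0) \<and> (\<forall>q\<in>Q. linf (n + 1) h1 q \<noteq> 0) \<and>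
     inj_on (\<lambda>q. linf (n + 1) h2 q / linf (n + 1) h1 q) Q"
  proof (rule generic_forms[OF Q(1,2) _ Q(4)])
    fix f assume "f \<in> {\<lambda>a. lina n a x}"
    then show "\<exists>x\<in>carrier_vec (n + 1). f x \<noteq> 0" 
      by (intro bexI[of _ "unit_vec (n + 1) n"]) (auto simp: unit_form_simps)
  qed (use Q(3) linapf in auto)
  then obtain h1 h2 where h: "h1 \<in> carrier_vec (n + 1)" "G h1 \<noteq> 0" "lina n h1 x \<noteq> 0"
    "\<forall>q\<in>Q. linf (n + 1) h1 q \<noteq> 0" "inj_on (\<lambda>q. linf (n + 1) h2 q / linf (n + 1) h1 q) Q" by auto
  have "no_relation C (lina n h0) (lina n h2) (lina n h1) (card Q)"
    using Q h by (intro no_relation_at_points[OF irr h0(2)]) auto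
  then have "(\<Sum>D\<in>{C}. card Q) \<le> d"
    using C x h False by (intro pencil_count[OF _ _ h0(1) h(1,2), of _ _ h2]) auto
  then show ?thesis by simp
qed simp

end

section \<open>Conjugates\<close>

abbreviation mp :: "'k::field poly \<Rightarrow> 'k alg_closure poly" where "mp \<equiv> map_poly to_ac"

text \<open>An element of K(\<alpha>) is carried around as a polynomial over K, so that its
  conjugates are obtained by evaluating the same polynomial elsewhere.\<close>

definition pe :: "'k::field poly \<Rightarrow> 'k alg_closure \<Rightarrow> 'k alg_closure" where
  "pe p x = poly (mp p) x"

lemma mp_add: "mp (p + q) = mp p + mp q"
  by (rule poly_eqI) (simp add: coeff_map_poly)

lemma mp_diff: "mp (p - q) = mp p - mp q"
  by (rule poly_eqI) (simp add: coeff_map_poly)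

lemma mp_mult: "mp (p * q) = mp p * mp q"
  by (rule poly_eqI) (simp add: coeff_map_poly coeff_mult to_ac_sum)

lemma mp_smult: "mp (smult c p) = smult (to_ac c) (mp p)"
  by (rule poly_eqI) (simp add: coeff_map_poly)

lemma mp_monom: "mp (monom c k) = monom (to_ac c) k"
  by (rule poly_eqI) (simp add: coeff_map_poly)

lemma mp_1: "mp 1 = 1"
  by (rule poly_eqI) (simp add: coeff_map_poly coeff_1)

lemma mp_sum: "mp (\<Sum>i\<in>A. f i) = (\<Sum>i\<in>A. mp (f i))"
  by (induction A rule: infinite_finite_induct) (auto simp: mp_add)

lemma mp_prod: "mp (\<Prod>i\<in>A. f i) = (\<Prod>i\<in>A. mp (f i))"
  by (induction A rule: infinite_finite_induct) (auto simp: mp_mult mp_1)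

lemma mp_eq_0: "mp p = 0 \<longleftrightarrow> p = 0"
  by (auto simp: poly_eq_iff coeff_map_poly)

lemma degree_mp: "degree (mp p) = degree p"
  by (cases "p = 0") (auto intro!: map_poly_degree_eq simp: leading_coeff_0_iff)

lemma poly_mp_to_ac: "poly (mp p) (to_ac x) = to_ac (poly p x)"
  by (induction p) (auto simp: map_poly_pCons)

lemma pe_add: "pe (p + q) x = pe p x + pe q x"
  and pe_diff: "pe (p - q) x = pe p x - pe q x"
  and pe_mult: "pe (p * q) x = pe p x * pe q x"
  and pe_smult: "pe (smult c p) x = to_ac c * pe p x"
  and pe_monom: "pe (monom c k) x = to_ac c * x ^ k"
  and pe_0: "pe 0 x = 0"
  and pe_1: "pe 1 x = 1"
  by (simp_all add: pe_def mp_add mp_diff mp_mult mp_smult mp_monom mp_1 poly_monom)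

lemma pe_minus: "pe (- p) x = - pe p x"
  using pe_diff[of 0 p x] by (simp add: pe_0)

lemma pe_sum: "pe (\<Sum>i\<in>A. f i) x = (\<Sum>i\<in>A. pe (f i) x)"
  by (simp add: pe_def mp_sum poly_sum)

lemma pe_prod: "pe (\<Prod>i\<in>A. f i) x = (\<Prod>i\<in>A. pe (f i) x)"
  by (simp add: pe_def mp_prod poly_prod)

lemma pe_power: "pe (p ^ k) x = pe p x ^ k"
  by (induction k) (auto simp: pe_1 pe_mult)

lemma pe_pCons: "pe (pCons a p) x = to_ac a + x * pe p x"
  by (simp add: pe_def map_poly_pCons)

lemma minimal_annihilator:
  fixes x :: "'k::field alg_closure"
  obtains p where "lead_coeff p = 1" "Factorial_Ring.irreducible p" "pe p x = 0" "\<And>r. pe r x = 0 \<longleftrightarrow> p dvd r"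
proof -
  define P where "P k \<longleftrightarrow> (\<exists>p::'k poly. p \<noteq> 0 \<and> pe p x = 0 \<and> degree p = k)" for k
  obtain p0 :: "'k poly" where "p0 \<noteq> 0" "pe p0 x = 0" unfolding pe_def by (rule alg_closure_algebraic)
  then have "P (degree p0)" unfolding P_def by blast
  define k where "k = (LEAST k. P k)"
  have "P k" unfolding k_def by (rule LeastI) fact
  then obtain q where q: "q \<noteq> 0" "pe q x = 0" "degree q = k" unfolding P_def by blast
  have min: "degree r \<ge> k" if "r \<noteq> 0" "pe r x = 0" for r
    unfolding k_def using that by (intro Least_le) (auto simp: P_def)
  define p where "p = smult (inverse (lead_coeff q)) q"
  have p: "lead_coeff p = 1" "p \<noteq> 0" "pe p x = 0" "degree p = k"
    unfolding p_def using q by (auto simp: pe_smult)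
  have dvd: "pe r x = 0 \<longleftrightarrow> p dvd r" for r
  proof
    assume r: "pe r x = 0"
    have "pe (r mod p) x = pe r x - pe (r div p * p) x"
      unfolding pe_diff[symmetric] by (simp add: minus_div_mult_eq_mod)
    then have "pe (r mod p) x = 0" using r p(3) by (simp add: pe_mult)
    moreover have "r mod p \<noteq> 0 \<Longrightarrow> degree (r mod p) < k" using degree_mod_less[OF p(2), of r] p(4) by auto
    ultimately have "r mod p = 0" using min by (metis not_less)
    then show "p dvd r" by auto
  next
    assume "p dvd r"
    then show "pe r x = 0" using p(3) by (auto elim!: dvdE simp: pe_mult)
  qed
  have "\<not> is_unit p"
  proof
    assume "is_unit p"
    then have "degree p = 0" using p(2) is_unit_iff_degree by blast
    then obtain c where c: "p = [:c:]" by (metis degree_eq_zeroE)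
    then show False using p by (simp add: pe_pCons pe_0)
  qed
  moreover have "is_unit a \<or> is_unit b" if ab: "p = a * b" for a b
  proof -
    have ne: "a \<noteq> 0" "b \<noteq> 0" using ab p(2) by auto
    have unit: "is_unit s" if "s \<noteq> 0" "degree s = 0" for s :: "'k poly"
      using that by (metis degree_eq_zeroE dvd_field_iff is_unit_const_poly_iff pCons_0_0)
    have deg: "degree a + degree b = k" using ab ne p(4) degree_mult_eq by metis
    have "pe a x = 0 \<or> pe b x = 0" using p(3) unfolding ab pe_mult by simp
    then show ?thesis
    proof
      assume "pe a x = 0"
      then have "degree b = 0" using min[OF ne(1)] deg by simp
      then show ?thesis using unit ne by blast
    next
      assume "pe b x = 0"
      then have "degree a = 0" using min[OF ne(2)] deg by simp
      then show ?thesis using unit ne by blast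
    qed
  qed
  ultimately have "Factorial_Ring.irreducible p" using p(2) by (intro irreducibleI)
  then show ?thesis using that p dvd by blast
qed

text \<open>The annihilator of least degree is the only monic irreducible one: any other is a
  multiple of it with a unit cofactor, which must be 1.\<close>

lemma min_poly:
  fixes x :: "'k::field alg_closure"
  shows "lead_coeff (min_poly x) = 1" "Factorial_Ring.irreducible (min_poly x)" "pe r x = 0 \<longleftrightarrow> min_poly x dvd r"
proof -
  obtain p where p: "lead_coeff p = 1" "Factorial_Ring.irreducible p" "pe p x = 0" "\<And>r. pe r x = 0 \<longleftrightarrow> p dvd r"
    by (rule minimal_annihilator) blast
  have "min_poly x = p" unfolding min_poly_def
  proof (rule the_equality)
    show "lead_coeff p = 1 \<and> Factorial_Ring.irreducible p \<and> poly (mp p) x = 0" using p unfolding pe_def by blast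
    fix q assume q: "lead_coeff q = 1 \<and> Factorial_Ring.irreducible q \<and> poly (mp q) x = 0"
    then have "p dvd q" using p(4) unfolding pe_def by blast
    then obtain s where s: "q = p * s" by (elim dvdE)
    have "\<not> is_unit p" using p(2) by (simp add: irreducible_not_unit)
    then have "is_unit s" using q s irreducibleD by blast
    moreover have "s \<noteq> 0" using q s by auto
    ultimately have "degree s = 0" using is_unit_iff_degree by blast
    then obtain c where c: "s = [:c:]" by (metis degree_eq_zeroE)
    have "lead_coeff q = lead_coeff p * c" unfolding s c by simp
    then have "c = 1" using q p(1) by simp
    then show "q = p" unfolding s c by simp
  qed
  then show "lead_coeff (min_poly x) = 1" "Factorial_Ring.irreducible (min_poly x)" "pe r x = 0 \<longleftrightarrow> min_poly x dvd r"
    using p by auto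
qed

lemma conjugates_iff: "\<beta> \<in> conjugates \<alpha> \<longleftrightarrow> pe (min_poly \<alpha>) \<beta> = 0"
  by (simp add: conjugates_def pe_def)

lemma self_conjugate: "\<alpha> \<in> conjugates \<alpha>"
  unfolding conjugates_iff min_poly(3) by simp

text \<open>The minimal polynomial of \<beta> divides the irreducible one of \<alpha>, so the two
  are associated. Its corollary \<open>conjugate_zero_iff\<close> takes the place of Galois
  automorphisms.\<close>

lemma conjugate_min_poly_dvd:
  assumes "\<beta> \<in> conjugates \<alpha>"
  shows "pe r \<beta> = 0 \<longleftrightarrow> min_poly \<alpha> dvd r"
proof
  assume r: "pe r \<beta> = 0"
  have "min_poly \<beta> dvd min_poly \<alpha>" using assms unfolding conjugates_iff min_poly(3) .
  then obtain s where s: "min_poly \<alpha> = min_poly \<beta> * s" by (elim dvdE)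
  have "\<not> is_unit (min_poly \<beta>)" using min_poly(2) irreducible_not_unit by blast
  then have "is_unit s" using irreducibleD[OF min_poly(2) s] by blast
  then have "min_poly \<alpha> dvd min_poly \<beta>" unfolding s by (simp add: mult_unit_dvd_iff)
  then show "min_poly \<alpha> dvd r" using r min_poly(3) dvd_trans by blast
next
  assume "min_poly \<alpha> dvd r"
  then show "pe r \<beta> = 0" using assms unfolding conjugates_iff by (auto elim!: dvdE simp: pe_mult)
qed

lemma conjugate_zero_iff:
  "\<beta> \<in> conjugates \<alpha> \<Longrightarrow> \<gamma> \<in> conjugates \<alpha> \<Longrightarrow> pe r \<beta> = 0 \<longleftrightarrow> pe r \<gamma> = 0"
  by (simp add: conjugate_min_poly_dvd)

lemma degree_min_poly_pos: "degree (min_poly \<alpha>) > 0"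
proof (rule ccontr)
  assume "\<not> ?thesis"
  then obtain c where "min_poly \<alpha> = [:c:]" by (metis degree_eq_zeroE neq0_conv)
  then have "min_poly \<alpha> = 1" using min_poly(1)[of \<alpha>] by (simp add: one_pCons)
  then show False using min_poly(2)[of \<alpha>] by simp
qed

lemma finite_conjugates: "finite (conjugates \<alpha>)"
  unfolding conjugates_def using min_poly(2)[of \<alpha>] by (intro poly_roots_finite) (auto simp: mp_eq_0)

text \<open>A multiple root would make the minimal polynomial divide its own derivative, which is
  shorter and, in characteristic zero, nonzero.\<close>

lemma card_conjugates:
  fixes \<alpha> :: "'k::field_char_0 alg_closure"
  shows "card (conjugates \<alpha>) = degree (min_poly \<alpha>)"
proof -
  have "card {\<beta>. poly (mp (min_poly \<alpha>)) \<beta> = 0} = degree (mp (min_poly \<alpha>))"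
  proof (rule card_simple_roots)
    fix \<beta> assume \<beta>: "poly (mp (min_poly \<alpha>)) \<beta> = 0"
    show "poly (pderiv (mp (min_poly \<alpha>))) \<beta> \<noteq> 0"
    proof
      assume "poly (pderiv (mp (min_poly \<alpha>))) \<beta> = 0"
      moreover have "pderiv (mp (min_poly \<alpha>)) = mp (pderiv (min_poly \<alpha>))"
        by (rule poly_eqI) (simp add: coeff_pderiv coeff_map_poly)
      ultimately have "min_poly \<alpha> dvd pderiv (min_poly \<alpha>)"
        using conjugate_min_poly_dvd[of \<beta> \<alpha>] \<beta> unfolding conjugates_def pe_def by simp
      moreover have "pderiv (min_poly \<alpha>) \<noteq> 0" using degree_min_poly_pos[of \<alpha>] by (simp add: pderiv_eq_0_iff)
      ultimately have "degree (min_poly \<alpha>) \<le> degree (pderiv (min_poly \<alpha>))" by (rule dvd_imp_degree_le)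
      then show False using degree_min_poly_pos[of \<alpha>] by (simp add: degree_pderiv)
    qed
  qed
  then show ?thesis unfolding conjugates_def degree_mp .
qed

lemma pe_pcompose: "pe (pcompose s p) x = pe s (pe p x)"
  by (induction s) (auto simp: pe_0 pe_pCons pcompose_pCons pe_add pe_mult)

text \<open>The minimal polynomial reads a + X q(X) with a nonzero by minimality, so the inverse is
  -q(h) / a.\<close>

lemma inverse_as_polynomial:
  fixes h :: "'k::field alg_closure"
  assumes "h \<noteq> 0"
  shows "\<exists>s. inverse h = pe s h"
proof -
  obtain a q where aq: "min_poly h = pCons a q" by (cases "min_poly h") auto
  have root: "to_ac a + h * pe q h = 0" using min_poly(3)[of "min_poly h" h] unfolding aq pe_pCons by simp
  have "q \<noteq> 0" using degree_min_poly_pos[of h] aq by auto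
  have "a \<noteq> 0"
  proof
    assume "a = 0"
    then have "pe q h = 0" using root assms by simp
    then have "min_poly h dvd q" using min_poly(3) by blast
    then have "degree (min_poly h) \<le> degree q" using \<open>q \<noteq> 0\<close> by (rule dvd_imp_degree_le)
    then show False unfolding aq using \<open>q \<noteq> 0\<close> by simp
  qed
  moreover have "h * pe q h = - to_ac a" using root by (simp add: eq_neg_iff_add_eq_0 add.commute)
  ultimately have "h * pe (smult (- inverse a) q) h = 1" unfolding pe_smult by (simp add: mult.left_commute[of h])
  then show ?thesis using inverse_unique by blast
qed

section \<open>The field K(\<alpha>) as the set of polynomial values at \<alpha>\<close>

lemma field_ops_type_algebra:
  fixes x y :: "'a::field"
  shows "x \<oplus>\<^bsub>ring_of_type_algebra\<^esub> y = x + y" "x \<otimes>\<^bsub>ring_of_type_algebra\<^esub> y = x * y"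
    "\<one>\<^bsub>ring_of_type_algebra\<^esub> = (1 :: 'a)" "\<zero>\<^bsub>ring_of_type_algebra\<^esub> = (0 :: 'a)"
    "\<ominus>\<^bsub>ring_of_type_algebra\<^esub> x = - x" "x \<noteq> 0 \<Longrightarrow> inv\<^bsub>ring_of_type_algebra\<^esub> x = inverse x"
proof -
  interpret F: Ring.field "ring_of_type_algebra :: 'a ring" by rule
  show *: "x \<oplus>\<^bsub>ring_of_type_algebra\<^esub> y = x + y" "x \<otimes>\<^bsub>ring_of_type_algebra\<^esub> y = x * y"
    "\<one>\<^bsub>ring_of_type_algebra\<^esub> = (1 :: 'a)" "\<zero>\<^bsub>ring_of_type_algebra\<^esub> = (0 :: 'a)" for x y :: 'a
    by (simp_all add: ring_of_type_algebra_def)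
  have UNIV: "carrier (ring_of_type_algebra :: 'a ring) = UNIV" by (simp add: ring_of_type_algebra_def)
  show "\<ominus>\<^bsub>ring_of_type_algebra\<^esub> x = - x"
    by (rule F.minus_equality) (simp_all add: * UNIV)
  show "inv\<^bsub>ring_of_type_algebra\<^esub> x = inverse x" if "x \<noteq> 0"
    by (rule F.comm_inv_char) (use that in \<open>simp_all add: * UNIV\<close>)
qed

lemma adjoin_closed:
  shows "to_ac c \<in> adjoin \<alpha>" "\<alpha> \<in> adjoin \<alpha>" "x \<in> adjoin \<alpha> \<Longrightarrow> y \<in> adjoin \<alpha> \<Longrightarrow> x + y \<in> adjoin \<alpha>"
    "x \<in> adjoin \<alpha> \<Longrightarrow> y \<in> adjoin \<alpha> \<Longrightarrow> x * y \<in> adjoin \<alpha>" "x \<in> adjoin \<alpha> \<Longrightarrow> - x \<in> adjoin \<alpha>"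
    "x \<in> adjoin \<alpha> \<Longrightarrow> inverse x \<in> adjoin \<alpha>"
proof -
  let ?R = "ring_of_type_algebra :: 'a alg_closure ring"
  show c: "to_ac c \<in> adjoin \<alpha>" for c unfolding adjoin_def base_field_def by (intro generate_field.incl) auto
  show "\<alpha> \<in> adjoin \<alpha>" unfolding adjoin_def by (intro generate_field.incl) auto
  show "x \<in> adjoin \<alpha> \<Longrightarrow> y \<in> adjoin \<alpha> \<Longrightarrow> x + y \<in> adjoin \<alpha>"
    using generate_field.eng_add[of x ?R "insert \<alpha> base_field" y] unfolding adjoin_def field_ops_type_algebra .
  show "x \<in> adjoin \<alpha> \<Longrightarrow> y \<in> adjoin \<alpha> \<Longrightarrow> x * y \<in> adjoin \<alpha>"
    using generate_field.eng_mult[of x ?R "insert \<alpha> base_field" y] unfolding adjoin_def field_ops_type_algebra .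
  show "x \<in> adjoin \<alpha> \<Longrightarrow> - x \<in> adjoin \<alpha>"
    using generate_field.a_inv[of x ?R "insert \<alpha> base_field"] unfolding adjoin_def field_ops_type_algebra .
  show "x \<in> adjoin \<alpha> \<Longrightarrow> inverse x \<in> adjoin \<alpha>"
    using generate_field.m_inv[of x ?R "insert \<alpha> base_field"] field_ops_type_algebra(6)[of x] c[of 0]
    unfolding adjoin_def field_ops_type_algebra(4) by (cases "x = 0") auto
qed

lemma is_subring_adjoin: "is_subring (adjoin \<alpha>)"
  unfolding is_subring_def using adjoin_closed(1)[of 1 \<alpha>] adjoin_closed(3-5)[of _ \<alpha>] by simp

lemma pe_in_adjoin: "pe p \<alpha> \<in> adjoin \<alpha>"
  by (induction p) (auto simp: pe_0 pe_pCons adjoin_closed intro: is_subringD(2)[OF is_subring_adjoin])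

lemma adjoin_eq: "x \<in> adjoin \<alpha> \<longleftrightarrow> (\<exists>p. x = pe p \<alpha>)"
proof
  assume "x \<in> adjoin \<alpha>"
  then show "\<exists>p. x = pe p \<alpha>"
    unfolding adjoin_def
  proof (induction rule: generate_field.induct)
    case one
    show ?case by (rule exI[of _ 1]) (simp only: field_ops_type_algebra pe_1)
  next
    case (incl h)
    then consider "h = \<alpha>" | c where "h = to_ac c" unfolding base_field_def by auto
    then show ?case
    proof cases
      case 1
      then show ?thesis by (intro exI[of _ "[:0, 1:]"]) (simp add: pe_pCons pe_0)
    next
      case (2 c)
      then show ?thesis by (intro exI[of _ "[:c:]"]) (simp add: pe_pCons pe_0)
    qed
  next
    case (a_inv h)
    then obtain p where "h = pe p \<alpha>" by blast
    then show ?case by (intro exI[of _ "- p"]) (simp add: field_ops_type_algebra pe_minus)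
  next
    case (m_inv h)
    then obtain p where p: "h = pe p \<alpha>" by blast
    have h0: "h \<noteq> 0" using m_inv.hyps(2) by (simp add: field_ops_type_algebra)
    obtain s where "inverse h = pe s h" using inverse_as_polynomial[OF h0] by blast
    then have "inverse h = pe (pcompose s p) \<alpha>" unfolding p by (simp add: pe_pcompose)
    then show ?case using h0 by (auto simp: field_ops_type_algebra)
  next
    case (eng_add h1 h2)
    then show ?case by (auto simp: field_ops_type_algebra pe_add[symmetric])
  next
    case (eng_mult h1 h2)
    then show ?case by (auto simp: field_ops_type_algebra pe_mult[symmetric])
  qed
qed (use pe_in_adjoin in blast)

lemma adjoin_basis_expansion:
  assumes "x \<in> adjoin \<alpha>"
  shows "\<exists>k. x = (\<Sum>i<degree (min_poly \<alpha>). to_ac (k i) * \<alpha> ^ i)"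
proof -
  obtain p where p: "x = pe p \<alpha>" using assms adjoin_eq by blast
  define r where "r = p mod min_poly \<alpha>"
  have "min_poly \<alpha> \<noteq> 0" using min_poly(2)[of \<alpha>] by auto
  then have deg: "degree r < degree (min_poly \<alpha>)"
    using degree_mod_less[of "min_poly \<alpha>" p] degree_min_poly_pos[of \<alpha>] unfolding r_def by auto
  have "pe (p - r) \<alpha> = 0" unfolding min_poly(3) r_def by (simp add: minus_mod_eq_div_mult)
  then have "x = pe r \<alpha>" unfolding p pe_diff by simp
  also have "\<dots> = (\<Sum>i\<le>degree r. to_ac (coeff r i) * \<alpha> ^ i)"
    unfolding pe_def poly_altdef degree_mp by (simp add: coeff_map_poly)
  also have "\<dots> = (\<Sum>i<degree (min_poly \<alpha>). to_ac (coeff r i) * \<alpha> ^ i)"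
    using deg by (intro sum.mono_neutral_left) (auto simp: coeff_eq_0)
  finally show ?thesis by blast
qed

section \<open>The points at infinity\<close>

text \<open>The forms called Y_k in the overview, with \<beta> in the role of the k-th conjugate. On
  a vector over K this is the conjugate at \<beta> of one element of K(\<alpha>).\<close>

definition conj_form :: "nat \<Rightarrow> 'a::field \<Rightarrow> 'a vec \<Rightarrow> 'a" where
  "conj_form n \<beta> x = (\<Sum>i<n. \<beta> ^ i * x $ i)"

definition conj_vec :: "nat \<Rightarrow> 'a::field \<Rightarrow> 'a vec" where
  "conj_vec n \<beta> = vec (n + 1) (\<lambda>i. if i < n then \<beta> ^ i else 0)"

lemma conj_vec_carrier: "conj_vec n \<beta> \<in> carrier_vec (n + 1)"
  by (simp add: conj_vec_def)

lemma lina_conj_vec: "lina n (conj_vec n \<beta>) x = conj_form n \<beta> x"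
  unfolding lina_def conj_vec_def conj_form_def by auto

lemma linf_conj_vec: "linf (n + 1) (conj_vec n \<beta>) x = conj_form n \<beta> x"
  unfolding linf_def conj_vec_def conj_form_def by auto

lemma conj_form_pf: "conj_form n \<beta> \<in> pf n UNIV"
  unfolding conj_form_def by (intro pf_sum pf_smult pf_coord) auto

lemma conj_form_lincomb:
  assumes "n \<le> m" "v \<in> carrier_vec m" "w \<in> carrier_vec m"
  shows "conj_form n \<beta> (v + c \<cdot>\<^sub>v w) = conj_form n \<beta> v + c * conj_form n \<beta> w"
  unfolding conj_form_def using assms by (auto simp: algebra_simps sum.distrib sum_distrib_left intro!: sum.cong)

lemma conj_form_smult:
  assumes "n \<le> m" "v \<in> carrier_vec m"
  shows "conj_form n \<beta> (c \<cdot>\<^sub>v v) = c * conj_form n \<beta> v"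
  unfolding conj_form_def using assms by (auto simp: algebra_simps sum_distrib_left intro!: sum.cong)

text \<open>The entries of \<open>x\<close> are the coefficients of a polynomial of degree less than
  \<open>n\<close> that vanishes at the \<open>n\<close> elements of \<open>B\<close>. So the
  conjugate forms are coordinates.\<close>

lemma vandermonde_zero:
  fixes x :: "'a::field vec"
  assumes "finite B" "card B = n" "\<And>\<beta>. \<beta> \<in> B \<Longrightarrow> conj_form n \<beta> x = 0" "i < n"
  shows "x $ i = 0"
proof (rule ccontr)
  assume xi: "x $ i \<noteq> 0"
  define p where "p = (\<Sum>j<n. monom (x $ j) j)"
  have c: "coeff p j = (if j < n then x $ j else 0)" for j
    unfolding p_def coeff_sum coeff_monom by (simp add: sum.delta)
  have p0: "p \<noteq> 0" using c[of i] xi assms(4) by auto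
  have "degree p < n" using assms(4) c p0 by (intro degree_lessI) auto
  have "poly p \<beta> = conj_form n \<beta> x" for \<beta>
    unfolding p_def conj_form_def by (simp add: poly_sum poly_monom mult.commute)
  then have "B \<subseteq> {\<beta>. poly p \<beta> = 0}" using assms(3) by auto
  then have "n \<le> card {\<beta>. poly p \<beta> = 0}" using card_mono[OF poly_roots_finite[OF p0]] assms(2) by metis
  also have "\<dots> \<le> degree p" by (rule card_poly_roots_bound[OF p0])
  finally show False using \<open>degree p < n\<close> by simp
qed

lemma conj_form_inject:
  fixes x y :: "'a::field vec"
  assumes "finite B" "card B = n" "x \<in> carrier_vec n" "y \<in> carrier_vec n"
    "\<And>\<beta>. \<beta> \<in> B \<Longrightarrow> conj_form n \<beta> x = conj_form n \<beta> y"
  shows "x = y"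
proof (rule eq_vecI)
  fix i assume "i < dim_vec y"
  then have i: "i < n" using assms(4) by simp
  have "conj_form n \<beta> (x + (- 1) \<cdot>\<^sub>v y) = 0" if "\<beta> \<in> B" for \<beta>
    using assms(5)[OF that] by (simp add: conj_form_lincomb[OF order_refl assms(3,4)])
  then have "(x + (- 1) \<cdot>\<^sub>v y) $ i = 0" by (rule vandermonde_zero[OF assms(1,2) _ i])
  then show "x $ i = y $ i" using i assms(3,4) by simp
qed (use assms(3,4) in auto)

text \<open>The coordinates of \<open>dual_vec M \<beta>\<close> are the coefficients of \<open>M(x) / (x - \<beta>)\<close>.\<close>

definition dual_coord :: "'k::field poly \<Rightarrow> nat \<Rightarrow> 'k poly" where
  "dual_coord M i = (\<Sum>r\<le>degree M. if i < r then monom (coeff M r) (r - 1 - i) else 0)"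

definition dual_vec :: "'k::field poly \<Rightarrow> 'k alg_closure \<Rightarrow> 'k alg_closure vec" where
  "dual_vec M \<beta> = vec (degree M + 1) (\<lambda>i. pe (if i < degree M then dual_coord M i else 0) \<beta>)"

lemma dual_vec_carrier: "dual_vec M \<beta> \<in> carrier_vec (degree M + 1)"
  by (simp add: dual_vec_def)

lemma dual_vec_last: "dual_vec M \<beta> $ degree M = 0"
  by (simp add: dual_vec_def pe_0)

text \<open>Evaluating M(X) / (X - \<beta>) at \<gamma> amounts to summing the factorizations of
  \<gamma>^r - \<beta>^r over the terms of \<open>M\<close>. At two different roots of
  \<open>M\<close> the right side is 0, hence so is the form.\<close>

lemma conj_form_dual_vec:
  "(\<gamma> - \<beta>) * conj_form (degree M) \<gamma> (dual_vec M \<beta>) = pe M \<gamma> - pe M \<beta>"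
proof -
  let ?n = "degree M"
  have "conj_form ?n \<gamma> (dual_vec M \<beta>) =
     (\<Sum>i<?n. \<Sum>r\<le>?n. if i < r then to_ac (coeff M r) * (\<gamma> ^ i * \<beta> ^ (r - 1 - i)) else 0)"
    unfolding conj_form_def dual_vec_def dual_coord_def
    by (intro sum.cong) (auto simp: pe_sum sum_distrib_left if_distrib[of "\<lambda>p. pe p \<beta>"] pe_monom pe_0 mult_ac
        if_distrib[of "(*) _"] cong: if_cong intro!: sum.cong)
  also have "\<dots> = (\<Sum>r\<le>?n. \<Sum>i<?n. if i < r then to_ac (coeff M r) * (\<gamma> ^ i * \<beta> ^ (r - 1 - i)) else 0)"
    by (rule sum.swap)
  also have "\<dots> = (\<Sum>r\<le>?n. to_ac (coeff M r) * (\<Sum>i<r. \<gamma> ^ i * \<beta> ^ (r - 1 - i)))"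
  proof (intro sum.cong refl)
    fix r assume "r \<in> {..?n}"
    then have "(\<Sum>i<?n. if i < r then to_ac (coeff M r) * (\<gamma> ^ i * \<beta> ^ (r - 1 - i)) else 0) =
      (\<Sum>i<r. to_ac (coeff M r) * (\<gamma> ^ i * \<beta> ^ (r - 1 - i)))"
      by (intro sum.mono_neutral_cong_right) auto
    then show "(\<Sum>i<?n. if i < r then to_ac (coeff M r) * (\<gamma> ^ i * \<beta> ^ (r - 1 - i)) else 0) =
      to_ac (coeff M r) * (\<Sum>i<r. \<gamma> ^ i * \<beta> ^ (r - 1 - i))" by (simp add: sum_distrib_left)
  qed
  finally have "(\<gamma> - \<beta>) * conj_form ?n \<gamma> (dual_vec M \<beta>) =
     (\<Sum>r\<le>?n. to_ac (coeff M r) * ((\<gamma> - \<beta>) * (\<Sum>i<r. \<gamma> ^ i * \<beta> ^ (r - 1 - i))))"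
    by (simp add: sum_distrib_left mult_ac)
  also have "\<dots> = (\<Sum>r\<le>?n. to_ac (coeff M r) * (\<gamma> ^ r - \<beta> ^ r))"
  proof (intro sum.cong refl arg_cong2[where f = "(*)"])
    fix r show "(\<gamma> - \<beta>) * (\<Sum>i<r. \<gamma> ^ i * \<beta> ^ (r - 1 - i)) = \<gamma> ^ r - \<beta> ^ r"
      using diff_power_eq_sum[of \<gamma> "r - 1" \<beta>] by (cases r) auto
  qed
  also have "\<dots> = pe M \<gamma> - pe M \<beta>"
    unfolding pe_def poly_altdef degree_mp by (simp add: coeff_map_poly right_diff_distrib sum_subtractf)
  finally show ?thesis .
qed

context
  fixes \<alpha> :: "'k::field_char_0 alg_closure" and n :: nat
  assumes n: "n = card (conjugates \<alpha>)"
begin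

private lemma degM: "degree (min_poly \<alpha>) = n"
  unfolding n by (rule card_conjugates[symmetric])

text \<open>The point P_j for the conjugate \<beta>, in explicit homogeneous coordinates. Its
  entries are polynomials over K in \<beta>, so conjugating \<beta> conjugates the point.\<close>

abbreviation inf_vec :: "'k alg_closure \<Rightarrow> 'k alg_closure vec" where
  "inf_vec \<equiv> dual_vec (min_poly \<alpha>)"

lemma inf_vec_carrier: "inf_vec \<beta> \<in> carrier_vec (n + 1)"
  and inf_vec_last: "inf_vec \<beta> $ n = 0"
  using dual_vec_carrier[of "min_poly \<alpha>"] dual_vec_last[of "min_poly \<alpha>"] unfolding degM by auto

lemma conj_form_inf_vec:
  assumes "\<beta> \<in> conjugates \<alpha>" "\<gamma> \<in> conjugates \<alpha>"
  shows "conj_form n \<gamma> (inf_vec \<beta>) = 0 \<longleftrightarrow> \<gamma> \<noteq> \<beta>"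
proof -
  have zero: "conj_form n \<gamma> (inf_vec \<beta>) = 0" if "\<gamma> \<noteq> \<beta>" "\<gamma> \<in> conjugates \<alpha>" for \<gamma>
    using conj_form_dual_vec[of \<gamma> \<beta> "min_poly \<alpha>"] that assms(1) unfolding degM conjugates_iff by auto
  have "conj_form n \<beta> (inf_vec \<beta>) \<noteq> 0"
  proof
    assume "conj_form n \<beta> (inf_vec \<beta>) = 0"
    then have all: "conj_form n \<gamma> (inf_vec \<beta>) = 0" if "\<gamma> \<in> conjugates \<alpha>" for \<gamma>
      by (cases "\<gamma> = \<beta>") (use zero[OF _ that] \<open>conj_form n \<beta> (inf_vec \<beta>) = 0\<close> in auto)
    have npos: "n > 0" using degree_min_poly_pos[of \<alpha>] degM by simp
    \<comment> \<open>The top coefficient of M(X) / (X - \<beta>) is the leading coefficient 1 of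
      the minimal polynomial, so the vector cannot be zero.\<close>
    have "dual_coord (min_poly \<alpha>) (n - 1) = (\<Sum>r\<le>n. if r = n then monom 1 0 else 0)"
      unfolding dual_coord_def degM using npos min_poly(1)[of \<alpha>] degM by (intro sum.cong) auto
    then have "dual_coord (min_poly \<alpha>) (n - 1) = 1" by (simp add: monom_0 one_pCons)
    then have "inf_vec \<beta> $ (n - 1) = 1" using npos by (simp add: dual_vec_def degM pe_1)
    then show False
      using vandermonde_zero[OF finite_conjugates n[symmetric] all, of "n - 1"] npos by simp
  qed
  then show ?thesis using zero assms by blast
qed

lemma inf_vec_nonzero: "\<beta> \<in> conjugates \<alpha> \<Longrightarrow> inf_vec \<beta> \<noteq> 0\<^sub>v (n + 1)"
  using conj_form_inf_vec[of \<beta> \<beta>] by (auto simp: conj_form_def)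

lemma inf_vec_not_proportional:
  assumes "\<beta> \<in> conjugates \<alpha>" "\<gamma> \<in> conjugates \<alpha>" "\<beta> \<noteq> \<gamma>"
  shows "inf_vec \<beta> \<noteq> c \<cdot>\<^sub>v inf_vec \<gamma>"
proof
  assume "inf_vec \<beta> = c \<cdot>\<^sub>v inf_vec \<gamma>"
  then have "conj_form n \<beta> (inf_vec \<beta>) = c * conj_form n \<beta> (inf_vec \<gamma>)"
    using conj_form_smult[OF _ inf_vec_carrier, of n \<beta> c \<gamma>] by simp
  then show False using conj_form_inf_vec[of \<beta> \<beta>] conj_form_inf_vec[of \<gamma> \<beta>] assms by simp
qed

lemma point_at_infinity_eq:
  assumes as: "bij_betw as {1..n} (conjugates \<alpha>)" and j: "j \<in> {1..n}"
  shows "point_at_infinity n as j = proj_point (inf_vec (as j))"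
proof -
  have asj: "as k \<in> conjugates \<alpha>" if "k \<in> {1..n}" for k using as that bij_betwE by blast
  have inj: "as k \<noteq> as j" if "k \<in> {1..n}" "k \<noteq> j" for k
    using as that j unfolding bij_betw_def inj_on_def by blast
  let ?v = "inf_vec (as j)"
  let ?a = "\<lambda>k. vec (n + 1) (\<lambda>i. if i < n then as k ^ i else 0)"
  have hyp: "proj_point w \<in> proj_hyperplane n a \<longleftrightarrow> linf (n + 1) a w = 0"
    if w: "w \<in> carrier_vec (n + 1)" "w \<noteq> 0\<^sub>v (n + 1)" and a: "a \<in> carrier_vec (n + 1)" for w a
  proof -
    have self: "w \<in> proj_point w" unfolding proj_point_def by (auto intro!: exI[of _ 1])
    have "(\<forall>v\<in>proj_point w. a \<bullet> v = 0) \<longleftrightarrow> linf (n + 1) a w = 0"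
    proof
      assume "\<forall>v\<in>proj_point w. a \<bullet> v = 0"
      then show "linf (n + 1) a w = 0" using self linf_scalar_prod[OF w(1)] by metis
    next
      assume "linf (n + 1) a w = 0"
      then show "\<forall>v\<in>proj_point w. a \<bullet> v = 0"
        unfolding proj_point_def using linf_scalar_prod[OF w(1), of a] scalar_prod_smult_right[of a w] a w(1) by auto
    qed
    moreover have "proj_point w \<in> proj_space n" unfolding proj_space_def using w by blast
    ultimately show ?thesis unfolding proj_hyperplane_def by blast
  qed
  have u: "unit_vec (n + 1) n \<in> carrier_vec (n + 1)" by simp
  have ak: "?a k \<in> carrier_vec (n + 1)" for k by simp
  note v = inf_vec_carrier[of "as j"] inf_vec_nonzero[OF asj[OF j]]
  have cf: "linf (n + 1) (?a k) w = conj_form n (as k) w" for k w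
    using linf_conj_vec[of n "as k" w] unfolding conj_vec_def .
  show ?thesis unfolding point_at_infinity_def
  proof (rule the_equality)
    show "proj_point ?v \<in> proj_hyperplane n (unit_vec (n + 1) n) \<and>
             (\<forall>k\<in>{1..n} - {j}. proj_point ?v \<in> proj_hyperplane n (?a k))"
      unfolding hyp[OF v u] hyp[OF v ak] cf linf_unit_last
      using inf_vec_last conj_form_inf_vec[OF asj[OF j] asj] inj by auto
  next
    fix Q assume Q: "Q \<in> proj_hyperplane n (unit_vec (n + 1) n) \<and> (\<forall>k\<in>{1..n} - {j}. Q \<in> proj_hyperplane n (?a k))"
    then obtain w where w: "Q = proj_point w" "w \<in> carrier_vec (n + 1)" "w \<noteq> 0\<^sub>v (n + 1)"
      unfolding proj_hyperplane_def proj_space_def by blast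
    have w1: "w $ n = 0" "\<And>k. k \<in> {1..n} - {j} \<Longrightarrow> conj_form n (as k) w = 0"
      using Q unfolding w(1) hyp[OF w(2,3) u] hyp[OF w(2,3) ak] cf linf_unit_last by auto
    \<comment> \<open>With this \<open>c\<close> the remaining form also vanishes on the difference,
      and then the Vandermonde argument makes the difference zero.\<close>
    define c where "c = conj_form n (as j) w / conj_form n (as j) ?v"
    have "conj_form n \<beta> (w + (- c) \<cdot>\<^sub>v ?v) = 0" if "\<beta> \<in> conjugates \<alpha>" for \<beta>
    proof -
      have "\<beta> \<in> as ` {1..n}" using as that by (simp add: bij_betw_def)
      then obtain k where k: "k \<in> {1..n}" "\<beta> = as k" by blast
      have "conj_form n \<beta> (w + (- c) \<cdot>\<^sub>v ?v) = conj_form n \<beta> w - c * conj_form n \<beta> ?v"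
        using conj_form_lincomb[OF _ w(2) v(1), of n \<beta> "- c"] by simp
      then show ?thesis
        using w1(2)[of k] k conj_form_inf_vec[OF asj[OF j] asj[OF k(1)]] inj[OF k(1)] unfolding c_def
        by (cases "k = j") auto
    qed
    then have zero: "(w + (- c) \<cdot>\<^sub>v ?v) $ i = 0" if "i < n" for i
      by (rule vandermonde_zero[OF finite_conjugates n[symmetric] _ that])
    have wc: "w = c \<cdot>\<^sub>v ?v"
    proof (rule eq_vecI)
      fix i assume i: "i < dim_vec (c \<cdot>\<^sub>v ?v)"
      then have "i < n \<or> i = n" using v(1) by auto
      then show "w $ i = (c \<cdot>\<^sub>v ?v) $ i"
        using zero[of i] w1(1) inf_vec_last[of "as j"] w(2) v(1) by auto
    qed (use w(2) v(1) in auto)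
    then have c0: "c \<noteq> 0" using w(3) v(1) by auto
    show "Q = proj_point ?v"
      unfolding w(1) wc proj_point_def
    proof (intro equalityI subsetI; elim CollectE exE conjE)
      fix z b assume "z = b \<cdot>\<^sub>v (c \<cdot>\<^sub>v ?v)" "b \<noteq> 0"
      then show "z \<in> {c \<cdot>\<^sub>v ?v | c. c \<noteq> 0}" using c0 by (auto intro!: exI[of _ "b * c"] simp: smult_smult_assoc)
    next
      fix z b assume "z = b \<cdot>\<^sub>v ?v" "b \<noteq> 0"
      then show "z \<in> {b \<cdot>\<^sub>v (c \<cdot>\<^sub>v ?v) | b. b \<noteq> 0}" using c0 by (auto intro!: exI[of _ "b / c"] simp: smult_smult_assoc)
    qed
  qed
qed

text \<open>Expanding the coefficients of a form in a basis over the base field replaces automorphisms.\<close>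

lemma in_closure_conjugate:
  fixes S D :: "'k alg_closure vec set"
  assumes D: "D \<subseteq> carrier_vec n" and S: "S \<subseteq> D" "\<And>x i. x \<in> S \<Longrightarrow> i < n \<Longrightarrow> x $ i \<in> base_field"
    and dense: "\<And>f. f \<in> pf n UNIV \<Longrightarrow> \<forall>x\<in>S. f x = 0 \<Longrightarrow> \<forall>x\<in>D. f x = 0"
    and conj: "\<beta> \<in> conjugates \<alpha>" "\<gamma> \<in> conjugates \<alpha>" and cl: "in_closure n D (inf_vec \<beta>)"
  shows "in_closure n D (inf_vec \<gamma>)"
  unfolding in_closure_def
proof (intro allI ballI impI)
  fix d and f :: "'k alg_closure vec \<Rightarrow> 'k alg_closure"
  assume f: "f \<in> pf (n + 1) {d}" and f0: "\<forall>x\<in>D. f (append_one x) = 0"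
  interpret V: vector_space "\<lambda>(c :: 'k) (x :: 'k alg_closure). to_ac c * x"
    by unfold_locales (auto simp: algebra_simps)
  \<comment> \<open>A basis of the algebraic closure as a vector space over K; \<open>l b\<close> is
    the coordinate at \<open>b\<close>.\<close>
  define B where "B = V.extend_basis {}"
  have B: "V.independent B" "V.span B = UNIV"
    unfolding B_def by (rule V.independent_extend_basis V.span_extend_basis; rule V.independent_empty)+
  define l where "l b x = V.representation B x b" for b x
  have l_add: "l b (x + y) = l b x + l b y" for b x y
    unfolding l_def using V.representation_add[OF B(1)] B(2) by auto
  have l_scale: "l b (x * to_ac c) = l b x * c" for b x c
  proof -
    have "l b (to_ac c * x) = c * l b x"
      unfolding l_def by (subst V.representation_scale[OF B(1)]) (simp_all add: B(2))
    then show ?thesis by (simp add: mult.commute[of x] mult.commute[of _ c])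
  qed
  have l_sum: "l b (sum g A) = (\<Sum>a\<in>A. l b (g a))" if "finite A" for b A and g :: "(nat \<Rightarrow>\<^sub>0 nat) \<Rightarrow> 'k alg_closure"
    using that
  proof (induction A rule: finite_induct)
    case empty
    have "l b 0 = 0" using l_add[of b 0 0] by simp
    then show ?case by simp
  qed (simp add: l_add)
  obtain M c where M: "finite M" "\<forall>m\<in>M. Poly_Mapping.keys m \<subseteq> {..<n + 1} \<and> mono_deg m \<in> {d}"
     "f = (\<lambda>x. \<Sum>m\<in>M. c m * mono_val m x)" using pf_sumD[OF f] by blast
  \<comment> \<open>The coordinate of the form \<open>f\<close> at \<open>b\<close>: a form of the
    same degree with coefficients in K.\<close>
  define g where "g b v = (\<Sum>m\<in>M. to_ac (l b (c m)) * mono_val m v)" for b v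
  have g_pf: "g b \<in> pf (n + 1) {d}" for b unfolding g_def using M by (intro pf_sum pf_mono_val) auto
  have g_zero: "g b (append_one x) = 0" if x: "x \<in> D" for b x
  proof -
    obtain h where h: "h \<in> pf n UNIV" "\<forall>x\<in>carrier_vec n. h x = g b (append_one x)"
      using pf_append_one[of "g b" n] pf_subset[OF _ g_pf] by blast
    have "h y = 0" if y: "y \<in> S" for y
    proof -
      have yc: "y \<in> carrier_vec n" using y S D by blast
      have "\<exists>k. mono_val m (append_one y) = to_ac k" if "m \<in> M" for m
      proof -
        have "\<forall>i. \<exists>k. i \<le> n \<longrightarrow> append_one y $ i = to_ac k"
        proof
          fix i
          show "\<exists>k. i \<le> n \<longrightarrow> append_one y $ i = to_ac k"
            using S(2)[OF y, of i] append_one_index[OF yc, of i] unfolding base_field_def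
            by (cases "i < n") (auto intro: exI[of _ 1])
        qed
        then obtain k where k: "\<And>i. i \<le> n \<Longrightarrow> append_one y $ i = to_ac (k i)" by metis
        have "mono_val m (append_one y) = to_ac (\<Prod>i\<in>Poly_Mapping.keys m. k i ^ Poly_Mapping.lookup m i)"
          unfolding mono_val_def to_ac_prod to_ac_power using M(2) that k
          by (intro prod.cong refl arg_cong2[where f = "(^)"]) (auto simp: subset_eq less_Suc_eq_le)
        then show ?thesis by blast
      qed
      then obtain k where k: "\<And>m. m \<in> M \<Longrightarrow> mono_val m (append_one y) = to_ac (k m)" by metis
      \<comment> \<open>At a point over K all monomials have values in K, so the coordinates of the
        value of \<open>f\<close> are the values of the forms \<open>g b\<close>. They vanish
        separately, and by density on all of \<open>D\<close>.\<close>
      have "l b (f (append_one y)) = (\<Sum>m\<in>M. l b (c m) * k m)"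
        unfolding M(3) l_sum[OF M(1)] using k by (intro sum.cong) (auto simp: l_scale)
      moreover have "l b (f (append_one y)) = 0" using f0 y S(1) l_add[of b 0 0] by auto
      ultimately have "to_ac (\<Sum>m\<in>M. l b (c m) * k m) = 0" by simp
      then have "g b (append_one y) = 0" unfolding g_def using k by (simp add: to_ac_sum)
      then show "h y = 0" using h(2) yc by simp
    qed
    then have "h x = 0" using dense[OF h(1)] x by blast
    then show ?thesis using h(2) x D by auto
  qed
  have "\<exists>W. \<forall>\<delta>. mono_val m (inf_vec \<delta>) = pe W \<delta>" if m: "m \<in> M" for m
  proof -
    have "mono_val m (inf_vec \<delta>) =
      pe (\<Prod>i\<in>Poly_Mapping.keys m. (if i < n then dual_coord (min_poly \<alpha>) i else 0) ^ Poly_Mapping.lookup m i) \<delta>" for \<delta>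
      unfolding mono_val_def pe_prod pe_power using M(2) m
      by (intro prod.cong refl arg_cong2[where f = "(^)"]) (auto simp: dual_vec_def degM subset_eq)
    then show ?thesis by blast
  qed
  then obtain W where W: "\<And>m \<delta>. m \<in> M \<Longrightarrow> mono_val m (inf_vec \<delta>) = pe (W m) \<delta>" by metis
  \<comment> \<open>The value of a form over K at the point of a conjugate is a polynomial over K in
    that conjugate, to which the transfer between conjugates applies.\<close>
  have g_val: "g b (inf_vec \<delta>) = pe (\<Sum>m\<in>M. smult (l b (c m)) (W m)) \<delta>" for b \<delta>
    unfolding g_def pe_sum pe_smult using W by (intro sum.cong) auto
  have "g b (inf_vec \<beta>) = 0" for b using in_closureD[OF cl g_pf g_zero] .
  then have g\<gamma>: "g b (inf_vec \<gamma>) = 0" for b unfolding g_val using conjugate_zero_iff[OF conj] by blast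
  define B' where "B' = (\<Union>m\<in>M. {b. l b (c m) \<noteq> 0})"
  have B'fin: "finite B'" unfolding B'_def l_def using M(1) V.finite_representation by auto
  have expand: "c m = (\<Sum>b\<in>B'. to_ac (l b (c m)) * b)" if m: "m \<in> M" for m
  proof -
    have "c m = (\<Sum>b | V.representation B (c m) b \<noteq> 0. to_ac (V.representation B (c m) b) * b)"
      using V.sum_nonzero_representation_eq[OF B(1), of "c m"] B(2) by simp
    also have "\<dots> = (\<Sum>b\<in>B'. to_ac (l b (c m)) * b)"
      using m B'fin unfolding l_def B'_def by (intro sum.mono_neutral_left) auto
    finally show ?thesis .
  qed
  have "f (inf_vec \<gamma>) = (\<Sum>m\<in>M. \<Sum>b\<in>B'. to_ac (l b (c m)) * b * mono_val m (inf_vec \<gamma>))"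
    unfolding M(3) sum_distrib_right[symmetric] using expand by (intro sum.cong refl) auto
  also have "\<dots> = (\<Sum>b\<in>B'. \<Sum>m\<in>M. to_ac (l b (c m)) * b * mono_val m (inf_vec \<gamma>))" by (rule sum.swap)
  also have "\<dots> = (\<Sum>b\<in>B'. b * g b (inf_vec \<gamma>))"
    unfolding g_def sum_distrib_left by (intro sum.cong refl) (simp add: mult_ac)
  also have "\<dots> = 0" using g\<gamma> by simp
  finally show "f (inf_vec \<gamma>) = 0" .
qed

end

section \<open>Conjugating rational parametrizations\<close>

lemma sum_Fract_common:
  fixes q :: "'a::field poly" and n :: nat
  assumes "q \<noteq> 0"
  shows "(\<Sum>i<n. Fract (A i) q * to_fract [:c i:]) = Fract (\<Sum>i<n. smult (c i) (A i)) q"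
proof (induction n)
  case 0
  then show ?case using assms by (simp add: Zero_fract_def eq_fract)
next
  case (Suc n)
  have "Fract x q + Fract y q = Fract (x + y) q" for x y
    using assms by (simp add: eq_fract algebra_simps)
  moreover have "Fract (A n) q * to_fract [:c n:] = Fract (smult (c n) (A n)) q"
    by (simp add: to_fract_def)
  ultimately show ?case using Suc by simp
qed

text \<open>The expansion of the unit in powers of \<alpha> survives when \<alpha> is replaced by a
  conjugate, also in the coefficients of the unit. For a parameter in K the cleared identity is a
  polynomial relation over K for \<alpha>, hence holds at \<beta>; infinitely many such parameters
  determine it.\<close>

lemma unit_conjugates:
  fixes \<alpha> :: "'k::field_char_0 alg_closure"
  assumes \<phi>: "\<And>i. i < n \<Longrightarrow> \<phi> i \<in> ratfuns base_field"
    and u: "Fract [:pe b \<alpha>, pe a \<alpha>:] [:pe d \<alpha>, pe c \<alpha>:] = (\<Sum>i<n. \<phi> i * to_fract [:\<alpha> ^ i:])"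
    and nz: "[:pe d \<alpha>, pe c \<alpha>:] \<noteq> 0"
  shows "\<exists>p q. q \<noteq> 0 \<and> (\<forall>i<n. \<phi> i = Fract (mp (p i)) (mp q)) \<and>
    (\<forall>\<beta>\<in>conjugates \<alpha>. (\<Sum>i<n. smult (\<beta> ^ i) (mp (p i))) * [:pe d \<beta>, pe c \<beta>:] = mp q * [:pe b \<beta>, pe a \<beta>:])"
proof -
  have lift: "\<exists>p'. p = mp p'" if "set (Polynomial.coeffs p) \<subseteq> base_field" for p :: "'k alg_closure poly"
  proof -
    have "coeff p i \<in> range to_ac" for i
      using that range_coeff[of p] unfolding base_field_def by (auto simp: image_iff) (metis rangeI to_ac_0 insertE subsetD rangeE)
    then have "p = mp (map_poly of_ac p)"
      by (intro poly_eqI) (simp add: coeff_map_poly to_ac_of_ac)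
    then show ?thesis by blast
  qed
  have "\<forall>i. \<exists>p q. i < n \<longrightarrow> \<phi> i = Fract (mp p) (mp q) \<and> q \<noteq> 0"
  proof
    fix i show "\<exists>p q. i < n \<longrightarrow> \<phi> i = Fract (mp p) (mp q) \<and> q \<noteq> 0"
      using \<phi>[of i] lift unfolding ratfuns_def by (auto simp: mp_eq_0) (metis mp_eq_0)
  qed
  then obtain P Q where PQ: "\<And>i. i < n \<Longrightarrow> \<phi> i = Fract (mp (P i)) (mp (Q i)) \<and> Q i \<noteq> 0" by metis
  define q where "q = (\<Prod>i<n. Q i)"
  define p where "p i = P i * (\<Prod>j\<in>{..<n} - {i}. Q j)" for i
  have q0: "q \<noteq> 0" unfolding q_def using PQ by auto
  have \<phi>eq: "\<phi> i = Fract (mp (p i)) (mp q)" if i: "i < n" for i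
  proof -
    have "q = Q i * (\<Prod>j\<in>{..<n} - {i}. Q j)" unfolding q_def using i by (intro prod.remove) auto
    then show ?thesis using PQ[OF i] q0 unfolding p_def by (simp add: eq_fract mp_eq_0 mp_mult mult_ac)
  qed
  have main: "(\<Sum>i<n. smult (\<alpha> ^ i) (mp (p i))) * [:pe d \<alpha>, pe c \<alpha>:] = mp q * [:pe b \<alpha>, pe a \<alpha>:]"
  proof -
    have "Fract [:pe b \<alpha>, pe a \<alpha>:] [:pe d \<alpha>, pe c \<alpha>:] = Fract (\<Sum>i<n. smult (\<alpha> ^ i) (mp (p i))) (mp q)"
      unfolding u using q0 \<phi>eq by (subst sum_Fract_common[symmetric]) (auto simp: mp_eq_0)
    then show ?thesis using nz q0 by (simp add: eq_fract mp_eq_0 mult_ac)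
  qed
  \<comment> \<open>\<open>R \<tau>\<close> is the polynomial over K whose value at a conjugate is
    the defect \<open>E\<close> of the identity there, at the parameter \<tau>.\<close>
  define R where "R \<tau> = (\<Sum>i<n. monom (poly (p i) \<tau>) i) * (d + smult \<tau> c) - smult (poly q \<tau>) (b + smult \<tau> a)" for \<tau>
  define E where "E \<beta> = (\<Sum>i<n. smult (\<beta> ^ i) (mp (p i))) * [:pe d \<beta>, pe c \<beta>:] - mp q * [:pe b \<beta>, pe a \<beta>:]" for \<beta>
  have R: "pe (R \<tau>) \<beta> = poly (E \<beta>) (to_ac \<tau>)" for \<tau> \<beta>
    unfolding R_def E_def by (simp add: pe_diff pe_mult pe_sum pe_add pe_smult pe_monom poly_sum poly_mp_to_ac algebra_simps)
  have "E \<beta> = 0" if \<beta>: "\<beta> \<in> conjugates \<alpha>" for \<beta>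
  proof (rule ccontr)
    assume "E \<beta> \<noteq> 0"
    then have "finite {t. poly (E \<beta>) t = 0}" by (rule poly_roots_finite)
    moreover have "range to_ac \<subseteq> {t. poly (E \<beta>) t = 0}"
    proof
      fix t :: "'k alg_closure" assume "t \<in> range to_ac"
      then obtain \<tau> where t: "t = to_ac \<tau>" by blast
      have "poly (E \<alpha>) t = 0" using main unfolding E_def by simp
      then have "pe (R \<tau>) \<beta> = 0" using conjugate_zero_iff[OF \<beta> self_conjugate] unfolding t R[symmetric] by blast
      then show "t \<in> {t. poly (E \<beta>) t = 0}" unfolding R t by simp
    qed
    ultimately have "finite (range (to_ac :: 'k \<Rightarrow> _))" using finite_subset by blast
    then show False using finite_imageD[OF _ inj_to_ac] infinite_UNIV_char_0 by blast
  qed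
  then show ?thesis using q0 \<phi>eq unfolding E_def by (intro exI[of _ p] exI[of _ q]) auto
qed

text \<open>Synthetic division: the coefficients of the quotient are obtained from the top downwards
  without any division.\<close>

lemma linear_quotient_over:
  assumes R: "is_subring R" "\<gamma> \<in> R" and w: "[:- \<gamma>, 1:] * w \<in> polys_over R"
  shows "w \<in> polys_over R"
proof (rule polys_overI)
  fix i
  show "coeff w i \<in> R"
  proof (induction "Suc (degree w) - i" arbitrary: i rule: less_induct)
    case less
    show ?case
    proof (cases "i > degree w")
      case True
      then show ?thesis using is_subringD(2)[OF R(1)] by (simp add: coeff_eq_0)
    next
      case False
      then have "coeff w (Suc i) \<in> R" by (intro less) simp
      moreover have "coeff ([:- \<gamma>, 1:] * w) (Suc i) \<in> R" using w by (rule polys_overD)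
      moreover have "coeff w i = coeff ([:- \<gamma>, 1:] * w) (Suc i) + \<gamma> * coeff w (Suc i)" by simp
      ultimately show ?thesis using R by (metis is_subringD(3,4))
    qed
  qed
qed

text \<open>The denominator is rationalized: it is extended to the minimal polynomial of the pole,
  which lies over K, while the numerator stays over K(\<alpha>) and its coefficients are expanded in
  powers of \<alpha>.\<close>

lemma unit_decomposition:
  fixes \<alpha> :: "'k::field_char_0 alg_closure"
  assumes n: "n = card (conjugates \<alpha>)" and L: "a \<in> adjoin \<alpha>" "b \<in> adjoin \<alpha>" "c \<in> adjoin \<alpha>" "d \<in> adjoin \<alpha>" and c: "c \<noteq> 0"
  shows "\<exists>\<phi>. (\<forall>i<n. \<phi> i \<in> ratfuns base_field) \<and> Fract [:b, a:] [:d, c:] = (\<Sum>i<n. \<phi> i * to_fract [:\<alpha> ^ i:])"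
proof -
  note sub = is_subring_adjoin[of \<alpha>]
  \<comment> \<open>The pole of the unit, finite because \<open>c\<close> is nonzero.\<close>
  define \<gamma> where "\<gamma> = - (d * inverse c)"
  have \<gamma>: "\<gamma> \<in> adjoin \<alpha>" unfolding \<gamma>_def by (intro adjoin_closed L)
  define m where "m = min_poly \<gamma>"
  have m0: "mp m \<noteq> 0" unfolding m_def mp_eq_0 using min_poly(2)[of \<gamma>] by auto
  have "poly (mp m) \<gamma> = 0" using min_poly(3)[of m \<gamma>] unfolding m_def pe_def by simp
  then obtain w where w: "mp m = [:- \<gamma>, 1:] * w" unfolding poly_eq_0_iff_dvd by (elim dvdE)
  have "mp m \<in> polys_over (adjoin \<alpha>)" by (rule polys_overI) (simp add: coeff_map_poly adjoin_closed)
  then have wL: "w \<in> polys_over (adjoin \<alpha>)" unfolding w by (rule linear_quotient_over[OF sub \<gamma>])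
  define N where "N = [:b, a:] * smult (inverse c) w"
  have NL: "N \<in> polys_over (adjoin \<alpha>)" unfolding N_def
    by (intro polys_over_ring[OF sub] adjoin_closed L wL)
  have dc: "[:d, c:] = smult c [:- \<gamma>, 1:]" unfolding \<gamma>_def using c by simp
  have "N * [:d, c:] = smult (inverse c * c) ([:b, a:] * ([:- \<gamma>, 1:] * w))"
    unfolding N_def dc by (simp only: mult_smult_left mult_smult_right smult_smult mult_ac)
  then have "[:b, a:] * mp m = N * [:d, c:]" unfolding w using c by simp
  then have frac: "Fract [:b, a:] [:d, c:] = Fract N (mp m)" using c m0 by (simp add: eq_fract)
  have "\<forall>r. \<exists>k. coeff N r = (\<Sum>i<n. to_ac (k i) * \<alpha> ^ i)"
    using adjoin_basis_expansion[OF polys_overD[OF NL]] unfolding n card_conjugates by blast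
  then obtain k where k: "\<And>r. coeff N r = (\<Sum>i<n. to_ac (k r i) * \<alpha> ^ i)" by metis
  define p where "p i = (\<Sum>r\<le>degree N. monom (k r i) r)" for i
  have "N = (\<Sum>i<n. smult (\<alpha> ^ i) (mp (p i)))"
  proof (rule poly_eqI)
    fix r
    show "coeff N r = coeff (\<Sum>i<n. smult (\<alpha> ^ i) (mp (p i))) r"
    proof (cases "r \<le> degree N")
      case True
      have "coeff (mp (p i)) r = to_ac (k r i)" for i
        using True unfolding p_def by (simp add: coeff_map_poly coeff_sum sum.delta)
      then show ?thesis by (simp add: coeff_sum k mult.commute)
    next
      case False
      have "coeff (mp (p i)) r = 0" for i
        using False unfolding p_def by (simp add: coeff_map_poly coeff_sum sum.delta)
      then show ?thesis using False by (simp add: coeff_sum coeff_eq_0)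
    qed
  qed
  then have "Fract [:b, a:] [:d, c:] = (\<Sum>i<n. Fract (mp (p i)) (mp m) * to_fract [:\<alpha> ^ i:])"
    unfolding frac sum_Fract_common[OF m0] by simp
  moreover have "set (Polynomial.coeffs (mp f)) \<subseteq> base_field" for f :: "'k poly"
    using range_coeff[of "mp f"] by (auto simp: base_field_def coeff_map_poly image_iff set_eq_iff)
  then have "Fract (mp (p i)) (mp m) \<in> ratfuns base_field" for i
    unfolding ratfuns_def using m0 by blast
  ultimately show ?thesis by (intro exI[of _ "\<lambda>i. Fract (mp (p i)) (mp m)"]) simp
qed

section \<open>Hypercircles\<close>

text \<open>Lagrange interpolation: up to the factor \<open>?N \<beta>\<close>, the vectors at
  infinity form the basis dual to the conjugate forms.\<close>

lemma conj_form_interpolation: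
  fixes \<alpha> :: "'k::field_char_0 alg_closure"
  assumes n: "n = card (conjugates \<alpha>)" and x: "x \<in> carrier_vec n" and i: "i < n"
  shows "x $ i = (\<Sum>\<beta>\<in>conjugates \<alpha>. conj_form n \<beta> x * (inf_vec \<alpha> \<beta> $ i / conj_form n \<beta> (inf_vec \<alpha> \<beta>)))"
proof -
  let ?N = "\<lambda>\<beta>. conj_form n \<beta> (inf_vec \<alpha> \<beta>)"
  define y where "y = vec n (\<lambda>i. \<Sum>\<beta>\<in>conjugates \<alpha>. conj_form n \<beta> x * (inf_vec \<alpha> \<beta> $ i / ?N \<beta>))"
  have "conj_form n \<gamma> y = conj_form n \<gamma> x" if \<gamma>: "\<gamma> \<in> conjugates \<alpha>" for \<gamma>
  proof -
    have "conj_form n \<gamma> y = (\<Sum>i<n. \<gamma> ^ i * y $ i)" by (rule conj_form_def)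
    also have "\<dots> = (\<Sum>i<n. \<Sum>\<beta>\<in>conjugates \<alpha>. conj_form n \<beta> x / ?N \<beta> * (\<gamma> ^ i * inf_vec \<alpha> \<beta> $ i))"
      unfolding y_def by (intro sum.cong) (auto simp: sum_distrib_left intro!: sum.cong)
    also have "\<dots> = (\<Sum>\<beta>\<in>conjugates \<alpha>. conj_form n \<beta> x / ?N \<beta> * conj_form n \<gamma> (inf_vec \<alpha> \<beta>))"
      unfolding sum.swap[of _ "{..<n}"] conj_form_def[of n \<gamma> "inf_vec \<alpha> _"] sum_distrib_left ..
    also have "\<dots> = (\<Sum>\<beta>\<in>conjugates \<alpha>. if \<beta> = \<gamma> then conj_form n \<gamma> x else 0)"
      using conj_form_inf_vec[OF n _ \<gamma>] by (intro sum.cong) auto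
    finally show ?thesis using \<gamma> finite_conjugates[of \<alpha>] by simp
  qed
  then have "y = x" using x unfolding y_def
    by (intro conj_form_inject[OF finite_conjugates n[symmetric]]) auto
  then show ?thesis using i unfolding y_def by (metis (no_types, lifting) index_vec)
qed

section \<open>Parametrized hypercircles, their poles and their points at infinity\<close>

lemma pf_rational_curve:
  fixes q :: "'a::field poly"
  assumes "f \<in> pf n UNIV"
  shows "\<exists>M r. \<forall>t. poly q t \<noteq> 0 \<longrightarrow> f (vec n (\<lambda>i. poly (p i) t / poly q t)) * poly q t ^ M = poly r t"
proof -
  obtain Ms c where f: "finite Ms" "\<forall>m\<in>Ms. Poly_Mapping.keys m \<subseteq> {..<n} \<and> mono_deg m \<in> UNIV"
     "f = (\<lambda>x. \<Sum>m\<in>Ms. c m * mono_val m x)" using pf_sumD[OF assms] by blast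
  define M where "M = Max (mono_deg ` Ms)"
  have M: "mono_deg m \<le> M" if "m \<in> Ms" for m unfolding M_def using f(1) that by (intro Max_ge) auto
  define r where "r = (\<Sum>m\<in>Ms. smult (c m) ((\<Prod>i\<in>Poly_Mapping.keys m. p i ^ Poly_Mapping.lookup m i) * q ^ (M - mono_deg m)))"
  have "f (vec n (\<lambda>i. poly (p i) t / poly q t)) * poly q t ^ M = poly r t" if qt: "poly q t \<noteq> 0" for t
  proof -
    have "mono_val m (vec n (\<lambda>i. poly (p i) t / poly q t)) * poly q t ^ M =
       (\<Prod>i\<in>Poly_Mapping.keys m. poly (p i) t ^ Poly_Mapping.lookup m i) * poly q t ^ (M - mono_deg m)"
      if m: "m \<in> Ms" for m
    proof -
      have "mono_val m (vec n (\<lambda>i. poly (p i) t / poly q t)) =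
         (\<Prod>i\<in>Poly_Mapping.keys m. poly (p i) t ^ Poly_Mapping.lookup m i / poly q t ^ Poly_Mapping.lookup m i)"
        unfolding mono_val_def using f(2) m by (intro prod.cong) (auto simp: power_divide subset_eq)
      also have "\<dots> = (\<Prod>i\<in>Poly_Mapping.keys m. poly (p i) t ^ Poly_Mapping.lookup m i) / poly q t ^ mono_deg m"
        unfolding prod_dividef mono_deg_def power_sum ..
      finally have eq: "mono_val m (vec n (\<lambda>i. poly (p i) t / poly q t)) =
        (\<Prod>i\<in>Poly_Mapping.keys m. poly (p i) t ^ Poly_Mapping.lookup m i) / poly q t ^ mono_deg m" .
      have "poly q t ^ M = poly q t ^ (M - mono_deg m) * poly q t ^ mono_deg m" using M[OF m] by (simp flip: power_add)
      then show ?thesis unfolding eq using qt by simp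
    qed
    then show ?thesis unfolding f(3) r_def
      by (simp add: poly_sum poly_prod sum_distrib_right mult.assoc)
  qed
  then show ?thesis by blast
qed

text \<open>The unit has the coefficients \<open>pe a \<alpha>\<close> and so on, and its conjugate
  at \<beta> arises by evaluating at \<beta>. The last assumption says that the form of \<beta> on
  the parametrized point is this conjugate unit, with denominators cleared.\<close>

locale unit_param =
  fixes \<alpha> :: "'k::field_char_0 alg_closure" and n :: nat
    and a b c d q :: "'k poly" and p :: "nat \<Rightarrow> 'k poly" and \<phi> :: "nat \<Rightarrow> 'k alg_closure poly fract"
  assumes n: "n = card (conjugates \<alpha>)"
    and det: "pe (a * d - b * c) \<alpha> \<noteq> 0"
    and q: "q \<noteq> 0"
    and \<phi>: "\<And>i. i < n \<Longrightarrow> \<phi> i = Fract (mp (p i)) (mp q)"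
    and conj: "\<And>\<beta>. \<beta> \<in> conjugates \<alpha> \<Longrightarrow>
      (\<Sum>i<n. smult (\<beta> ^ i) (mp (p i))) * [:pe d \<beta>, pe c \<beta>:] = mp q * [:pe b \<beta>, pe a \<beta>:]"
begin

definition img :: "'k alg_closure vec set" where
  "img = {x \<in> carrier_vec n. \<exists>t. \<forall>i<n. ratfun_value (\<phi> i) t (x $ i)}"

definition Z :: "'k alg_closure \<Rightarrow> 'k alg_closure vec" where
  "Z t = vec n (\<lambda>i. poly (mp (p i)) t / poly (mp q) t)"

definition good :: "'k alg_closure set" where
  "good = {t. poly (mp q) t \<noteq> 0}"

lemma det_conj: "\<beta> \<in> conjugates \<alpha> \<Longrightarrow> pe a \<beta> * pe d \<beta> - pe b \<beta> * pe c \<beta> \<noteq> 0"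
  using conjugate_zero_iff[OF _ self_conjugate, of \<beta> \<alpha> "a * d - b * c"] det by (simp add: pe_diff pe_mult)

lemma finite_bad: "finite (- good)"
  unfolding good_def using poly_roots_finite[of "mp q"] q by (simp add: mp_eq_0 Collect_neg_eq)

lemma Z_carrier: "Z t \<in> carrier_vec n"
  by (simp add: Z_def)

lemma Z_img: "t \<in> good \<Longrightarrow> Z t \<in> img"
  unfolding img_def ratfun_value_def good_def Z_def using \<phi> by auto

text \<open>At a zero of its denominator the conjugate unit would have a zero numerator too, against
  its determinant. So a parameter outside the roots of \<open>q\<close> is a pole of no
  conjugate.\<close>

lemma conj_form_Z:
  assumes "\<beta> \<in> conjugates \<alpha>" "t \<in> good"
  shows "conj_form n \<beta> (Z t) * (pe c \<beta> * t + pe d \<beta>) = pe a \<beta> * t + pe b \<beta>" "pe c \<beta> * t + pe d \<beta> \<noteq> 0"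
proof -
  have qt: "poly (mp q) t \<noteq> 0" using assms(2) unfolding good_def by simp
  have "conj_form n \<beta> (Z t) = (\<Sum>i<n. \<beta> ^ i * poly (mp (p i)) t) / poly (mp q) t"
    unfolding conj_form_def Z_def sum_divide_distrib by (intro sum.cong) auto
  moreover have "(\<Sum>i<n. \<beta> ^ i * poly (mp (p i)) t) * (pe d \<beta> + t * pe c \<beta>) = poly (mp q) t * (pe b \<beta> + t * pe a \<beta>)"
    using arg_cong[OF conj[OF assms(1)], of "\<lambda>f. poly f t"] by (simp add: poly_sum algebra_simps)
  ultimately show *: "conj_form n \<beta> (Z t) * (pe c \<beta> * t + pe d \<beta>) = pe a \<beta> * t + pe b \<beta>"
  proof -
    assume Y: "conj_form n \<beta> (Z t) = (\<Sum>i<n. \<beta> ^ i * poly (mp (p i)) t) / poly (mp q) t"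
      and eq: "(\<Sum>i<n. \<beta> ^ i * poly (mp (p i)) t) * (pe d \<beta> + t * pe c \<beta>) = poly (mp q) t * (pe b \<beta> + t * pe a \<beta>)"
    have "(\<Sum>i<n. \<beta> ^ i * poly (mp (p i)) t) = poly (mp q) t * conj_form n \<beta> (Z t)" using Y qt by simp
    then have "poly (mp q) t * (conj_form n \<beta> (Z t) * (pe c \<beta> * t + pe d \<beta>)) = poly (mp q) t * (pe a \<beta> * t + pe b \<beta>)"
      using eq by (simp add: algebra_simps)
    then show ?thesis using qt by simp
  qed
  show "pe c \<beta> * t + pe d \<beta> \<noteq> 0"
  proof
    assume 0: "pe c \<beta> * t + pe d \<beta> = 0"
    then have "pe a \<beta> * t + pe b \<beta> = 0" using * by simp
    then have "pe a \<beta> * (pe c \<beta> * t + pe d \<beta>) - pe c \<beta> * (pe a \<beta> * t + pe b \<beta>) = 0" using 0 by simp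
    then show False using det_conj[OF assms(1)] by (simp add: algebra_simps)
  qed
qed

lemma conj_form_Z_inj: "inj_on (\<lambda>t. conj_form n \<alpha> (Z t)) good"
proof
  fix s t assume st: "s \<in> good" "t \<in> good" "conj_form n \<alpha> (Z s) = conj_form n \<alpha> (Z t)"
  let ?Y = "conj_form n \<alpha> (Z t)"
  have s: "?Y * (pe c \<alpha> * s + pe d \<alpha>) = pe a \<alpha> * s + pe b \<alpha>" and t: "?Y * (pe c \<alpha> * t + pe d \<alpha>) = pe a \<alpha> * t + pe b \<alpha>"
    using conj_form_Z(1)[OF self_conjugate] st by metis+
  have nz: "pe c \<alpha> * s + pe d \<alpha> \<noteq> 0" "pe c \<alpha> * t + pe d \<alpha> \<noteq> 0"
    using conj_form_Z(2)[OF self_conjugate] st by blast+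
  have "(pe a \<alpha> * s + pe b \<alpha>) * (pe c \<alpha> * t + pe d \<alpha>) = (pe a \<alpha> * t + pe b \<alpha>) * (pe c \<alpha> * s + pe d \<alpha>)"
    unfolding s[symmetric] t[symmetric] by (simp add: mult_ac)
  then have "(pe a \<alpha> * pe d \<alpha> - pe b \<alpha> * pe c \<alpha>) * (s - t) = 0" by (simp add: algebra_simps)
  then show "s = t" using det_conj[OF self_conjugate] by simp
qed

lemma Z_inj: "inj_on Z good"
  using conj_form_Z_inj unfolding inj_on_def by metis

text \<open>After clearing denominators, \<open>f\<close> along the parametrization is a polynomial
  in the parameter with infinitely many roots.\<close>

lemma img_dense:
  assumes f: "f \<in> pf n UNIV" and T: "infinite T" "\<And>t. t \<in> T \<Longrightarrow> t \<in> good \<Longrightarrow> f (Z t) = 0" and x: "x \<in> img"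
  shows "f x = 0"
proof -
  obtain t0 where xc: "x \<in> carrier_vec n" and t0: "\<forall>i<n. ratfun_value (\<phi> i) t0 (x $ i)" using x unfolding img_def by blast
  have "\<forall>i. \<exists>P Q. i < n \<longrightarrow> \<phi> i = Fract P Q \<and> poly Q t0 \<noteq> 0 \<and> x $ i = poly P t0 / poly Q t0"
    using t0 unfolding ratfun_value_def by metis
  then obtain P Q where PQ: "\<And>i. i < n \<Longrightarrow> \<phi> i = Fract (P i) (Q i) \<and> poly (Q i) t0 \<noteq> 0 \<and> x $ i = poly (P i) t0 / poly (Q i) t0"
    by metis
  \<comment> \<open>The point \<open>x\<close> may come from a parameter where \<open>q\<close>
    vanishes and the fractions cancel. So a second common denominator is used that is nonzero at
    that parameter.\<close>
  define Qp where "Qp = (\<Prod>i<n. Q i)"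
  define Pp where "Pp i = P i * (\<Prod>j\<in>{..<n} - {i}. Q j)" for i
  have Qsplit: "Qp = Q i * (\<Prod>j\<in>{..<n} - {i}. Q j)" if "i < n" for i
    unfolding Qp_def using that by (intro prod.remove) auto
  have Qp0: "poly Qp t0 \<noteq> 0" unfolding Qp_def poly_prod using PQ by auto
  have ratio: "poly (Pp i) t / poly Qp t = poly (P i) t / poly (Q i) t" if "i < n" "poly Qp t \<noteq> 0" for i t
    using that(2) unfolding Qsplit[OF that(1)] Pp_def by auto
  have x_eq: "x = vec n (\<lambda>i. poly (Pp i) t0 / poly Qp t0)"
    using xc PQ ratio[OF _ Qp0] by (intro eq_vecI) auto
  have Z_eq: "Z t = vec n (\<lambda>i. poly (Pp i) t / poly Qp t)" if t: "t \<in> good" "poly Qp t \<noteq> 0" for t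
  proof (rule eq_vecI)
    fix i assume "i < dim_vec (vec n (\<lambda>i. poly (Pp i) t / poly Qp t))"
    then have i: "i < n" by simp
    have Qt: "poly (Q i) t \<noteq> 0" using t(2) unfolding Qsplit[OF i] by auto
    have "Fract (P i) (Q i) = Fract (mp (p i)) (mp q)" using PQ[OF i] \<phi>[OF i] by simp
    moreover have "Q i \<noteq> 0" "mp q \<noteq> 0" using Qt t(1) unfolding good_def by auto
    ultimately have "P i * mp q = mp (p i) * Q i" by (simp add: eq_fract)
    then have "poly (P i) t * poly (mp q) t = poly (mp (p i)) t * poly (Q i) t" by (metis poly_mult)
    then have "poly (P i) t / poly (Q i) t = poly (mp (p i)) t / poly (mp q) t"
      using Qt t(1) unfolding good_def by (simp add: frac_eq_eq)
    then show "Z t $ i = vec n (\<lambda>i. poly (Pp i) t / poly Qp t) $ i"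
      using i ratio[OF i t(2)] unfolding Z_def by simp
  qed (simp add: Z_def)
  obtain M r where Mr: "\<And>t. poly Qp t \<noteq> 0 \<Longrightarrow> f (vec n (\<lambda>i. poly (Pp i) t / poly Qp t)) * poly Qp t ^ M = poly r t"
    using pf_rational_curve[OF f, of Qp Pp] by blast
  have "r = 0"
  proof (rule ccontr)
    assume "r \<noteq> 0"
    have "T \<subseteq> - good \<union> {t. poly Qp t = 0} \<union> {t. poly r t = 0}"
    proof
      fix t assume t: "t \<in> T"
      show "t \<in> - good \<union> {t. poly Qp t = 0} \<union> {t. poly r t = 0}"
      proof (rule ccontr)
        assume "\<not> ?thesis"
        then have *: "t \<in> good" "poly Qp t \<noteq> 0" "poly r t \<noteq> 0" by auto
        then show False using T(2)[OF t *(1)] Z_eq[OF *(1,2)] Mr[OF *(2)] by simp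
      qed
    qed
    moreover have "Qp \<noteq> 0" using Qp0 by auto
    ultimately show False
      using T(1) finite_bad poly_roots_finite[of Qp] poly_roots_finite[OF \<open>r \<noteq> 0\<close>] by (meson finite_UnI finite_subset)
  qed
  then show ?thesis using Mr[OF Qp0] Qp0 unfolding x_eq by simp
qed

definition H :: "'k alg_closure vec set" where
  "H = zariski_closure n img"

lemma img_carrier: "img \<subseteq> carrier_vec n"
  unfolding img_def by blast

lemma H_carrier: "H \<subseteq> carrier_vec n"
  unfolding H_def zariski_closure_pf[OF img_carrier] by blast

lemma H_zero:
  assumes "f \<in> pf n UNIV" "infinite T" "\<And>t. t \<in> T \<Longrightarrow> t \<in> good \<Longrightarrow> f (Z t) = 0" "x \<in> H"
  shows "f x = 0"
  using img_dense[OF assms(1-3)] assms(1,4) unfolding H_def zariski_closure_pf[OF img_carrier] by blast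

lemma infinite_good: "infinite good"
  using finite_bad infinite_UNIV_char_0[where 'a = "'k alg_closure"] by (metis finite_Un Compl_partition)

lemma Z_in_H: "t \<in> good \<Longrightarrow> Z t \<in> H"
  using Z_img unfolding H_def zariski_closure_def by blast

lemma H_irreducible: "irreducible_set n H"
  unfolding H_def
proof (rule irreducible_closure[OF img_carrier])
  obtain t where "t \<in> good" using infinite_good infinite_imp_nonempty by blast
  then show "img \<noteq> {}" using Z_img by blast
  fix f g :: "'k alg_closure vec \<Rightarrow> 'k alg_closure"
  assume fg: "f \<in> pf n UNIV" "g \<in> pf n UNIV" "\<forall>x\<in>img. f x * g x = 0"
  have "good \<subseteq> {t \<in> good. f (Z t) = 0} \<union> {t \<in> good. g (Z t) = 0}" using fg(3) Z_img by auto
  then have "infinite ({t \<in> good. f (Z t) = 0} \<union> {t \<in> good. g (Z t) = 0})"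
    using infinite_good finite_subset by blast
  then consider "infinite {t \<in> good. f (Z t) = 0}" | "infinite {t \<in> good. g (Z t) = 0}"
    unfolding finite_Un by blast
  then show "(\<forall>x\<in>img. f x = 0) \<or> (\<forall>x\<in>img. g x = 0)"
  proof cases
    case 1
    then show ?thesis using img_dense[OF fg(1) 1] by blast
  next
    case 2
    then show ?thesis using img_dense[OF fg(2) 2] by blast
  qed
qed

lemma infinite_base_points: "infinite {x \<in> H. \<forall>i<n. x $ i \<in> base_field}"
proof -
  have "infinite (range (to_ac :: 'k \<Rightarrow> _))"
    using finite_imageD[OF _ inj_to_ac] infinite_UNIV_char_0[where 'a = 'k] by blast
  then have "infinite (range (to_ac :: 'k \<Rightarrow> _) - (- good))" using finite_bad by (rule Diff_infinite_finite[rotated])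
  moreover have "range to_ac - (- good) \<subseteq> good" by blast
  ultimately have "infinite (Z ` (range to_ac - (- good)))" using finite_imageD[OF _ inj_on_subset[OF Z_inj]] by blast
  moreover have "Z ` (range to_ac - (- good)) \<subseteq> {x \<in> H. \<forall>i<n. x $ i \<in> base_field}"
  proof
    fix x assume "x \<in> Z ` (range to_ac - (- good))"
    then obtain \<tau> where \<tau>: "x = Z (to_ac \<tau>)" "to_ac \<tau> \<in> good" by blast
    have "x $ i = to_ac (poly (p i) \<tau> / poly q \<tau>)" if "i < n" for i
      unfolding \<tau>(1) Z_def using that by (simp add: poly_mp_to_ac)
    then have "x $ i \<in> base_field" if "i < n" for i unfolding base_field_def using that by (metis rangeI)
    then show "x \<in> {x \<in> H. \<forall>i<n. x $ i \<in> base_field}" using Z_in_H[OF \<tau>(2)] \<tau>(1) by blast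
  qed
  ultimately show ?thesis using finite_subset by blast
qed

text \<open>Together with \<open>t1\<close> this is the inverse of the unit in homogeneous form: the
  parameter is t0 : t1, read off from the form of \<alpha> alone. It is defined on all of
  \<open>H\<close>, and \<open>t1\<close> is 0 where the parameter is infinite.\<close>

definition t0 :: "'k alg_closure vec \<Rightarrow> 'k alg_closure" where
  "t0 y = pe d \<alpha> * conj_form n \<alpha> y - pe b \<alpha>"

definition t1 :: "'k alg_closure vec \<Rightarrow> 'k alg_closure" where
  "t1 y = pe a \<alpha> - pe c \<alpha> * conj_form n \<alpha> y"

text \<open>Both sides are polynomial functions of the point. On the image they differ by a common
  factor \<open>k\<close> times the relation for the conjugate unit, and density extends the
  equation to the closure.\<close>

lemma H_relation:
  assumes y: "y \<in> H" and \<beta>: "\<beta> \<in> conjugates \<alpha>"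
  shows "conj_form n \<beta> y * (pe c \<beta> * t0 y + pe d \<beta> * t1 y) = pe a \<beta> * t0 y + pe b \<beta> * t1 y"
proof -
  define f where "f y = conj_form n \<beta> y * (pe c \<beta> * t0 y + pe d \<beta> * t1 y) - (pe a \<beta> * t0 y + pe b \<beta> * t1 y)" for y
  have tpf: "t0 \<in> pf n UNIV" "t1 \<in> pf n UNIV" unfolding t0_def t1_def
    by (intro pf_diff pf_smult pf_const conj_form_pf UNIV_I)+
  have "f \<in> pf n UNIV" unfolding f_def
    by (intro pf_diff pf_times pf_add pf_smult tpf conj_form_pf)
  moreover have "f (Z t) = 0" if t: "t \<in> good" for t
  proof -
    let ?Y = "conj_form n \<alpha> (Z t)"
    define e where "e = pe c \<alpha> * t + pe d \<alpha>"
    have Y: "?Y * e = pe a \<alpha> * t + pe b \<alpha>" "e \<noteq> 0" unfolding e_def using conj_form_Z[OF self_conjugate t] by auto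
    define k where "k = (pe a \<alpha> * pe d \<alpha> - pe b \<alpha> * pe c \<alpha>) / e"
    have "t0 (Z t) * e = t * (pe a \<alpha> * pe d \<alpha> - pe b \<alpha> * pe c \<alpha>)"
    proof -
      have "t0 (Z t) * e = pe d \<alpha> * (?Y * e) - pe b \<alpha> * e" unfolding t0_def by (simp add: algebra_simps)
      also have "\<dots> = pe d \<alpha> * (pe a \<alpha> * t + pe b \<alpha>) - pe b \<alpha> * e" unfolding Y(1) ..
      also have "\<dots> = t * (pe a \<alpha> * pe d \<alpha> - pe b \<alpha> * pe c \<alpha>)" unfolding e_def by (simp add: algebra_simps)
      finally show ?thesis .
    qed
    then have 0: "t0 (Z t) = k * t" unfolding k_def using Y(2) by (simp add: eq_divide_eq mult.commute)
    have "t1 (Z t) * e = pe a \<alpha> * pe d \<alpha> - pe b \<alpha> * pe c \<alpha>"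
    proof -
      have "t1 (Z t) * e = pe a \<alpha> * e - pe c \<alpha> * (?Y * e)" unfolding t1_def by (simp add: algebra_simps)
      also have "\<dots> = pe a \<alpha> * e - pe c \<alpha> * (pe a \<alpha> * t + pe b \<alpha>)" unfolding Y(1) ..
      also have "\<dots> = pe a \<alpha> * pe d \<alpha> - pe b \<alpha> * pe c \<alpha>" unfolding e_def by (simp add: algebra_simps)
      finally show ?thesis .
    qed
    then have 1: "t1 (Z t) = k" unfolding k_def using Y(2) by (simp add: eq_divide_eq)
    have "f (Z t) = k * (conj_form n \<beta> (Z t) * (pe c \<beta> * t + pe d \<beta>) - (pe a \<beta> * t + pe b \<beta>))"
      unfolding f_def 0 1 by (simp add: algebra_simps)
    then show ?thesis using conj_form_Z(1)[OF \<beta> t] by simp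
  qed
  ultimately have "f y = 0" using H_zero[OF _ infinite_good _ y] by blast
  then show ?thesis unfolding f_def by simp
qed

lemma t_nonzero: "t0 y \<noteq> 0 \<or> t1 y \<noteq> 0"
proof (rule ccontr)
  assume "\<not> ?thesis"
  then have *: "pe d \<alpha> * conj_form n \<alpha> y = pe b \<alpha>" "pe c \<alpha> * conj_form n \<alpha> y = pe a \<alpha>"
    unfolding t0_def t1_def by auto
  have "pe a \<alpha> * pe d \<alpha> - pe b \<alpha> * pe c \<alpha> = 0" unfolding *[symmetric] by (simp add: mult_ac)
  then show False using det_conj[OF self_conjugate] by simp
qed

text \<open>Numerator and denominator of a conjugate unit cannot vanish together at t0 : t1, since
  the determinant is nonzero. So points of \<open>H\<close> avoid all poles.\<close>

lemma H_denominator: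
  assumes y: "y \<in> H" and \<beta>: "\<beta> \<in> conjugates \<alpha>"
  shows "pe c \<beta> * t0 y + pe d \<beta> * t1 y \<noteq> 0"
proof
  assume 0: "pe c \<beta> * t0 y + pe d \<beta> * t1 y = 0"
  then have 1: "pe a \<beta> * t0 y + pe b \<beta> * t1 y = 0" using H_relation[OF assms] by simp
  have "(pe a \<beta> * pe d \<beta> - pe b \<beta> * pe c \<beta>) * t0 y =
      pe d \<beta> * (pe a \<beta> * t0 y + pe b \<beta> * t1 y) - pe b \<beta> * (pe c \<beta> * t0 y + pe d \<beta> * t1 y)" by (simp add: algebra_simps)
  then have "t0 y = 0" unfolding 0 1 using det_conj[OF \<beta>] by simp
  have "(pe a \<beta> * pe d \<beta> - pe b \<beta> * pe c \<beta>) * t1 y =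
      pe a \<beta> * (pe c \<beta> * t0 y + pe d \<beta> * t1 y) - pe c \<beta> * (pe a \<beta> * t0 y + pe b \<beta> * t1 y)" by (simp add: algebra_simps)
  then have "t1 y = 0" unfolding 0 1 using det_conj[OF \<beta>] by simp
  then show False using t_nonzero \<open>t0 y = 0\<close> by blast
qed

text \<open>The parameter determines the value of every conjugate form, hence the point.\<close>

lemma H_point_unique:
  assumes "y \<in> H" "z \<in> H" "t0 y * t1 z = t0 z * t1 y"
  shows "y = z"
proof (rule conj_form_inject[OF finite_conjugates n[symmetric]])
  show "y \<in> carrier_vec n" "z \<in> carrier_vec n" using assms H_carrier by auto
  fix \<beta> assume \<beta>: "\<beta> \<in> conjugates \<alpha>"
  let ?dy = "pe c \<beta> * t0 y + pe d \<beta> * t1 y" and ?dz = "pe c \<beta> * t0 z + pe d \<beta> * t1 z"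
  let ?ny = "pe a \<beta> * t0 y + pe b \<beta> * t1 y" and ?nz = "pe a \<beta> * t0 z + pe b \<beta> * t1 z"
  have "?ny * ?dz - ?nz * ?dy = (pe a \<beta> * pe d \<beta> - pe b \<beta> * pe c \<beta>) * (t0 y * t1 z - t0 z * t1 y)"
    by (simp add: algebra_simps)
  then have cross: "?ny * ?dz = ?nz * ?dy" using assms(3) by simp
  have "conj_form n \<beta> y * (?dy * ?dz) = (conj_form n \<beta> y * ?dy) * ?dz" by (simp only: mult.assoc)
  also have "\<dots> = ?nz * ?dy" unfolding H_relation[OF assms(1) \<beta>] cross ..
  also have "\<dots> = conj_form n \<beta> z * (?dy * ?dz)" unfolding H_relation[OF assms(2) \<beta>, symmetric] by (simp only: mult_ac)
  finally have "conj_form n \<beta> y * (?dy * ?dz) = conj_form n \<beta> z * (?dy * ?dz)" .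
  then show "conj_form n \<beta> y = conj_form n \<beta> z"
    using H_denominator[OF assms(1) \<beta>] H_denominator[OF assms(2) \<beta>] by simp
qed

text \<open>If two conjugate denominators are proportional, one of them can be left out of the
  common denominator. A section then becomes a polynomial equation of degree at most
  \<open>n - 1\<close> in the parameter, too small for \<open>n\<close> points. The cross-multiplied
  form of the inequality includes poles at infinity.\<close>

lemma poles_distinct:
  assumes deg: "has_curve_degree n H n" and \<beta>\<gamma>: "\<beta> \<in> conjugates \<alpha>" "\<gamma> \<in> conjugates \<alpha>" "\<beta> \<noteq> \<gamma>"
  shows "pe c \<beta> * pe d \<gamma> \<noteq> pe c \<gamma> * pe d \<beta>"
proof
  assume same: "pe c \<beta> * pe d \<gamma> = pe c \<gamma> * pe d \<beta>"
  let ?C = "conjugates \<alpha>"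
  define den where "den \<delta> = [:pe d \<delta>, pe c \<delta>:]" for \<delta>
  define num where "num \<delta> = [:pe b \<delta>, pe a \<delta>:]" for \<delta>
  have den0: "den \<delta> \<noteq> 0" if "\<delta> \<in> ?C" for \<delta> using det_conj[OF that] unfolding den_def by auto
  \<comment> \<open>The common denominator without the factor of \<beta>, which is already supplied
    by that of \<gamma>.\<close>
  define L where "L = (\<Prod>\<delta>\<in>?C - {\<beta>}. den \<delta>)"
  have card: "card (?C - {\<beta>}) = n - 1" "card (?C - {\<beta>} - {\<delta>}) = n - 2" if "\<delta> \<in> ?C - {\<beta>}" for \<delta>
    using n \<beta>\<gamma>(1) finite_conjugates[of \<alpha>] that by auto
  have deg_den: "degree (\<Prod>\<delta>\<in>A. den \<delta>) \<le> card A" if "finite A" for A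
    by (rule order_trans[OF degree_prod_sum_le[OF that]]) (use sum_bounded_above[of A "\<lambda>\<delta>. degree (den \<delta>)" 1] in \<open>auto simp: den_def\<close>)
  have fin: "finite (?C - {\<beta>})" using finite_conjugates by blast
  have L0: "L \<noteq> 0" unfolding L_def prod_zero_iff[OF fin] using den0 by blast
  have degL: "degree L \<le> n - 1" using deg_den[OF fin] card(1)[of \<gamma>] \<beta>\<gamma> unfolding L_def by simp
  have n2: "n \<ge> 2"
  proof -
    have "card {\<beta>, \<gamma>} \<le> card ?C" using \<beta>\<gamma> finite_conjugates by (intro card_mono) auto
    then show ?thesis using \<beta>\<gamma> n by simp
  qed
  have mult: "\<exists>m. L = den \<delta> * m \<and> degree m \<le> n - 2" if \<delta>: "\<delta> \<in> ?C" for \<delta>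
  proof -
    have *: "L = den \<delta> * (\<Prod>\<epsilon>\<in>?C - {\<beta>} - {\<delta>}. den \<epsilon>) \<and> degree (\<Prod>\<epsilon>\<in>?C - {\<beta>} - {\<delta>}. den \<epsilon>) \<le> n - 2"
      if "\<delta> \<in> ?C - {\<beta>}" for \<delta>
    proof
      show "L = den \<delta> * (\<Prod>\<epsilon>\<in>?C - {\<beta>} - {\<delta>}. den \<epsilon>)" unfolding L_def using that fin by (intro prod.remove) auto
      show "degree (\<Prod>\<epsilon>\<in>?C - {\<beta>} - {\<delta>}. den \<epsilon>) \<le> n - 2"
        using deg_den[of "?C - {\<beta>} - {\<delta>}"] card(2)[OF that] fin by simp
    qed
    show ?thesis
    proof (cases "\<delta> = \<beta>")
      case False
      then show ?thesis using * \<delta> by blast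
    next
      case True
      \<comment> \<open>The two denominators are proportional, so the cofactor that belongs to
        \<gamma> also serves \<beta>.\<close>
      have "\<exists>k. den \<gamma> = smult k (den \<beta>)"
      proof (cases "pe c \<beta> = 0")
        case True
        then have "pe d \<beta> \<noteq> 0" using den0[OF \<beta>\<gamma>(1)] unfolding den_def by auto
        then show ?thesis using same True by (intro exI[of _ "pe d \<gamma> / pe d \<beta>"]) (simp add: den_def)
      next
        case False
        then show ?thesis using same by (intro exI[of _ "pe c \<gamma> / pe c \<beta>"]) (simp add: den_def field_simps)
      qed
      then obtain k where k: "den \<gamma> = smult k (den \<beta>)" by blast
      have \<gamma>': "\<gamma> \<in> ?C - {\<beta>}" using \<beta>\<gamma> by blast
      show ?thesis using *[OF \<gamma>'] unfolding k True
        by (intro exI[of _ "smult k (\<Prod>\<epsilon>\<in>?C - {\<beta>} - {\<gamma>}. den \<epsilon>)"])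
          (auto intro: order_trans[OF degree_smult_le])
    qed
  qed
  then obtain m where m: "\<And>\<delta>. \<delta> \<in> ?C \<Longrightarrow> L = den \<delta> * m \<delta> \<and> degree (m \<delta>) \<le> n - 2" by metis
  obtain G where G: "G \<in> mpols (n + 1)" "G \<noteq> 0"
    "\<And>a. a \<in> carrier_vec (n + 1) \<Longrightarrow> mpol_eval G a \<noteq> 0 \<Longrightarrow>
           finite {x \<in> H. a \<bullet> append_one x = 0} \<and> card {x \<in> H. a \<bullet> append_one x = 0} = n"
    using deg unfolding has_curve_degree_def by blast
  obtain A where A: "A \<in> carrier_vec (n + 1)" "mpol_eval G A \<noteq> 0" using mpol_nonzero_value[OF G(1,2)] by blast
  let ?u = "unit_vec (n + 1) n"
  \<comment> \<open>The coefficients of the hyperplane \<open>A\<close> with respect to the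
    conjugate forms.\<close>
  define e where "e \<delta> = (\<Sum>i<n. A $ i * (inf_vec \<alpha> \<delta> $ i / conj_form n \<delta> (inf_vec \<alpha> \<delta>)))" for \<delta>
  have lina_e: "lina n A y = (\<Sum>\<delta>\<in>?C. conj_form n \<delta> y * e \<delta>) + A $ n" if "y \<in> carrier_vec n" for y
  proof -
    have "(\<Sum>i<n. A $ i * y $ i) =
      (\<Sum>i<n. \<Sum>\<delta>\<in>?C. A $ i * (conj_form n \<delta> y * (inf_vec \<alpha> \<delta> $ i / conj_form n \<delta> (inf_vec \<alpha> \<delta>))))"
      using conj_form_interpolation[OF n that] by (intro sum.cong refl) (simp add: sum_distrib_left)
    also have "\<dots> = (\<Sum>\<delta>\<in>?C. conj_form n \<delta> y * e \<delta>)"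
      unfolding sum.swap[of _ "{..<n}"] e_def sum_distrib_left by (simp add: mult_ac)
    finally show ?thesis unfolding lina_def by simp
  qed
  \<comment> \<open>The equation of the section by the hyperplane \<open>A\<close> shifted by
    \<open>s\<close>, in the parameter and multiplied by \<open>L\<close>.\<close>
  define R where "R s = (\<Sum>\<delta>\<in>?C. smult (e \<delta>) (num \<delta> * m \<delta>)) + smult (A $ n + s) L" for s
  have degR: "degree (R s) \<le> n - 1" for s
  proof -
    have "degree (smult (e \<delta>) (num \<delta> * m \<delta>)) \<le> n - 1" if "\<delta> \<in> ?C" for \<delta>
    proof -
      have "degree (num \<delta> * m \<delta>) \<le> degree (num \<delta>) + degree (m \<delta>)" by (rule degree_mult_le)
      moreover have "degree (num \<delta>) \<le> 1" by (simp add: num_def)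
      ultimately have "degree (num \<delta> * m \<delta>) \<le> n - 1" using m[OF that] n2 by linarith
      then show ?thesis by (rule order_trans[OF degree_smult_le])
    qed
    then have "degree (\<Sum>\<delta>\<in>?C. smult (e \<delta>) (num \<delta> * m \<delta>)) \<le> n - 1" by (rule degree_sum_le[OF finite_conjugates])
    moreover have "degree (smult (A $ n + s) L) \<le> n - 1" by (rule order_trans[OF degree_smult_le degL])
    ultimately show ?thesis unfolding R_def by (rule degree_add_le)
  qed
  have R_inj: "s = s'" if "R s = 0" "R s' = 0" for s s'
  proof -
    have "smult (s - s') L = R s - R s'" unfolding R_def by (simp add: smult_add_left smult_diff_left)
    then show ?thesis using that L0 by simp
  qed
  have fin1: "finite {s. R s = 0}"
  proof (cases "{s. R s = 0} = {}")
    case False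
    then obtain s where "R s = 0" by blast
    then have "{s. R s = 0} = {s}" using R_inj by blast
    then show ?thesis by simp
  qed simp
  define E where "E = {y \<in> H. t1 y = 0}"
  have finE: "finite E"
  proof (cases "E = {}")
    case False
    then obtain y where "y \<in> E" by blast
    then have "E = {y}" using H_point_unique[of _ y] unfolding E_def by auto
    then show ?thesis by simp
  qed simp
  have finG: "finite {s. mpol_eval G (A + s \<cdot>\<^sub>v ?u) = 0}"
    using A by (intro pf_line_finite[OF mpol_eval_in_pf[OF G(1)]]) auto
  \<comment> \<open>The shift \<open>s\<close> is chosen so that the equation is not trivial, the
    section avoids the point of infinite parameter, and the hyperplane is generic.\<close>
  have "finite ({s. R s = 0} \<union> (\<lambda>y. - lina n A y) ` E \<union> {s. mpol_eval G (A + s \<cdot>\<^sub>v ?u) = 0})"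
    using fin1 finE finG by simp
  then obtain s where "s \<notin> {s. R s = 0} \<union> (\<lambda>y. - lina n A y) ` E \<union> {s. mpol_eval G (A + s \<cdot>\<^sub>v ?u) = 0}"
    using ex_new_if_finite[OF infinite_UNIV_char_0] by metis
  then have s: "R s \<noteq> 0" "s \<notin> (\<lambda>y. - lina n A y) ` E" "mpol_eval G (A + s \<cdot>\<^sub>v ?u) \<noteq> 0" by auto
  have sec: "(A + s \<cdot>\<^sub>v ?u) \<bullet> append_one y = lina n A y + s" if "y \<in> H" for y
  proof -
    have yc: "y \<in> carrier_vec n" using that H_carrier by blast
    have u: "?u \<in> carrier_vec (n + 1)" by simp
    show ?thesis
      unfolding linf_scalar_prod[OF append_one_carrier[OF yc]] lina_append_one[OF yc] lina_add[OF A(1) u] lina_unit_last by simp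
  qed
  define Sec where "Sec = {y \<in> H. (A + s \<cdot>\<^sub>v ?u) \<bullet> append_one y = 0}"
  have Sec: "card Sec = n" unfolding Sec_def using G(3)[OF _ s(3)] A(1) by simp
  have t1_Sec: "t1 y \<noteq> 0" if "y \<in> Sec" for y
  proof
    assume "t1 y = 0"
    then have "y \<in> E" using that unfolding E_def Sec_def by blast
    moreover have "s = - lina n A y" using that sec[of y] unfolding Sec_def by (simp add: eq_neg_iff_add_eq_0 add.commute)
    ultimately show False using s(2) by blast
  qed
  have "inj_on (\<lambda>y. t0 y / t1 y) Sec"
  proof
    fix y z assume yz: "y \<in> Sec" "z \<in> Sec" "t0 y / t1 y = t0 z / t1 z"
    then have "t0 y * t1 z = t0 z * t1 y" using t1_Sec by (simp add: frac_eq_eq)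
    then show "y = z" using H_point_unique yz unfolding Sec_def by blast
  qed
  then have cS: "card ((\<lambda>y. t0 y / t1 y) ` Sec) = card Sec" by (rule card_image)
  have "(\<lambda>y. t0 y / t1 y) ` Sec \<subseteq> {t. poly (R s) t = 0}"
  proof
    fix t assume "t \<in> (\<lambda>y. t0 y / t1 y) ` Sec"
    then obtain y where y: "y \<in> Sec" "t = t0 y / t1 y" by blast
    have yH: "y \<in> H" and yc: "y \<in> carrier_vec n" using y(1) H_carrier unfolding Sec_def by auto
    have "conj_form n \<delta> y * poly L t = poly (num \<delta> * m \<delta>) t" if \<delta>: "\<delta> \<in> ?C" for \<delta>
    proof -
      have "t0 y = t * t1 y" using t1_Sec[OF y(1)] y(2) by simp
      then have "t1 y * (conj_form n \<delta> y * poly (den \<delta>) t) = t1 y * poly (num \<delta>) t"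
        using H_relation[OF yH \<delta>] unfolding den_def num_def by (simp add: algebra_simps)
      then have "conj_form n \<delta> y * poly (den \<delta>) t = poly (num \<delta>) t" using t1_Sec[OF y(1)] by simp
      then show ?thesis using m[OF \<delta>] by (metis mult.assoc poly_mult)
    qed
    then have "poly (R s) t = (\<Sum>\<delta>\<in>?C. e \<delta> * (conj_form n \<delta> y * poly L t)) + (A $ n + s) * poly L t"
      unfolding R_def by (simp add: poly_sum)
    also have "\<dots> = (lina n A y + s) * poly L t"
      unfolding lina_e[OF yc] by (simp add: algebra_simps sum_distrib_left sum_distrib_right)
    also have "\<dots> = 0" using y(1) sec[OF yH] unfolding Sec_def by simp
    finally show "t \<in> {t. poly (R s) t = 0}" by simp
  qed
  then have "card Sec \<le> card {t. poly (R s) t = 0}"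
    unfolding cS[symmetric] by (rule card_mono[OF poly_roots_finite[OF s(1)]])
  also have "\<dots> \<le> degree (R s)" by (rule card_poly_roots_bound[OF s(1)])
  also have "\<dots> \<le> n - 1" by (rule degR)
  finally show False using Sec n2 by simp
qed

text \<open>The parametrization is extended through the pole of the conjugate at \<open>\<beta>\<close>, in homogeneous coordinates.\<close>

lemma inf_vec_in_closure:
  assumes distinct: "\<And>\<gamma>. \<gamma> \<in> conjugates \<alpha> \<Longrightarrow> \<gamma> \<noteq> \<beta> \<Longrightarrow> pe c \<gamma> * pe d \<beta> \<noteq> pe c \<beta> * pe d \<gamma>"
    and \<beta>: "\<beta> \<in> conjugates \<alpha>"
  shows "in_closure n H (inf_vec \<alpha> \<beta>)"
  unfolding in_closure_def
proof (intro allI ballI impI)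
  fix k and f :: "'k alg_closure vec \<Rightarrow> 'k alg_closure"
  assume f: "f \<in> pf (n + 1) {k}" and f0: "\<forall>x\<in>H. f (append_one x) = 0"
  let ?C = "conjugates \<alpha>"
  have fin: "finite ?C" by (rule finite_conjugates)
  \<comment> \<open>A line of parameters T0 : T1 that meets the pole of the conjugate at \<beta>,
    namely \<open>pe d \<beta>\<close> : \<open>- pe c \<beta>\<close>, at 0. The case split keeps
    the ratio nonconstant whether or not the pole is infinite.\<close>
  define T0 where "T0 = [:pe d \<beta>, if pe c \<beta> = 0 then 0 else 1:]"
  define T1 where "T1 = [:- pe c \<beta>, if pe c \<beta> = 0 then 1 else 0:]"
  define den where "den \<delta> = smult (pe c \<delta>) T0 + smult (pe d \<delta>) T1" for \<delta>
  define num where "num \<delta> = smult (pe a \<delta>) T0 + smult (pe b \<delta>) T1" for \<delta>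
  define N where "N \<delta> = conj_form n \<delta> (inf_vec \<alpha> \<delta>)" for \<delta>
  \<comment> \<open>Homogeneous coordinates of the parametrized point, obtained by interpolation and
    multiplied by the product of all denominators.\<close>
  define W where "W i = (if i < n then \<Sum>\<delta>\<in>?C. smult (inf_vec \<alpha> \<delta> $ i / N \<delta>) (num \<delta> * (\<Prod>\<epsilon>\<in>?C - {\<delta>}. den \<epsilon>))
     else (\<Prod>\<epsilon>\<in>?C. den \<epsilon>))" for i
  define w where "w s = vec (n + 1) (\<lambda>i. poly (W i) s)" for s
  obtain r where r: "\<And>s. f (w s) = poly r s" using pf_curve[of f "n + 1" W] pf_subset[OF _ f] unfolding w_def by blast
  have "pe d \<beta> \<noteq> 0" if "pe c \<beta> = 0" using det_conj[OF \<beta>] that by auto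
  then have Tg: "T0 - smult g T1 \<noteq> 0" for g unfolding T0_def T1_def by auto
  have T1: "T1 \<noteq> 0" unfolding T1_def by auto
  have zero: "poly r s = 0" if s: "poly T1 s \<noteq> 0" "poly T0 s / poly T1 s \<in> good" for s
  proof -
    define t where "t = poly T0 s / poly T1 s"
    have t: "t \<in> good" using s(2) unfolding t_def .
    have T0s: "poly T0 s = t * poly T1 s" unfolding t_def using s(1) by simp
    define P where "P = (\<Prod>\<epsilon>\<in>?C. poly (den \<epsilon>) s)"
    have den_s: "poly (den \<delta>) s = poly T1 s * (pe c \<delta> * t + pe d \<delta>)" for \<delta>
      unfolding den_def by (simp add: T0s algebra_simps)
    have num_s: "poly (num \<delta>) s = conj_form n \<delta> (Z t) * poly (den \<delta>) s" if "\<delta> \<in> ?C" for \<delta>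
    proof -
      have "poly (num \<delta>) s = poly T1 s * (pe a \<delta> * t + pe b \<delta>)" unfolding num_def by (simp add: T0s algebra_simps)
      then show ?thesis unfolding den_s conj_form_Z(1)[OF that t, symmetric] by (simp add: mult_ac)
    qed
    have "w s = P \<cdot>\<^sub>v append_one (Z t)"
    proof (rule eq_vecI)
      fix i assume i: "i < dim_vec (P \<cdot>\<^sub>v append_one (Z t))"
      then have i': "i < n + 1" using append_one_carrier[OF Z_carrier, of t] by auto
      show "w s $ i = (P \<cdot>\<^sub>v append_one (Z t)) $ i"
      proof (cases "i < n")
        case True
        have "poly (num \<delta>) s * (\<Prod>\<epsilon>\<in>?C - {\<delta>}. poly (den \<epsilon>) s) = P * conj_form n \<delta> (Z t)" if "\<delta> \<in> ?C" for \<delta>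
          unfolding num_s[OF that] P_def using prod.remove[OF fin that, of "\<lambda>\<epsilon>. poly (den \<epsilon>) s"] by (simp add: mult_ac)
        then have "w s $ i = (\<Sum>\<delta>\<in>?C. inf_vec \<alpha> \<delta> $ i / N \<delta> * (P * conj_form n \<delta> (Z t)))"
          unfolding w_def W_def using True by (simp add: poly_sum poly_prod)
        also have "\<dots> = P * Z t $ i"
          unfolding conj_form_interpolation[OF n Z_carrier True] N_def sum_distrib_left by (simp add: mult_ac)
        finally show ?thesis
          using True append_one_carrier[OF Z_carrier, of t] by (simp add: append_one_index[OF Z_carrier])
      next
        case False
        then have "i = n" using i' by simp
        then show ?thesis
          using append_one_carrier[OF Z_carrier, of t] by (simp add: append_one_index[OF Z_carrier] w_def W_def P_def poly_prod)
      qed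
    qed (use append_one_carrier[OF Z_carrier, of t] in \<open>simp add: w_def\<close>)
    then show ?thesis
      unfolding r[symmetric] using pf_homogeneous_smult[OF f append_one_carrier[OF Z_carrier]] f0 Z_in_H[OF t] by simp
  qed
  have "r = 0"
  proof (rule ccontr)
    assume r0: "r \<noteq> 0"
    \<comment> \<open>A parameter T0 / T1 that is not good is hit by finitely many \<open>s\<close>
      only, since the ratio is not constant; hence a nonzero \<open>r\<close> would leave only
      finitely many \<open>s\<close> altogether.\<close>
    have "UNIV \<subseteq> {s. poly r s = 0} \<union> {s. poly T1 s = 0} \<union> (\<Union>g\<in>- good. {s. poly (T0 - smult g T1) s = 0})"
    proof
      fix s
      show "s \<in> {s. poly r s = 0} \<union> {s. poly T1 s = 0} \<union> (\<Union>g\<in>- good. {s. poly (T0 - smult g T1) s = 0})"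
      proof (cases "poly T1 s = 0 \<or> poly r s = 0")
        case False
        then have "poly T0 s / poly T1 s \<in> - good" using zero[of s] by blast
        moreover have "poly (T0 - smult (poly T0 s / poly T1 s) T1) s = 0" using False by simp
        ultimately show ?thesis by blast
      qed auto
    qed
    moreover have "finite ({s. poly r s = 0} \<union> {s. poly T1 s = 0} \<union> (\<Union>g\<in>- good. {s. poly (T0 - smult g T1) s = 0}))"
      using poly_roots_finite[OF r0] poly_roots_finite[OF T1] poly_roots_finite[OF Tg] finite_bad by blast
    ultimately show False using finite_subset infinite_UNIV_char_0[where 'a = "'k alg_closure"] by blast
  qed
  then have f_w0: "f (w 0) = 0" using r[of 0] by simp
  \<comment> \<open>At 0 the denominator of \<beta> vanishes, so only the summand of \<beta>
    survives. Its factor \<open>K\<close> is nonzero because the other poles are different.\<close>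
  define K where "K = poly (num \<beta>) 0 * (\<Prod>\<epsilon>\<in>?C - {\<beta>}. poly (den \<epsilon>) 0) / N \<beta>"
  have d0: "poly (den \<delta>) 0 = pe c \<delta> * pe d \<beta> - pe c \<beta> * pe d \<delta>" for \<delta>
    unfolding den_def T0_def T1_def by (simp add: mult_ac)
  have n0: "poly (num \<beta>) 0 = pe a \<beta> * pe d \<beta> - pe b \<beta> * pe c \<beta>" unfolding num_def T0_def T1_def by (simp add: mult_ac)
  have "N \<beta> \<noteq> 0" unfolding N_def using conj_form_inf_vec[OF n \<beta> \<beta>] by simp
  then have K0: "K \<noteq> 0" unfolding K_def n0 d0 using det_conj[OF \<beta>] distinct fin by auto
  have "w 0 = K \<cdot>\<^sub>v inf_vec \<alpha> \<beta>"
  proof (rule eq_vecI)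
    fix i assume i: "i < dim_vec (K \<cdot>\<^sub>v inf_vec \<alpha> \<beta>)"
    then have i': "i < n + 1" using inf_vec_carrier[OF n, of \<beta>] by auto
    have zero: "(\<Prod>\<epsilon>\<in>A. poly (den \<epsilon>) 0) = 0" if "\<beta> \<in> A" "finite A" for A
      using that by (intro prod_zero bexI[of _ \<beta>]) (auto simp: d0)
    show "w 0 $ i = (K \<cdot>\<^sub>v inf_vec \<alpha> \<beta>) $ i"
    proof (cases "i < n")
      case True
      have "w 0 $ i = (\<Sum>\<delta>\<in>?C. inf_vec \<alpha> \<delta> $ i / N \<delta> * (poly (num \<delta>) 0 * (\<Prod>\<epsilon>\<in>?C - {\<delta>}. poly (den \<epsilon>) 0)))"
        unfolding w_def W_def using True by (simp add: poly_sum poly_prod)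
      also have "\<dots> = (\<Sum>\<delta>\<in>?C. if \<delta> = \<beta> then inf_vec \<alpha> \<beta> $ i * K else 0)"
        using zero[of "?C - {_}"] \<beta> fin unfolding K_def by (intro sum.cong) auto
      also have "\<dots> = K * inf_vec \<alpha> \<beta> $ i" using \<beta> fin by simp
      finally show ?thesis using i by simp
    next
      case False
      then have "i = n" using i' by simp
      then show ?thesis using zero[OF \<beta> fin] inf_vec_last[OF n, of \<beta>] i by (simp add: w_def W_def poly_prod)
    qed
  qed (use inf_vec_carrier[OF n, of \<beta>] in \<open>simp add: w_def\<close>)
  then have "K ^ k * f (inf_vec \<alpha> \<beta>) = 0"
    using f_w0 pf_homogeneous_smult[OF f inf_vec_carrier[OF n]] by simp
  then show "f (inf_vec \<alpha> \<beta>) = 0" using K0 by simp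
qed

end

lemma hypercircle_param:
  fixes \<alpha> :: "'k::field_char_0 alg_closure"
  assumes n: "n = card (conjugates \<alpha>)" "n = ext_degree \<alpha>" and U: "hypercircle \<alpha> U"
  shows "\<exists>a b c d q p \<phi>. unit_param \<alpha> n a b c d q p \<phi> \<and> U = unit_param.H n \<phi>"
proof -
  obtain u \<phi> where u: "is_unit_over (adjoin \<alpha>) u" and \<phi>: "\<forall>i<n. \<phi> i \<in> ratfuns base_field"
    and sum: "u = (\<Sum>i<n. \<phi> i * to_fract [:\<alpha> ^ i:])"
    and Ueq: "U = zariski_closure n {x \<in> carrier_vec n. \<exists>t. \<forall>i<n. ratfun_value (\<phi> i) t (x $ i)}"
    using U unfolding hypercircle_def Let_def n(2)[symmetric] by blast
  obtain a' b' c' d' where L: "a' \<in> adjoin \<alpha>" "b' \<in> adjoin \<alpha>" "c' \<in> adjoin \<alpha>" "d' \<in> adjoin \<alpha>"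
    "a' * d' - b' * c' \<noteq> 0" "u = Fract [:b', a':] [:d', c':]"
    using u unfolding is_unit_over_def by blast
  then obtain a b c d where "a' = pe a \<alpha>" "b' = pe b \<alpha>" "c' = pe c \<alpha>" "d' = pe d \<alpha>" unfolding adjoin_eq by blast
  with L(5,6) have abcd: "pe a \<alpha> * pe d \<alpha> - pe b \<alpha> * pe c \<alpha> \<noteq> 0" "u = Fract [:pe b \<alpha>, pe a \<alpha>:] [:pe d \<alpha>, pe c \<alpha>:]"
    by simp_all
  have nz: "[:pe d \<alpha>, pe c \<alpha>:] \<noteq> 0" using abcd(1) by auto
  have "Fract [:pe b \<alpha>, pe a \<alpha>:] [:pe d \<alpha>, pe c \<alpha>:] = (\<Sum>i<n. \<phi> i * to_fract [:\<alpha> ^ i:])"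
    using sum abcd(2) by simp
  then obtain p q where pq: "q \<noteq> 0" "\<forall>i<n. \<phi> i = Fract (mp (p i)) (mp q)"
    "\<forall>\<beta>\<in>conjugates \<alpha>. (\<Sum>i<n. smult (\<beta> ^ i) (mp (p i))) * [:pe d \<beta>, pe c \<beta>:] = mp q * [:pe b \<beta>, pe a \<beta>:]"
    using unit_conjugates[of n \<phi> b \<alpha> a d c] \<phi> nz by blast
  have param: "unit_param \<alpha> n a b c d q p \<phi>"
    by unfold_locales (use n(1) abcd(1) pq in \<open>auto simp: pe_diff pe_mult\<close>)
  then interpret unit_param \<alpha> n a b c d q p \<phi> .
  have "U = H" unfolding H_def img_def Ueq ..
  then show ?thesis using param by blast
qed

lemma pf_prod_homogeneous:
  "finite J \<Longrightarrow> (\<And>i. i \<in> J \<Longrightarrow> f i \<in> pf n {d i}) \<Longrightarrow> (\<lambda>x. \<Prod>i\<in>J. f i x) \<in> pf n {\<Sum>i\<in>J. d i}"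
  by (induction J rule: finite_induct) (auto intro!: pf_const pf_mult)

text \<open>If every member had a form vanishing on it but not at \<open>v\<close>, the product of
  these forms would separate \<open>v\<close> from the union.\<close>

lemma in_closure_Union:
  assumes "finite \<D>" "in_closure n (\<Union>\<D>) v"
  shows "\<exists>D\<in>\<D>. in_closure n D v"
proof (rule ccontr)
  assume "\<not> ?thesis"
  then have "\<forall>D\<in>\<D>. \<exists>p. snd p \<in> pf (n + 1) {fst p} \<and> (\<forall>x\<in>D. snd p (append_one x) = 0) \<and> snd p v \<noteq> 0"
    unfolding in_closure_def by (simp add: split_paired_Ex) blast
  from bchoice[OF this] obtain p where
    p: "\<forall>D\<in>\<D>. snd (p D) \<in> pf (n + 1) {fst (p D)} \<and> (\<forall>x\<in>D. snd (p D) (append_one x) = 0) \<and> snd (p D) v \<noteq> 0" by blast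
  have "(\<lambda>x. \<Prod>D\<in>\<D>. snd (p D) x) \<in> pf (n + 1) {\<Sum>D\<in>\<D>. fst (p D)}"
    using p by (intro pf_prod_homogeneous[OF assms(1)]) blast
  moreover have "(\<Prod>D\<in>\<D>. snd (p D) (append_one x)) = 0" if "x \<in> \<Union>\<D>" for x
    using that p assms(1) by (auto intro!: prod_zero)
  ultimately have "(\<Prod>D\<in>\<D>. snd (p D) v) = 0" using in_closureD[OF assms(2)] by blast
  then show False using p assms(1) by (simp add: prod_zero_iff)
qed

section \<open>Curves of degree \<open>n\<close> through the points at infinity\<close>

locale curve_through_infinity = curve_sections n n U G
  for n :: nat and U :: "'k::field_char_0 alg_closure vec set" and G +
  fixes \<alpha> :: "'k alg_closure" and C :: "'k alg_closure vec set"
  assumes n: "n = card (conjugates \<alpha>)"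
    and C: "C \<in> branches"
    and at_infinity: "\<And>\<beta>. \<beta> \<in> conjugates \<alpha> \<Longrightarrow> in_closure n C (inf_vec \<alpha> \<beta>)"
begin

lemma C_irreducible: "irreducible_set n C" and C_subset: "C \<subseteq> U" and C_infinite: "infinite C"
  using C unfolding branches_def by auto

lemma C_carrier: "x \<in> C \<Longrightarrow> x \<in> carrier_vec n"
  using dom_carrier[OF C_irreducible] .

text \<open>Two points with the same value \<open>t\<close> of the form, and the
  \<open>n - 1\<close> points at infinity of the other conjugates, would be \<open>n + 1\<close>
  points on one hyperplane.\<close>

lemma conj_form_injective:
  assumes \<beta>: "\<beta> \<in> conjugates \<alpha>"
  shows "inj_on (conj_form n \<beta>) C"
proof (rule ccontr)
  assume "\<not> ?thesis"
  then obtain x y where xy: "x \<in> C" "y \<in> C" "x \<noteq> y" "conj_form n \<beta> x = conj_form n \<beta> y" unfolding inj_on_def by blast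
  define t where "t = conj_form n \<beta> x"
  let ?u = "unit_vec (n + 1) n"
  have u: "?u \<in> carrier_vec (n + 1)" by simp
  define h0 where "h0 = conj_vec n \<beta> + (- t) \<cdot>\<^sub>v ?u"
  have h0: "h0 \<in> carrier_vec (n + 1)" unfolding h0_def using conj_vec_carrier[of n \<beta>] by simp
  have lina_h0: "lina n h0 z = conj_form n \<beta> z - t" for z
    unfolding h0_def lina_add[OF conj_vec_carrier u] lina_conj_vec lina_unit_last by simp
  have linf_h0: "linf (n + 1) h0 v = conj_form n \<beta> v - t * v $ n" for v
    unfolding h0_def linf_add[OF conj_vec_carrier u] linf_conj_vec linf_unit_last by simp
  have xc: "x \<in> carrier_vec n" "y \<in> carrier_vec n" using xy C_carrier by auto
  define Q where "Q = inf_vec \<alpha> ` (conjugates \<alpha> - {\<beta>}) \<union> {append_one x, append_one y}"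
  have last: "append_one x $ n = 1" "append_one y $ n = 1" using xc by (auto simp: append_one_index)
  have inf_last: "inf_vec \<alpha> \<gamma> $ n = 0" for \<gamma> by (rule inf_vec_last[OF n])
  have inf_c: "inf_vec \<alpha> \<gamma> \<in> carrier_vec (n + 1)" for \<gamma> by (rule inf_vec_carrier[OF n])
  have ap_c: "append_one x \<in> carrier_vec (n + 1)" "append_one y \<in> carrier_vec (n + 1)" using xc append_one_carrier by auto
  have ap_ne: "append_one x \<noteq> append_one y"
  proof
    assume eq: "append_one x = append_one y"
    have "x $ i = y $ i" if "i < n" for i
      using append_one_index[OF xc(1), of i] append_one_index[OF xc(2), of i] that unfolding eq by simp
    then have "x = y" using xc by (intro eq_vecI) auto
    then show False using xy(3) by blast
  qed
  have inj_inf: "inj_on (inf_vec \<alpha>) (conjugates \<alpha> - {\<beta>})"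
  proof
    fix \<gamma> \<delta> assume *: "\<gamma> \<in> conjugates \<alpha> - {\<beta>}" "\<delta> \<in> conjugates \<alpha> - {\<beta>}" "inf_vec \<alpha> \<gamma> = inf_vec \<alpha> \<delta>"
    then have "inf_vec \<alpha> \<gamma> = 1 \<cdot>\<^sub>v inf_vec \<alpha> \<delta>" by simp
    then show "\<gamma> = \<delta>" using inf_vec_not_proportional[OF n, of \<gamma> \<delta> 1] * by blast
  qed
  have disj: "inf_vec \<alpha> ` (conjugates \<alpha> - {\<beta>}) \<inter> {append_one x, append_one y} = {}"
    using last inf_last by (auto dest: arg_cong[of _ _ "\<lambda>v :: 'k alg_closure vec. v $ n"])
  have "card Q = n + 1"
  proof -
    have "card (inf_vec \<alpha> ` (conjugates \<alpha> - {\<beta>})) = n - 1"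
      using card_image[OF inj_inf] finite_conjugates[of \<alpha>] \<beta> n by simp
    moreover have "n > 0" unfolding n using \<beta> finite_conjugates[of \<alpha>] by (auto simp: card_gt_0_iff)
    ultimately show ?thesis
      unfolding Q_def using disj ap_ne finite_conjugates[of \<alpha>] by (subst card_Un_disjoint) auto
  qed
  moreover have "card Q \<le> n"
  proof (rule hyperplane_count[OF C h0])
    \<comment> \<open>The curve does not lie in this hyperplane, since its closure contains the
      point of \<beta> at infinity, where the form of \<beta> is nonzero.\<close>
    show "\<exists>z\<in>C. lina n h0 z \<noteq> 0"
    proof (rule ccontr)
      assume "\<not> ?thesis"
      then have "linf (n + 1) h0 (append_one z) = 0" if "z \<in> C" for z
        using that lina_append_one[OF C_carrier[OF that], of h0] by auto
      then have "linf (n + 1) h0 (inf_vec \<alpha> \<beta>) = 0" using in_closureD[OF at_infinity[OF \<beta>] linf_pf] by blast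
      then show False unfolding linf_h0 inf_last using conj_form_inf_vec[OF n \<beta> \<beta>] by simp
    qed
    show "finite Q" unfolding Q_def using finite_conjugates by auto
    show "Q \<subseteq> carrier_vec (n + 1)" unfolding Q_def using inf_c ap_c by auto
    fix q assume "q \<in> Q"
    then consider \<gamma> where "\<gamma> \<in> conjugates \<alpha>" "\<gamma> \<noteq> \<beta>" "q = inf_vec \<alpha> \<gamma>" | z where "z \<in> {x, y}" "q = append_one z"
      unfolding Q_def by blast
    then show "q \<noteq> 0\<^sub>v (n + 1) \<and> in_closure n C q \<and> linf (n + 1) h0 q = 0"
    proof cases
      case 1
      then show ?thesis
        using inf_vec_nonzero[OF n 1(1)] at_infinity[OF 1(1)] conj_form_inf_vec[OF n 1(1) \<beta>] inf_last
        unfolding linf_h0 by simp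
    next
      case 2
      then have z: "z \<in> C" "z \<in> carrier_vec n" "conj_form n \<beta> z = t" using xy xc t_def by auto
      then show ?thesis
        using append_one_nonzero[OF z(2)] in_closure_point[OF z(1)] lina_append_one[OF z(2), of h0] lina_h0[of z]
        unfolding 2(2) by simp
    qed
  next
    fix q q' c assume q: "q \<in> Q" "q' \<in> Q" "q \<noteq> q'"
    show "q \<noteq> c \<cdot>\<^sub>v q'"
    proof
      assume eq: "q = c \<cdot>\<^sub>v q'"
      have q'c: "q' \<in> carrier_vec (n + 1)" using q(2) inf_c ap_c unfolding Q_def by auto
      then have qn: "q $ n = c * q' $ n" unfolding eq by simp
      consider (aa) "q \<in> {append_one x, append_one y}" "q' \<in> {append_one x, append_one y}"
        | (ai) \<gamma> where "q \<in> {append_one x, append_one y}" "q' = inf_vec \<alpha> \<gamma>"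
        | (ia) \<gamma> where "\<gamma> \<in> conjugates \<alpha>" "q = inf_vec \<alpha> \<gamma>" "q' \<in> {append_one x, append_one y}"
        | (ii) \<gamma> \<delta> where "\<gamma> \<in> conjugates \<alpha>" "\<delta> \<in> conjugates \<alpha>" "q = inf_vec \<alpha> \<gamma>" "q' = inf_vec \<alpha> \<delta>"
        using q(1,2) unfolding Q_def by blast
      then show False
      proof cases
        case aa
        then have "c = 1" using qn last by auto
        then show ?thesis using eq q(3) by simp
      next
        case ai
        then show ?thesis using qn last inf_last by auto
      next
        case ia
        then have "c = 0" using qn last inf_last by auto
        then have "inf_vec \<alpha> \<gamma> = 0\<^sub>v (n + 1)" using eq ia(2) q'c by auto
        then show ?thesis using inf_vec_nonzero[OF n ia(1)] by blast
      next
        case ii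
        then have "\<gamma> \<noteq> \<delta>" using q(3) by blast
        from inf_vec_not_proportional[OF n ii(1,2) this, of c] show ?thesis using eq unfolding ii(3,4) by (rule notE)
      qed
    qed
  qed
  ultimately show False by simp
qed

lemma conj_form_transcendental:
  assumes \<beta>: "\<beta> \<in> conjugates \<alpha>" and P: "\<forall>x\<in>C. poly P (conj_form n \<beta> x) = 0"
  shows "P = 0"
proof (rule ccontr)
  assume "P \<noteq> 0"
  then have "finite (conj_form n \<beta> ` C)"
    using P by (intro finite_subset[OF _ poly_roots_finite[of P]]) auto
  then show False using finite_imageD[OF _ conj_form_injective[OF \<beta>]] C_infinite by blast
qed

text \<open>The form is transcendental on \<open>C\<close>, so the fibres over all but finitely many
  values contain a point.\<close>

lemma conj_form_cofinite:
  assumes \<beta>: "\<beta> \<in> conjugates \<alpha>"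
  shows "\<exists>B. finite B \<and> (\<forall>e. e \<notin> B \<longrightarrow> (\<exists>x\<in>C. conj_form n \<beta> x = e))"
proof -
  obtain x0 where x0: "x0 \<in> C" using irreducible_setD(2)[OF C_irreducible] by blast
  have "no_relation C (conj_form n \<beta>) (\<lambda>x. 0) (\<lambda>x. 1) 1"
    unfolding no_relation_def using conj_form_transcendental[OF \<beta>] by simp
  then have "\<exists>B. finite B \<and> (\<forall>e. e \<notin> B \<longrightarrow> (\<exists>A. finite A \<and> card A = 1 \<and> A \<subseteq> C \<and>
           (\<forall>x\<in>A. (1 :: 'k alg_closure) \<noteq> 0 \<and> (1 :: 'k alg_closure) \<noteq> 0 \<and> conj_form n \<beta> x = e * 1)))"
    using x0 by (intro fibre_points[OF C_irreducible conj_form_pf pf_zero]) (auto intro: pf_const)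
  then obtain B where B: "finite B" "\<And>e. e \<notin> B \<Longrightarrow> \<exists>A. finite A \<and> card A = 1 \<and> A \<subseteq> C \<and> (\<forall>x\<in>A. conj_form n \<beta> x = e)"
    by auto
  have "\<exists>x\<in>C. conj_form n \<beta> x = e" if e: "e \<notin> B" for e
  proof -
    obtain A where A: "card A = 1" "A \<subseteq> C" "\<forall>x\<in>A. conj_form n \<beta> x = e" using B(2)[OF e] by blast
    then obtain x where "A = {x}" by (metis card_1_singletonE)
    then show ?thesis using A by auto
  qed
  then show ?thesis using B(1) by blast
qed

text \<open>If the form of \<gamma> were not rational in that of \<beta>, generic fibres of the
  latter would have two points, against injectivity. A common factor of the two coefficients can be
  cancelled because the form of \<beta> is transcendental.\<close>

lemma coprime_relation:
  assumes \<beta>: "\<beta> \<in> conjugates \<alpha>" and \<gamma>: "\<gamma> \<in> conjugates \<alpha>"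
  shows "\<exists>P Q. coprime P Q \<and> Q \<noteq> 0 \<and> (\<forall>x\<in>C. poly P (conj_form n \<beta> x) + poly Q (conj_form n \<beta> x) * conj_form n \<gamma> x = 0)"
proof -
  obtain x0 where x0: "x0 \<in> C" using irreducible_setD(2)[OF C_irreducible] by blast
  have "\<not> no_relation C (conj_form n \<beta>) (conj_form n \<gamma>) (\<lambda>x. 1) 2"
  proof
    assume "no_relation C (conj_form n \<beta>) (conj_form n \<gamma>) (\<lambda>x. 1) 2"
    then have "\<exists>B. finite B \<and> (\<forall>e. e \<notin> B \<longrightarrow> (\<exists>A. finite A \<and> card A = 2 \<and> A \<subseteq> C \<and>
           (\<forall>x\<in>A. (1 :: 'k alg_closure) \<noteq> 0 \<and> (1 :: 'k alg_closure) \<noteq> 0 \<and> conj_form n \<beta> x = e * 1)))"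
      using x0 by (intro fibre_points[OF C_irreducible conj_form_pf conj_form_pf] pf_const) auto
    then obtain B where B: "finite B" "\<And>e. e \<notin> B \<Longrightarrow> \<exists>A. finite A \<and> card A = 2 \<and> A \<subseteq> C \<and> (\<forall>x\<in>A. conj_form n \<beta> x = e)"
      by auto
    obtain e where "e \<notin> B" using ex_new_if_finite[OF infinite_UNIV_char_0 B(1)] by blast
    then obtain A where A: "card A = 2" "A \<subseteq> C" "\<forall>x\<in>A. conj_form n \<beta> x = e" using B(2) by blast
    then obtain x y where "A = {x, y}" "x \<noteq> y" by (metis card_2_iff)
    then show False using A conj_form_injective[OF \<beta>] unfolding inj_on_def by auto
  qed
  then obtain R i where R: "\<forall>x\<in>C. (\<Sum>i<2. poly (R i) (conj_form n \<beta> x) * conj_form n \<gamma> x ^ i) = 0"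
    and i: "i < 2" "R i \<noteq> 0" unfolding no_relation_def by auto
  have R: "poly (R 0) (conj_form n \<beta> x) + poly (R 1) (conj_form n \<beta> x) * conj_form n \<gamma> x = 0" if "x \<in> C" for x
    using R that by (simp add: numeral_2_eq_2)
  have R1: "R 1 \<noteq> 0"
  proof
    assume "R 1 = 0"
    moreover then have "R 0 = 0" using R by (intro conj_form_transcendental[OF \<beta>]) simp
    moreover have "i = 0 \<or> i = 1" using i(1) by linarith
    ultimately show False using i(2) by auto
  qed
  define g where "g = gcd (R 0) (R 1)"
  have g0: "g \<noteq> 0" unfolding g_def using R1 by simp
  obtain P Q where PQ: "R 0 = g * P" "R 1 = g * Q" and cop: "coprime P Q"
    using gcd_coprime_exists[of "R 0" "R 1"] g0 unfolding g_def by (metis mult.commute)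
  define f where "f x = poly P (conj_form n \<beta> x) + poly Q (conj_form n \<beta> x) * conj_form n \<gamma> x" for x
  have "\<forall>x\<in>C. poly g (conj_form n \<beta> x) * f x = 0" using R unfolding PQ f_def by (simp add: algebra_simps)
  moreover have "f \<in> pf n UNIV" unfolding f_def by (intro pf_add pf_times pf_poly conj_form_pf)
  ultimately have "(\<forall>x\<in>C. poly g (conj_form n \<beta> x) = 0) \<or> (\<forall>x\<in>C. f x = 0)"
    by (intro irreducible_set_prime[OF C_irreducible] pf_poly conj_form_pf)
  then have "\<forall>x\<in>C. f x = 0" using conj_form_transcendental[OF \<beta>] g0 by blast
  moreover have "Q \<noteq> 0" using R1 PQ by auto
  ultimately show ?thesis using cop unfolding f_def by blast
qed

text \<open>The coefficients have degree at most one: otherwise a generic level set of \<open>- P / Q\<close>, having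
  simple roots by the Wronskian, would violate the injectivity of \<open>conj_form n \<gamma>\<close>.\<close>

lemma bilinear_relation:
  assumes \<beta>: "\<beta> \<in> conjugates \<alpha>" and \<gamma>: "\<gamma> \<in> conjugates \<alpha>"
  shows "\<exists>p0 p1 q0 q1. (q0 \<noteq> 0 \<or> q1 \<noteq> 0) \<and>
    (\<forall>x\<in>C. p0 + p1 * conj_form n \<beta> x + (q0 + q1 * conj_form n \<beta> x) * conj_form n \<gamma> x = 0)"
proof -
  obtain P Q where cop: "coprime P Q" and Q0: "Q \<noteq> 0"
    and rel: "\<And>x. x \<in> C \<Longrightarrow> poly P (conj_form n \<beta> x) + poly Q (conj_form n \<beta> x) * conj_form n \<gamma> x = 0"
    using coprime_relation[OF assms] by blast
  obtain B where B: "finite B" "\<And>e. e \<notin> B \<Longrightarrow> \<exists>x\<in>C. conj_form n \<beta> x = e" using conj_form_cofinite[OF \<beta>] by blast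
  have common: "poly P s \<noteq> 0 \<or> poly Q s \<noteq> 0" for s
    using cop coprime_poly_0[of P Q s] by blast
  define w where "w = P * pderiv Q - Q * pderiv P"
  \<comment> \<open>With \<open>P\<close> and \<open>Q\<close> coprime, a zero Wronskian makes each
    divide its derivative, so both are constant. The relation would then be an equation for the form
    of \<gamma> alone.\<close>
  have w0: "w \<noteq> 0"
  proof
    assume "w = 0"
    then have eq: "P * pderiv Q = Q * pderiv P" unfolding w_def by simp
    have "Q dvd pderiv Q" using cop eq by (metis coprime_commute coprime_dvd_mult_right_iff dvd_triv_left)
    moreover have "P dvd pderiv P" using cop eq by (metis coprime_dvd_mult_right_iff dvd_triv_left)
    moreover have const: "degree R = 0" if "R dvd pderiv R" for R :: "'k alg_closure poly"
    proof (rule ccontr)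
      assume d: "degree R \<noteq> 0"
      then have "pderiv R \<noteq> 0" by (simp add: pderiv_eq_0_iff)
      then have "degree R \<le> degree (pderiv R)" using that by (intro dvd_imp_degree_le)
      then show False using d by (simp add: degree_pderiv)
    qed
    ultimately obtain p0 q0 where pq: "P = [:p0:]" "Q = [:q0:]" by (metis degree_eq_zeroE)
    have "\<forall>x\<in>C. poly [:p0, q0:] (conj_form n \<gamma> x) = 0" using rel unfolding pq by (simp add: mult.commute)
    then show False using conj_form_transcendental[OF \<gamma>] Q0 pq(2) by fastforce
  qed
  define m where "m = max (degree P) (degree Q)"
  have "m \<le> 1"
  proof (rule ccontr)
    assume m: "\<not> m \<le> 1"
    define bad where "bad = B \<union> {s. poly w s = 0}"
    have finbad: "finite bad" unfolding bad_def using B(1) poly_roots_finite[OF w0] by simp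
    \<comment> \<open>As a polynomial in c, this is the coefficient of P + c Q in degree
      \<open>m\<close>; avoiding its root keeps the degree.\<close>
    define L where "L = [:coeff P m, coeff Q m:]"
    have "L \<noteq> 0"
    proof
      assume "L = 0"
      then have c: "coeff P m = 0" "coeff Q m = 0" unfolding L_def by auto
      consider "degree P = m" | "degree Q = m" unfolding m_def by linarith
      then show False using c m Q0 by cases auto
    qed
    \<comment> \<open>The level c avoids the values of -P / Q at zeros of the Wronskian and at
      values that the form of \<beta> may omit. So all roots of P + c Q are simple and come from
      points of \<open>C\<close>.\<close>
    then have "finite ((\<lambda>s. - poly P s / poly Q s) ` bad \<union> {c. poly L c = 0})"
      using finbad poly_roots_finite by blast
    then obtain c where "c \<notin> (\<lambda>s. - poly P s / poly Q s) ` bad \<union> {c. poly L c = 0}"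
      using ex_new_if_finite[OF infinite_UNIV_char_0] by metis
    then have c: "c \<notin> (\<lambda>s. - poly P s / poly Q s) ` bad" "poly L c \<noteq> 0" by auto
    define R where "R = P + smult c Q"
    have "degree R \<le> m" unfolding R_def m_def
      by (intro degree_add_le order_trans[OF degree_smult_le]) auto
    moreover have "coeff R m \<noteq> 0" using c(2) unfolding R_def L_def by simp
    ultimately have degR: "degree R = m" using le_degree by (metis le_antisym)
    have root: "poly Q s \<noteq> 0 \<and> c = - poly P s / poly Q s \<and> s \<notin> bad" if s: "poly R s = 0" for s
    proof -
      have eq: "poly P s + c * poly Q s = 0" using s unfolding R_def by simp
      then have Qs: "poly Q s \<noteq> 0" using common[of s] by auto
      have "poly P s = - (c * poly Q s)" using eq by (simp add: eq_neg_iff_add_eq_0)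
      then have cs: "c = - poly P s / poly Q s" using Qs by simp
      then have "s \<notin> bad" using c(1) by blast
      then show ?thesis using Qs cs by blast
    qed
    have "card {s. poly R s = 0} = degree R"
    proof (rule card_simple_roots)
      fix s assume s: "poly R s = 0"
      show "poly (pderiv R) s \<noteq> 0"
      proof
        assume d: "poly (pderiv R) s = 0"
        have "poly P s = - (c * poly Q s)" using s unfolding R_def by (simp add: eq_neg_iff_add_eq_0)
        moreover have "poly (pderiv P) s = - (c * poly (pderiv Q) s)"
          using d unfolding R_def by (simp add: pderiv_add pderiv_smult eq_neg_iff_add_eq_0)
        ultimately have "poly w s = 0" unfolding w_def by (simp add: algebra_simps)
        then show False using root[OF s] unfolding bad_def by blast
      qed
    qed
    then have "2 \<le> card {s. poly R s = 0}" using m degR by simp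
    then obtain A where "A \<subseteq> {s. poly R s = 0}" "card A = 2" by (metis obtain_subset_with_card_n)
    then obtain s t where st: "s \<noteq> t" "poly R s = 0" "poly R t = 0" by (auto simp: card_2_iff)
    have "\<exists>x\<in>C. conj_form n \<beta> x = s \<and> conj_form n \<gamma> x = c" if s: "poly R s = 0" for s
    proof -
      have "s \<notin> B" using root[OF s] unfolding bad_def by blast
      then obtain x where x: "x \<in> C" "conj_form n \<beta> x = s" using B(2) by blast
      have "poly Q s * conj_form n \<gamma> x = - poly P s" using rel[OF x(1)] x(2) by (simp add: eq_neg_iff_add_eq_0 add.commute)
      also have "\<dots> = poly Q s * c" using root[OF s] by simp
      finally have "poly Q s * conj_form n \<gamma> x = poly Q s * c" .
      moreover have "poly Q s \<noteq> 0" using root[OF s] by blast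
      ultimately have "conj_form n \<gamma> x = c" by (metis mult_left_cancel)
      then show ?thesis using x by blast
    qed
    then obtain x y where "x \<in> C" "y \<in> C" "conj_form n \<beta> x = s" "conj_form n \<beta> y = t" "conj_form n \<gamma> x = conj_form n \<gamma> y"
      using st(2,3) by metis
    then show False using conj_form_injective[OF \<gamma>] st(1) unfolding inj_on_def by blast
  qed
  then have deg: "degree P \<le> 1" "degree Q \<le> 1" unfolding m_def by auto
  have lin: "R = [:coeff R 0, coeff R 1:]" if "degree R \<le> 1" for R :: "'k alg_closure poly"
  proof (rule poly_eqI)
    fix i
    show "coeff R i = coeff [:coeff R 0, coeff R 1:] i"
      using that by (cases i; cases "i - 1") (auto simp: coeff_eq_0)
  qed
  have "coeff Q 0 \<noteq> 0 \<or> coeff Q 1 \<noteq> 0" using lin[OF deg(2)] Q0 by auto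
  moreover have "poly R z = coeff R 0 + coeff R 1 * z" if "degree R \<le> 1" for R :: "'k alg_closure poly" and z
    by (subst lin[OF that]) (simp add: mult.commute)
  ultimately show ?thesis using rel deg
    by (intro exI[of _ "coeff P 0"] exI[of _ "coeff P 1"] exI[of _ "coeff Q 0"] exI[of _ "coeff Q 1"]) auto
qed

text \<open>A unit is fixed by its values at \<open>0\<close>, \<open>1\<close> and \<open>\<infinity>\<close>, for which three points over the base field are used.\<close>

lemma is_hypercircle:
  fixes S :: "'k alg_closure vec set"
  assumes UC: "U = C" and ext: "n = ext_degree \<alpha>" and S: "infinite S" "S \<subseteq> U" "\<And>x i. x \<in> S \<Longrightarrow> i < n \<Longrightarrow> x $ i \<in> base_field"
  shows "hypercircle \<alpha> U"
proof -
  let ?C = "conjugates \<alpha>"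
  have "\<forall>x\<in>S. \<exists>h. \<forall>\<gamma>. conj_form n \<gamma> x = pe h \<gamma>"
  proof
    fix x assume "x \<in> S"
    then have "\<forall>i. \<exists>k. i < n \<longrightarrow> x $ i = to_ac k" using S(3) unfolding base_field_def by blast
    then obtain k where k: "\<And>i. i < n \<Longrightarrow> x $ i = to_ac (k i)" by metis
    have "conj_form n \<gamma> x = pe (\<Sum>i<n. monom (k i) i) \<gamma>" for \<gamma>
      unfolding conj_form_def pe_sum pe_monom using k by (intro sum.cong) (auto simp: mult.commute)
    then show "\<exists>h. \<forall>\<gamma>. conj_form n \<gamma> x = pe h \<gamma>" by blast
  qed
  from bchoice[OF this] obtain h where h: "\<forall>x\<in>S. \<forall>\<gamma>. conj_form n \<gamma> x = pe (h x) \<gamma>" by blast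
  obtain T where T: "T \<subseteq> S" "card T = 3" using infinite_arbitrarily_large[OF S(1)] by metis
  then obtain x0 x1 x2 where "T = {x0, x1, x2}" and ne: "x0 \<noteq> x1" "x0 \<noteq> x2" "x1 \<noteq> x2" by (auto simp: card_3_iff)
  then have xS: "x0 \<in> S" "x1 \<in> S" "x2 \<in> S" using T by auto
  define b0 b1 b2 where "b0 = h x0" and "b1 = h x1" and "b2 = h x2"
  have cf: "conj_form n \<gamma> x0 = pe b0 \<gamma>" "conj_form n \<gamma> x1 = pe b1 \<gamma>" "conj_form n \<gamma> x2 = pe b2 \<gamma>" for \<gamma>
    using h xS unfolding b0_def b1_def b2_def by auto
  have xC: "x0 \<in> C" "x1 \<in> C" "x2 \<in> C" using xS S(2) UC by auto
  have bne: "pe b0 \<alpha> \<noteq> pe b1 \<alpha>" "pe b0 \<alpha> \<noteq> pe b2 \<alpha>" "pe b1 \<alpha> \<noteq> pe b2 \<alpha>"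
    using ne xC conj_form_injective[OF self_conjugate] unfolding cf[symmetric] inj_on_def by blast+
  \<comment> \<open>The unit (a t + b) / (c t + d) takes the values b0, b1, b2 at 0, 1 and infinity,
    and so do its conjugates with the conjugate values. The coefficients are polynomials over
    K.\<close>
  define a b c d where "a = b2 * (b1 - b0)" and "b = b0 * (b2 - b1)" and "c = b1 - b0" and "d = b2 - b1"
  note abcd = a_def b_def c_def d_def
  have det: "pe (a * d - b * c) \<alpha> \<noteq> 0"
  proof -
    have "pe (a * d - b * c) \<alpha> = (pe b1 \<alpha> - pe b0 \<alpha>) * (pe b2 \<alpha> - pe b1 \<alpha>) * (pe b2 \<alpha> - pe b0 \<alpha>)"
      unfolding abcd pe_diff pe_mult by (simp add: algebra_simps)
    then show ?thesis using bne by auto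
  qed
  have c0: "pe c \<alpha> \<noteq> 0" unfolding c_def pe_diff using bne by simp
  obtain \<phi> where \<phi>: "\<forall>i<n. \<phi> i \<in> ratfuns base_field"
    "Fract [:pe b \<alpha>, pe a \<alpha>:] [:pe d \<alpha>, pe c \<alpha>:] = (\<Sum>i<n. \<phi> i * to_fract [:\<alpha> ^ i:])"
    using unit_decomposition[OF n pe_in_adjoin pe_in_adjoin pe_in_adjoin pe_in_adjoin c0] by blast
  obtain p q where pq: "q \<noteq> 0" "\<forall>i<n. \<phi> i = Fract (mp (p i)) (mp q)"
    "\<forall>\<beta>\<in>?C. (\<Sum>i<n. smult (\<beta> ^ i) (mp (p i))) * [:pe d \<beta>, pe c \<beta>:] = mp q * [:pe b \<beta>, pe a \<beta>:]"
    using unit_conjugates[of n \<phi> b \<alpha> a d c] \<phi> c0 by auto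
  interpret P: unit_param \<alpha> n a b c d q p \<phi>
    by unfold_locales (use n det pq in auto)
  have "\<forall>\<gamma>\<in>?C. \<exists>k. (fst (snd (snd k)) \<noteq> 0 \<or> snd (snd (snd k)) \<noteq> 0) \<and>
    (\<forall>x\<in>C. fst k + fst (snd k) * conj_form n \<alpha> x + (fst (snd (snd k)) + snd (snd (snd k)) * conj_form n \<alpha> x) * conj_form n \<gamma> x = 0)"
    using bilinear_relation[OF self_conjugate] by (simp add: split_paired_Ex)
  from bchoice[OF this] obtain k where k: "\<forall>\<gamma>\<in>?C. (fst (snd (snd (k \<gamma>))) \<noteq> 0 \<or> snd (snd (snd (k \<gamma>))) \<noteq> 0) \<and>
    (\<forall>x\<in>C. fst (k \<gamma>) + fst (snd (k \<gamma>)) * conj_form n \<alpha> x +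
      (fst (snd (snd (k \<gamma>))) + snd (snd (snd (k \<gamma>))) * conj_form n \<alpha> x) * conj_form n \<gamma> x = 0)" by blast
  define p0 p1 q0 q1 where "p0 \<gamma> = fst (k \<gamma>)" and "p1 \<gamma> = fst (snd (k \<gamma>))" and "q0 \<gamma> = fst (snd (snd (k \<gamma>)))"
    and "q1 \<gamma> = snd (snd (snd (k \<gamma>)))" for \<gamma>
  have q01: "q0 \<gamma> \<noteq> 0 \<or> q1 \<gamma> \<noteq> 0" if "\<gamma> \<in> ?C" for \<gamma> using k that unfolding q0_def q1_def by blast
  have rel: "p0 \<gamma> + p1 \<gamma> * conj_form n \<alpha> x + (q0 \<gamma> + q1 \<gamma> * conj_form n \<alpha> x) * conj_form n \<gamma> x = 0"
    if "\<gamma> \<in> ?C" "x \<in> C" for \<gamma> x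
    using k that unfolding p0_def p1_def q0_def q1_def by blast
  have relZ: "p0 \<gamma> + p1 \<gamma> * conj_form n \<alpha> (P.Z t) + (q0 \<gamma> + q1 \<gamma> * conj_form n \<alpha> (P.Z t)) * conj_form n \<gamma> (P.Z t) = 0"
    if \<gamma>: "\<gamma> \<in> ?C" and t: "t \<in> P.good" for \<gamma> t
  proof -
    define y z where "y = conj_form n \<alpha> (P.Z t)" and "z = conj_form n \<gamma> (P.Z t)"
    define E where "E y z = p0 \<gamma> + p1 \<gamma> * y + (q0 \<gamma> + q1 \<gamma> * y) * z" for y z
    \<comment> \<open>The bihomogeneous version of the bilinear relation \<open>E\<close>. Along the
      parametrization it is a quadratic polynomial in t, and the three chosen points of
      \<open>C\<close> make it vanish at 0, 1 and infinity.\<close>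
    define F where "F y1 y2 z1 z2 = p0 \<gamma> * y2 * z2 + p1 \<gamma> * y1 * z2 + q0 \<gamma> * y2 * z1 + q1 \<gamma> * y1 * z1" for y1 y2 z1 z2
    have F: "F (y * u) u (z * v) v = E y z * u * v" for y z u v unfolding F_def E_def by (simp add: algebra_simps)
    have e0: "F (pe b \<alpha>) (pe d \<alpha>) (pe b \<gamma>) (pe d \<gamma>) = 0"
      using rel[OF \<gamma> xC(1)] F[of "pe b0 \<alpha>" "pe d \<alpha>" "pe b0 \<gamma>" "pe d \<gamma>"]
      unfolding cf E_def abcd by (simp add: pe_mult pe_diff)
    have e2: "F (pe a \<alpha>) (pe c \<alpha>) (pe a \<gamma>) (pe c \<gamma>) = 0"
      using rel[OF \<gamma> xC(3)] F[of "pe b2 \<alpha>" "pe c \<alpha>" "pe b2 \<gamma>" "pe c \<gamma>"]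
      unfolding cf E_def abcd by (simp add: pe_mult pe_diff)
    have ab: "pe a \<delta> + pe b \<delta> = pe b1 \<delta> * (pe c \<delta> + pe d \<delta>)" for \<delta>
      unfolding abcd pe_diff pe_mult by (simp add: algebra_simps)
    have e1: "F (pe a \<alpha> + pe b \<alpha>) (pe c \<alpha> + pe d \<alpha>) (pe a \<gamma> + pe b \<gamma>) (pe c \<gamma> + pe d \<gamma>) = 0"
      unfolding ab F using rel[OF \<gamma> xC(2)] unfolding cf E_def by simp
    \<comment> \<open>A quadratic polynomial is recovered from its values at 0 and 1 and its leading
      coefficient, which is its value at infinity.\<close>
    have "F (pe a \<alpha> * t + pe b \<alpha>) (pe c \<alpha> * t + pe d \<alpha>) (pe a \<gamma> * t + pe b \<gamma>) (pe c \<gamma> * t + pe d \<gamma>) =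
      F (pe b \<alpha>) (pe d \<alpha>) (pe b \<gamma>) (pe d \<gamma>) * (1 - t) + t * (t - 1) * F (pe a \<alpha>) (pe c \<alpha>) (pe a \<gamma>) (pe c \<gamma>)
      + t * F (pe a \<alpha> + pe b \<alpha>) (pe c \<alpha> + pe d \<alpha>) (pe a \<gamma> + pe b \<gamma>) (pe c \<gamma> + pe d \<gamma>)"
      unfolding F_def by (simp add: algebra_simps)
    then have "F (y * (pe c \<alpha> * t + pe d \<alpha>)) (pe c \<alpha> * t + pe d \<alpha>) (z * (pe c \<gamma> * t + pe d \<gamma>)) (pe c \<gamma> * t + pe d \<gamma>) = 0"
      unfolding y_def z_def P.conj_form_Z(1)[OF self_conjugate t] P.conj_form_Z(1)[OF \<gamma> t] e0 e1 e2 by simp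
    then have "E y z = 0" unfolding F using P.conj_form_Z(2)[OF self_conjugate t] P.conj_form_Z(2)[OF \<gamma> t] by simp
    then show ?thesis unfolding E_def y_def z_def .
  qed
  obtain B where B: "finite B" "\<And>e. e \<notin> B \<Longrightarrow> \<exists>x\<in>C. conj_form n \<alpha> x = e"
    using conj_form_cofinite[OF self_conjugate] by blast
  \<comment> \<open>Values of the form of \<alpha> that may not occur on \<open>C\<close>, or at
    which the relation does not determine the form of some conjugate.\<close>
  define bad where "bad = B \<union> (\<lambda>\<gamma>. - q0 \<gamma> / q1 \<gamma>) ` ?C"
  have finbad: "finite bad" unfolding bad_def using B(1) finite_conjugates by auto
  define T where "T = {t \<in> P.good. conj_form n \<alpha> (P.Z t) \<notin> bad}"
  have "infinite T"
  proof
    assume "finite T"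
    have "(\<lambda>t. conj_form n \<alpha> (P.Z t)) ` (P.good - T) \<subseteq> bad" unfolding T_def by auto
    then have "finite ((\<lambda>t. conj_form n \<alpha> (P.Z t)) ` (P.good - T))" using finbad finite_subset by blast
    then have "finite (P.good - T)" by (rule finite_imageD) (rule inj_on_subset[OF P.conj_form_Z_inj], auto)
    then show False using \<open>finite T\<close> P.infinite_good by simp
  qed
  \<comment> \<open>A point of \<open>C\<close> with the same value of the form of \<alpha>
    satisfies the same relations as \<open>P.Z t\<close>, hence has the same conjugate forms and
    coincides with it.\<close>
  have Z_U: "P.Z t \<in> U" if t: "t \<in> T" for t
  proof -
    have tg: "t \<in> P.good" and nb: "conj_form n \<alpha> (P.Z t) \<notin> bad" using t unfolding T_def by auto
    obtain x where x: "x \<in> C" "conj_form n \<alpha> x = conj_form n \<alpha> (P.Z t)" using B(2) nb unfolding bad_def by blast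
    have "conj_form n \<gamma> x = conj_form n \<gamma> (P.Z t)" if \<gamma>: "\<gamma> \<in> ?C" for \<gamma>
    proof -
      let ?y = "conj_form n \<alpha> (P.Z t)"
      have "q0 \<gamma> + q1 \<gamma> * ?y \<noteq> 0"
      proof
        assume 0: "q0 \<gamma> + q1 \<gamma> * ?y = 0"
        then have q1: "q1 \<gamma> \<noteq> 0" using q01[OF \<gamma>] by auto
        have "q1 \<gamma> * ?y = - q0 \<gamma>" using 0 by (simp add: eq_neg_iff_add_eq_0 add.commute)
        moreover have "?y = (q1 \<gamma> * ?y) / q1 \<gamma>" using q1 by simp
        ultimately have "?y = - q0 \<gamma> / q1 \<gamma>" by (simp only:)
        then show False using nb \<gamma> unfolding bad_def by blast
      qed
      moreover have "(q0 \<gamma> + q1 \<gamma> * ?y) * conj_form n \<gamma> x = (q0 \<gamma> + q1 \<gamma> * ?y) * conj_form n \<gamma> (P.Z t)"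
      proof -
        have cancel: "u = v" if "w + u = 0" "w + v = 0" for u v w :: "'k alg_closure"
          using that by (metis add_left_cancel)
        show ?thesis by (rule cancel[OF rel[OF \<gamma> x(1), unfolded x(2)] relZ[OF \<gamma> tg]])
      qed
      ultimately show ?thesis by simp
    qed
    then have "x = P.Z t" by (intro conj_form_inject[OF finite_conjugates n[symmetric] C_carrier[OF x(1)] P.Z_carrier])
    then show ?thesis using x(1) UC by simp
  qed
  have "P.H \<subseteq> U"
  proof
    fix x assume x: "x \<in> P.H"
    show "x \<in> U"
    proof (rule algebraic_set_mem[OF U])
      show "x \<in> carrier_vec n" using x P.H_carrier by blast
      fix f assume f: "f \<in> pf n UNIV" "\<forall>y\<in>U. f y = 0"
      show "f x = 0" by (rule P.H_zero[OF f(1) \<open>infinite T\<close> _ x]) (use Z_U f(2) in blast)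
    qed
  qed
  moreover have "infinite P.H" using P.infinite_base_points by (rule contrapos_nn) simp
  \<comment> \<open>The hypercircle is an infinite irreducible closed subset of
    \<open>U = C\<close>, and branches are not nested, so it is all of \<open>U\<close>.\<close>
  ultimately have "P.H \<in> branches" unfolding branches_def using P.H_irreducible by blast
  then have UH: "U = P.H" using branch_eqI[of P.H C] C UC \<open>P.H \<subseteq> U\<close> by blast
  have "is_unit_over (adjoin \<alpha>) (Fract [:pe b \<alpha>, pe a \<alpha>:] [:pe d \<alpha>, pe c \<alpha>:])"
    unfolding is_unit_over_def using det
    by (intro bexI[of _ "pe a \<alpha>"] bexI[of _ "pe b \<alpha>"] bexI[of _ "pe c \<alpha>"] bexI[of _ "pe d \<alpha>"] pe_in_adjoin)
      (simp add: pe_diff pe_mult)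
  then show ?thesis
    unfolding hypercircle_def Let_def ext[symmetric] UH P.H_def P.img_def using \<phi>
    by (intro exI[of _ "Fract [:pe b \<alpha>, pe a \<alpha>:] [:pe d \<alpha>, pe c \<alpha>:]"] exI[of _ \<phi>]) simp
qed

end

text \<open>The conjugates number exactly \<open>n\<close>, and the counts at infinity add up to at
  most \<open>n\<close>. This leaves no room for a branch that misses all points at infinity, nor
  for a second branch beside one that contains all of them.\<close>

lemma hypercircle_of_degree:
  fixes \<alpha> :: "'k::field_char_0 alg_closure" and U :: "'k alg_closure vec set"
  assumes nn: "n = card (conjugates \<alpha>)" "n = ext_degree \<alpha>" and U: "algebraic_set n U" and deg: "has_curve_degree n U n"
    and dim: "\<forall>C\<in>components n U. zariski_dim n C = 1"
    and S: "infinite {x \<in> U. \<forall>i<n. x $ i \<in> base_field}"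
    and cl: "\<And>\<beta>. \<beta> \<in> conjugates \<alpha> \<Longrightarrow> in_closure n U (inf_vec \<alpha> \<beta>)"
  shows "hypercircle \<alpha> U"
proof -
  obtain G where G: "G \<in> mpols (n + 1)" "G \<noteq> 0"
    "\<And>a. a \<in> carrier_vec (n + 1) \<Longrightarrow> mpol_eval G a \<noteq> 0 \<Longrightarrow>
           finite {x \<in> U. a \<bullet> append_one x = 0} \<and> card {x \<in> U. a \<bullet> append_one x = 0} = n"
    using deg unfolding has_curve_degree_def by blast
  have "a \<bullet> append_one x = lina n a x" if "x \<in> U" for a x
  proof -
    have "x \<in> carrier_vec n" using that algebraic_set_carrier[OF U] by blast
    then show ?thesis using lina_append_one[of x n a] linf_scalar_prod[OF append_one_carrier, of x n a] by simp
  qed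
  then have "{x \<in> U. a \<bullet> append_one x = 0} = {x \<in> U. lina n a x = 0}" for a by auto
  then interpret curve_sections n n U "mpol_eval G"
    using U mpol_eval_in_pf[OF G(1)] mpol_nonzero_value[OF G(1,2)] G(3) by unfold_locales auto
  let ?C = "conjugates \<alpha>"
  let ?S = "{x \<in> U. \<forall>i<n. x $ i \<in> base_field}"
  define Q where "Q D = {\<beta> \<in> ?C. in_closure n D (inf_vec \<alpha> \<beta>)}" for D
  have count: "(\<Sum>D\<in>branches. max 1 (card (Q D))) \<le> n"
    unfolding Q_def using finite_conjugates inf_vec_carrier[OF nn(1)] inf_vec_nonzero[OF nn(1)] inf_vec_last[OF nn(1)]
      inf_vec_not_proportional[OF nn(1)]
    by (intro count_at_infinity[OF finite_branches order_refl]) auto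
  have Ueq: "U = \<Union>branches" using branches_cover[OF dim] unfolding branches_def by blast
  have Qcover: "(\<Union>D\<in>branches. Q D) = ?C"
    using in_closure_Union[OF finite_branches] cl unfolding Ueq[symmetric] Q_def by blast
  have "\<exists>C\<in>branches. infinite (?S \<inter> C)"
  proof (rule ccontr)
    assume "\<not> ?thesis"
    then have "finite (\<Union>D\<in>branches. ?S \<inter> D)" using finite_branches by blast
    moreover have "?S \<subseteq> (\<Union>D\<in>branches. ?S \<inter> D)" using Ueq by blast
    ultimately show False using S finite_subset by blast
  qed
  then obtain C where C: "C \<in> branches" "infinite (?S \<inter> C)" by blast
  have split: "(\<Sum>D\<in>branches. max 1 (card (Q D))) = max 1 (card (Q C)) + (\<Sum>D\<in>branches - {C}. max 1 (card (Q D)))"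
    using finite_branches C(1) by (rule sum.remove)
  \<comment> \<open>Otherwise the other branches alone account for all \<open>n\<close> points, and
    \<open>C\<close> still adds the 1 from the maximum.\<close>
  have "Q C \<noteq> {}"
  proof
    assume QC: "Q C = {}"
    then have "?C = (\<Union>D\<in>branches - {C}. Q D)" using Qcover by blast
    then have "card ?C \<le> (\<Sum>D\<in>branches - {C}. card (Q D))"
      using card_UN_le[of "branches - {C}" Q] finite_branches by (metis finite_Diff)
    also have "\<dots> \<le> (\<Sum>D\<in>branches - {C}. max 1 (card (Q D)))" by (intro sum_mono) simp
    finally show False using count split nn(1) by simp
  qed
  then obtain \<beta> where \<beta>: "\<beta> \<in> ?C" "in_closure n C (inf_vec \<alpha> \<beta>)" unfolding Q_def by blast
  have Cc: "C \<subseteq> carrier_vec n" using C(1) algebraic_set_carrier irreducible_setD(1) unfolding branches_def by blast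
  have all: "in_closure n C (inf_vec \<alpha> \<gamma>)" if "\<gamma> \<in> ?C" for \<gamma>
  proof (rule in_closure_conjugate[OF nn(1) Cc, of "?S \<inter> C"])
    show "\<forall>x\<in>C. f x = 0" if "f \<in> pf n UNIV" "\<forall>x\<in>?S \<inter> C. f x = 0" for f
      using branch_dense[OF C(1) _ C(2) that] by blast
  qed (use \<beta> that in auto)
  then have QC: "Q C = ?C" unfolding Q_def by blast
  have "branches = {C}"
  proof (rule ccontr)
    assume "branches \<noteq> {C}"
    then obtain D where D: "D \<in> branches - {C}" using C(1) by blast
    have "1 \<le> max 1 (card (Q D))" by simp
    also have "\<dots> \<le> (\<Sum>D\<in>branches - {C}. max 1 (card (Q D)))"
      by (rule member_le_sum[OF D]) (use finite_branches in auto)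
    finally show False using count split QC nn(1) by simp
  qed
  then have UC: "U = C" using Ueq by simp
  interpret curve_through_infinity n U "mpol_eval G" \<alpha> C
    by unfold_locales (use nn C all in auto)
  show ?thesis by (rule is_hypercircle[OF UC nn(2) S]) auto
qed

theorem theorem6p1:
  fixes \<alpha> :: "'k::field_char_0 alg_closure"
    and n :: nat
    and as :: "nat \<Rightarrow> 'k alg_closure"
    and U :: "'k alg_closure vec set"
  assumes "n = ext_degree \<alpha>"
    and "bij_betw as {1..n} (conjugates \<alpha>)"
    and "algebraic_set n U"
    and "has_curve_degree n U n"
    and "\<forall>C\<in>components n U. zariski_dim n C = 1"
  shows "primitive_hypercircle \<alpha> U \<longleftrightarrow>
           infinite {x \<in> U. \<forall>i<n. x $ i \<in> base_field} \<and>
           (\<forall>j\<in>{1..n}. point_at_infinity n as j \<in> proj_closure n U)"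
proof -
  \<comment> \<open>The given enumeration is what links the degree of the extension to the number of
    conjugates.\<close>
  have n: "n = card (conjugates \<alpha>)" using bij_betw_same_card[OF assms(2)] by simp
  have asj: "as j \<in> conjugates \<alpha>" if "j \<in> {1..n}" for j using assms(2) that bij_betwE by blast
  have cl: "point_at_infinity n as j \<in> proj_closure n U \<longleftrightarrow> in_closure n U (inf_vec \<alpha> (as j))" if j: "j \<in> {1..n}" for j
    unfolding point_at_infinity_eq[OF n assms(2) j]
    by (rule proj_closure_iff[OF algebraic_set_carrier[OF assms(3)] inf_vec_carrier[OF n] inf_vec_nonzero[OF n asj[OF j]]])
  show ?thesis
  proof
    assume "primitive_hypercircle \<alpha> U"
    then obtain a b c d q p \<phi> where P: "unit_param \<alpha> n a b c d q p \<phi>" and UH: "U = unit_param.H n \<phi>"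
      using hypercircle_param[OF n assms(1)] unfolding primitive_hypercircle_def by blast
    interpret unit_param \<alpha> n a b c d q p \<phi> by (rule P)
    have "in_closure n U (inf_vec \<alpha> \<beta>)" if "\<beta> \<in> conjugates \<alpha>" for \<beta>
      unfolding UH using poles_distinct[OF assms(4)[unfolded UH] _ that] by (intro inf_vec_in_closure that)
    then show "infinite {x \<in> U. \<forall>i<n. x $ i \<in> base_field} \<and>
           (\<forall>j\<in>{1..n}. point_at_infinity n as j \<in> proj_closure n U)"
      using infinite_base_points cl asj unfolding UH[symmetric] by blast
  next
    assume R: "infinite {x \<in> U. \<forall>i<n. x $ i \<in> base_field} \<and>
           (\<forall>j\<in>{1..n}. point_at_infinity n as j \<in> proj_closure n U)"
    have "in_closure n U (inf_vec \<alpha> \<beta>)" if \<beta>: "\<beta> \<in> conjugates \<alpha>" for \<beta>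
    proof -
      have "\<beta> \<in> as ` {1..n}" using \<beta> assms(2) by (simp add: bij_betw_def)
      then obtain j where "j \<in> {1..n}" "\<beta> = as j" by blast
      then show ?thesis using R cl by blast
    qed
    then show "primitive_hypercircle \<alpha> U"
      unfolding primitive_hypercircle_def using hypercircle_of_degree[OF n assms(1,3,4,5)] R assms(1,4) by simp
  qed
qed

end
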